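(* Let $\gamma\in[0,1/4)$, $\beta>0$, $L>0$. There exists a constant $c=c(\beta,L,\gamma)>0$ such that for all $n$ large enough, $$\inf_{\widehat W_n}\ \sup_{W_\rho\in\mathcal A(\beta,2,L)}\mathbb E\|\widehat W_n-W_\rho\|_\infty\ \ge\ c\,n^{-\frac{\beta}{2(\beta+\gamma)}}\log^{-3/2}(n)$$ and $$\inf_{\widehat W_n}\ \sup_{W_\rho\in\mathcal A(\beta,2,L)}\mathbb E\|\widehat W_n-W_\rho\|_2^2\ \ge\ c\,n^{-\frac{\beta}{\beta+\gamma}},$$ where the infima are over all estimators $\widehat W_n$ based on the i.i.d. sample $(Z_1,\Phi_1),\dots,(Z_n,\Phi_n)$ of noisy observations, and the suprema are over all quantum states $\rho$ whose Wigner function $W_\rho$ lies in $\mathcal A(\beta,2,L)$.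
   Context: Quantum states and Wigner functions. A quantum state $\rho$ is a self-adjoint, positive semidefinite, trace-one operator on $L^2(\mathbb R;\mathbb C)$. Let $\mathbf Q$ be multiplication by $x$ and $\mathbf P=-i\,d/dx$. The Wigner function $W_\rho:\mathbb R^2\to\mathbb R$ is the function whose Fourier transform $\widetilde W_\rho(u,v)=\iint e^{i(uq+vp)}W_\rho(q,p)\,dq\,dp$ equals $\mathrm{Tr}(\rho e^{i(u\mathbf Q+v\mathbf P)})$. For $\phi\in[0,\pi]$ let $p_\rho(\cdot|\phi)$ be the probability density on $\mathbb R$ with $\int e^{itx}p_\rho(x|\phi)\,dx=\widetilde W_\rho(t\cos\phi,t\sin\phi)$ for all $t\in\mathbb R$ (i.e. the Radon transform of $W_\rho$ at angle $\phi$). Data. One observes i.i.d. pairs $(Z_\ell,\Phi_\ell)$, $\ell=1,\dots,n$, with $\Phi_\ell$ uniform on $[0,\pi]$ and $Z_\ell=X_\ell+\sqrt{2\gamma}\,\xi_\ell$, where conditionally on $\Phi_\ell=\phi$ the variable $X_\ell$ has density $p_\rho(\cdot|\phi)$, and the $\xi_\ell$ are standard Gaussian, independent of each other and of all $(X_\ell,\Phi_\ell)$. $\mathbb E$ denotes expectation under this law. An estimator is any (measurable) function of the sample with values in functions on $\mathbb R^2$. Smoothness class. $\mathcal A(\beta,2,L)=\{f:\mathbb R^2\to\mathbb R:\ \iint|\widetilde f(u,v)|^2e^{2\beta\|(u,v)\|^2}du\,dv\le(2\pi)^2L\}$, where $\widetilde f$ is the Fourier transform in both variables and $\|\cdot\|$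 the Euclidean norm. $\|\cdot\|_\infty$ and $\|\cdot\|_2$ are the sup norm and the $L_2$ norm on $\mathbb R^2$. *)

theory Defs
  imports "HOL-Probability.Probability"
begin

section \<open>Square-integrable functions\<close>

text \<open>
  Elements of an \<open>L\<^sup>2\<close> space are represented by functions; identities between them are
  stated almost everywhere.
\<close>

definition L2_norm_sq :: "('a::euclidean_space \<Rightarrow> 'b::real_normed_vector) \<Rightarrow> ennreal" where
  "L2_norm_sq f = (\<integral>\<^sup>+x. ennreal ((norm (f x))\<^sup>2) \<partial>lborel)"

definition L2_fun :: "('a::euclidean_space \<Rightarrow> 'b::real_normed_vector) set" where
  "L2_fun = {f. f \<in> borel_measurable lborel \<and> L2_norm_sq f < \<infinity>}"

definition L2_inner :: "(real \<Rightarrow> complex) \<Rightarrow> (real \<Rightarrow> complex) \<Rightarrow> complex" where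
  "L2_inner f g = (LINT x|lborel. cnj (f x) * g x)"

section \<open>Operators on \<open>L\<^sup>2(\<real>; \<complex>)\<close>\<close>

type_synonym operator = "(real \<Rightarrow> complex) \<Rightarrow> (real \<Rightarrow> complex)"

text \<open>Linearity together with the norm bound makes such an operator respect a.e. equality.\<close>

definition bounded_operator :: "operator \<Rightarrow> bool" where
  "bounded_operator A \<longleftrightarrow>
     (\<forall>f\<in>L2_fun. A f \<in> L2_fun) \<and>
     (\<forall>f\<in>L2_fun. \<forall>g\<in>L2_fun. AE x in lborel. A (\<lambda>y. f y + g y) x = A f x + A g x) \<and>
     (\<forall>c. \<forall>f\<in>L2_fun. AE x in lborel. A (\<lambda>y. c * f y) x = c * A f x) \<and>
     (\<exists>C::real. \<forall>f\<in>L2_fun. L2_norm_sq (A f) \<le> ennreal C * L2_norm_sq f)"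

definition self_adjoint_operator :: "operator \<Rightarrow> bool" where
  "self_adjoint_operator A \<longleftrightarrow> (\<forall>f\<in>L2_fun. \<forall>g\<in>L2_fun. L2_inner f (A g) = L2_inner (A f) g)"

text \<open>For a self-adjoint \<open>A\<close> the inner product below is automatically real.\<close>

definition positive_semidefinite :: "operator \<Rightarrow> bool" where
  "positive_semidefinite A \<longleftrightarrow> (\<forall>f\<in>L2_fun. 0 \<le> Re (L2_inner f (A f)))"

definition orthonormal_basis :: "(nat \<Rightarrow> real \<Rightarrow> complex) \<Rightarrow> bool" where
  "orthonormal_basis e \<longleftrightarrow>
     (\<forall>j. e j \<in> L2_fun) \<and>
     (\<forall>j k. L2_inner (e j) (e k) = (if j = k then 1 else 0)) \<and>
     (\<forall>f\<in>L2_fun. (\<forall>j. L2_inner (e j) f = 0) \<longrightarrow> (AE x in lborel. f x = 0))"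

text \<open>
  For a bounded \<open>A\<close>, summability with respect to every orthonormal basis characterises the
  trace class.
\<close>

definition has_trace :: "operator \<Rightarrow> complex \<Rightarrow> bool" where
  "has_trace A \<tau> \<longleftrightarrow>
     (\<forall>e. orthonormal_basis e \<longrightarrow> ((\<lambda>j. L2_inner (e j) (A (e j))) has_sum \<tau>) UNIV)"

definition quantum_state :: "operator \<Rightarrow> bool" where
  "quantum_state \<rho> \<longleftrightarrow>
     bounded_operator \<rho> \<and> self_adjoint_operator \<rho> \<and> positive_semidefinite \<rho> \<and> has_trace \<rho> 1"

section \<open>The operators \<open>exp (\<i>(u Q + v P))\<close>\<close>

definition position_op :: operator where
  "position_op f = (\<lambda>x. of_real x * f x)"

definition momentum_op :: operator where
  "momentum_op f = (\<lambda>x. - \<i> * vector_derivative f (at x))"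

definition test_functions :: "(real \<Rightarrow> complex) set" where
  "test_functions = {f. f C1_differentiable_on UNIV \<and> (\<exists>R. \<forall>x. R < \<bar>x\<bar> \<longrightarrow> f x = 0)}"

text \<open>
  \<open>U\<close> is a strongly continuous one-parameter unitary group whose infinitesimal generator
  extends \<open>\<i> H\<close>, where \<open>H\<close> is given on the test functions.
  Surjectivity of each \<open>U t\<close> follows from the group law.
\<close>

definition unitary_group_generated_by :: "operator \<Rightarrow> (real \<Rightarrow> operator) \<Rightarrow> bool" where
  "unitary_group_generated_by H U \<longleftrightarrow>
     (\<forall>t. bounded_operator (U t)) \<and>
     (\<forall>t. \<forall>f\<in>L2_fun. \<forall>g\<in>L2_fun. L2_inner (U t f) (U t g) = L2_inner f g) \<and>
     (\<forall>f\<in>L2_fun. AE x in lborel. U 0 f x = f x) \<and>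
     (\<forall>s t. \<forall>f\<in>L2_fun. AE x in lborel. U (s + t) f x = U s (U t f) x) \<and>
     (\<forall>f\<in>L2_fun. ((\<lambda>t. L2_norm_sq (\<lambda>x. U t f x - f x)) \<longlongrightarrow> 0) (at 0)) \<and>
     (\<forall>f\<in>test_functions.
        ((\<lambda>t. L2_norm_sq (\<lambda>x. (U t f x - f x) / of_real t - \<i> * H f x)) \<longlongrightarrow> 0) (at 0))"

text \<open>
  \<open>A = exp (\<i> H)\<close> in the sense of Stone's theorem. If \<open>H\<close> is essentially self-adjoint on the
  test functions, as is every real combination \<open>u Q + v P\<close>, then \<open>A\<close> is uniquely determined
  (up to a.e. equality).
\<close>

definition is_exp_i :: "operator \<Rightarrow> operator \<Rightarrow> bool" where
  "is_exp_i H A \<longleftrightarrow> (\<exists>U. unitary_group_generated_by H U \<and> A = U 1)"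

text \<open>\<open>\<psi> (u, v)\<close> is the trace of \<open>\<rho> exp (\<i>(u Q + v P))\<close>.\<close>

definition characteristic_function :: "operator \<Rightarrow> (real \<times> real \<Rightarrow> complex) \<Rightarrow> bool" where
  "characteristic_function \<rho> \<psi> \<longleftrightarrow>
     (\<forall>u v. \<exists>A. is_exp_i (\<lambda>f x. of_real u * position_op f x + of_real v * momentum_op f x) A \<and>
                has_trace (\<rho> \<circ> A) (\<psi> (u, v)))"

section \<open>Fourier transform, Wigner function and smoothness class\<close>

definition fourier_integral :: "(real \<times> real \<Rightarrow> real) \<Rightarrow> real \<times> real \<Rightarrow> complex" where
  "fourier_integral f = (\<lambda>(u, v). LINT (q, p)|lborel. cis (u * q + v * p) * of_real (f (q, p)))"

text \<open>
  A Wigner function is square-integrable but need not be absolutely integrable. The Fourier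
  transform on \<open>L\<^sup>2\<close> is the \<open>L\<^sup>2\<close>-closure of the integral transform on \<open>L\<^sup>1 \<inter> L\<^sup>2\<close>; for \<open>f\<close> in
  \<open>L\<^sup>1 \<inter> L\<^sup>2\<close> it agrees a.e. with \<open>fourier_integral f\<close>.
\<close>

definition fourier_transform :: "(real \<times> real \<Rightarrow> real) \<Rightarrow> (real \<times> real \<Rightarrow> complex) \<Rightarrow> bool" where
  "fourier_transform f g \<longleftrightarrow> f \<in> L2_fun \<and> g \<in> L2_fun \<and>
     (\<exists>h :: nat \<Rightarrow> real \<times> real \<Rightarrow> real.
        (\<forall>k. integrable lborel (h k) \<and> h k \<in> L2_fun) \<and>
        (\<lambda>k. L2_norm_sq (\<lambda>z. h k z - f z)) \<longlonglongrightarrow> 0 \<and>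
        (\<lambda>k. L2_norm_sq (\<lambda>w. fourier_integral (h k) w - g w)) \<longlonglongrightarrow> 0)"

text \<open>
  The continuous representative is selected (every quantum state has one), so that pointwise
  values and the supremum norm are meaningful.
\<close>

definition wigner_function :: "operator \<Rightarrow> (real \<times> real \<Rightarrow> real) \<Rightarrow> bool" where
  "wigner_function \<rho> W \<longleftrightarrow>
     continuous_on UNIV W \<and> (\<exists>\<psi>. characteristic_function \<rho> \<psi> \<and> fourier_transform W \<psi>)"

definition smoothness_class :: "real \<Rightarrow> real \<Rightarrow> (real \<times> real \<Rightarrow> real) set" where
  "smoothness_class \<beta> L = {f. \<exists>g. fourier_transform f g \<and>
     (\<integral>\<^sup>+w. ennreal ((cmod (g w))\<^sup>2 * exp (2 * \<beta> * (norm w)\<^sup>2)) \<partial>lborel) \<le> ennreal ((2 * pi)\<^sup>2 * L)}"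

section \<open>The observations\<close>

text \<open>
  \<open>p x \<phi>\<close> stands for \<open>p\<^sub>\<rho>(x | \<phi>)\<close>. For each angle it is determined up to a null set of \<open>x\<close>,
  and a jointly measurable version exists for every state.
\<close>

definition homodyne_density :: "operator \<Rightarrow> (real \<Rightarrow> real \<Rightarrow> real) \<Rightarrow> bool" where
  "homodyne_density \<rho> p \<longleftrightarrow>
     (\<lambda>(x, \<phi>). p x \<phi>) \<in> borel_measurable borel \<and>
     (\<forall>\<phi>\<in>{0..pi}. (\<forall>x. 0 \<le> p x \<phi>) \<and> integrable lborel (\<lambda>x. p x \<phi>) \<and> (LINT x|lborel. p x \<phi>) = 1) \<and>
     (\<exists>\<psi>. characteristic_function \<rho> \<psi> \<and>
        (\<forall>\<phi>\<in>{0..pi}. \<forall>t. (LINT x|lborel. cis (t * x) * of_real (p x \<phi>)) = \<psi> (t * cos \<phi>, t * sin \<phi>)))"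

text \<open>
  The law of \<open>(Z, \<Phi>)\<close> with \<open>Z = X + sqrt (2 \<gamma>) \<xi>\<close>, where \<open>(X, \<Phi>)\<close> has joint density
  \<open>p x \<phi> / pi\<close> on \<open>\<real> \<times> [0, pi]\<close> and \<open>\<xi>\<close> is an independent standard Gaussian.
\<close>

definition observation_law :: "real \<Rightarrow> (real \<Rightarrow> real \<Rightarrow> real) \<Rightarrow> (real \<times> real) measure" where
  "observation_law \<gamma> p =
     distr (density lborel (\<lambda>(x, \<phi>). ennreal (indicator {0..pi} \<phi> * p x \<phi> / pi))
              \<Otimes>\<^sub>M density lborel (\<lambda>\<xi>. ennreal (std_normal_density \<xi>)))
           borel (\<lambda>((x, \<phi>), \<xi>). (x + sqrt (2 * \<gamma>) * \<xi>, \<phi>))"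

definition sample_law :: "real \<Rightarrow> (real \<Rightarrow> real \<Rightarrow> real) \<Rightarrow> nat \<Rightarrow> (nat \<Rightarrow> real \<times> real) measure" where
  "sample_law \<gamma> p n = PiM {..<n} (\<lambda>_. observation_law \<gamma> p)"

section \<open>Estimators, states and losses\<close>

text \<open>
  Joint measurability in the sample and in the point of the plane makes the \<open>L\<^sup>2\<close> loss
  measurable and the sup-norm loss universally measurable, so that the (lower) integral over
  the sample is the expected loss.
\<close>

definition estimators :: "nat \<Rightarrow> ((nat \<Rightarrow> real \<times> real) \<Rightarrow> real \<times> real \<Rightarrow> real) set" where
  "estimators n = {What. (\<lambda>(s, z). What s z) \<in>
     borel_measurable (PiM {..<n} (\<lambda>_. borel :: (real \<times> real) measure) \<Otimes>\<^sub>M borel)}"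

definition admissible_states ::
    "real \<Rightarrow> real \<Rightarrow> (operator \<times> (real \<times> real \<Rightarrow> real) \<times> (real \<Rightarrow> real \<Rightarrow> real)) set" where
  "admissible_states \<beta> L = {(\<rho>, W, p).
     quantum_state \<rho> \<and> wigner_function \<rho> W \<and> homodyne_density \<rho> p \<and> W \<in> smoothness_class \<beta> L}"

definition sup_norm :: "(real \<times> real \<Rightarrow> real) \<Rightarrow> ennreal" where
  "sup_norm f = (SUP z. ennreal \<bar>f z\<bar>)"

end

theory Submission
  imports Defs
begin

text \<open>
  Le Cam's two-point method, with hypotheses depending on \<open>n\<close>. Put \<open>r\<^sup>2 = ln n / (2 (\<beta> + \<gamma>))\<close>. The first
  hypothesis has as Wigner function the centred isotropic Gaussian density of variance \<open>r\<^sup>2\<close>, the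
  second one multiplies it by \<open>1 + \<epsilon> sin (r q)\<close>, where \<open>\<epsilon>\<close> is of order \<open>r exp (- \<beta> r\<^sup>2)\<close>. Everything
  is then explicit: since the spatial scale of the perturbation is that of the Gaussian itself,
  no tail of a reference density enters, and the perturbation has size \<open>exp (- 2 \<beta> r\<^sup>2)\<close> in squared
  \<open>L\<^sup>2\<close> norm and \<open>exp (- \<beta> r\<^sup>2) / r\<close> in sup norm, whereas the chi-square distance of one noisy
  observation is of order \<open>exp (- 2 (\<beta> + \<gamma>) r\<^sup>2) = 1 / n\<close>.

  Both functions belong to quantum states because they are Gaussian convolutions of positive
  densities, that is, mixtures of displaced squeezed coherent states. The squeezing \<open>a = \<beta> / 2\<close> in
  the direction of \<open>q\<close> makes deconvolution amplify the perturbation only by about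
  \<open>exp (\<beta> r\<^sup>2 / 2)\<close>, which \<open>\<epsilon>\<close> absorbs. That such a mixture is a state with the expected
  characteristic function follows from Parseval's identity for an arbitrary orthonormal basis
  and from the explicit form \<open>f \<mapsto> cis (u x + u v / 2) f (x + v)\<close> of \<open>exp (\<i> (u Q + v P))\<close>.
\<close>

section \<open>Square-integrable functions\<close>

text \<open>The family \<open>modulated V \<eta> l\<close> is parametrised so that each operation of
  the problem moves one parameter. Mixing and noise change only the variance, from
  \<open>V - a\<close> to \<open>V\<close> and then to \<open>V + 2 * \<gamma>\<close>; projection
  at angle \<phi> changes only \<open>l\<close>, to \<open>l * cos \<phi>\<close>; \<eta> never
  changes. So every density has a closed form, and one amplitude condition, at the smallest variance
  \<open>V - a\<close>, gives positivity everywhere. With \<open>R\<close> for the squared radius,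
  deconvolving by \<open>a\<close> multiplies the amplitude by about \<open>exp (a * R / 2)\<close>.
  The unsqueezed value 1/2 of \<open>a\<close> would exceed the available decay
  \<open>exp (- \<beta> * R)\<close> for \<beta> below 1/4, hence a squeezing proportional to
  \<beta>. The factor r in the amplitude is a gain from averaging over the angle: only angles within
  about \<open>1 / R\<close> of 0 and pi see the oscillation, which divides the chi-square distance
  by about \<open>R\<close>. In squared L2 norm this gain offsets the factor \<open>1 / R\<close>
  lost because the Gaussian spreads over an area of order \<open>R\<close>.\<close>

lemma L2_fun_iff:
  fixes f :: "'a::euclidean_space \<Rightarrow> 'b::real_normed_vector"
  shows "f \<in> L2_fun \<longleftrightarrow> f \<in> borel_measurable borel \<and> integrable lborel (\<lambda>x. (norm (f x))\<^sup>2)"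
proof (cases "f \<in> borel_measurable borel")
  case True
  have "(L2_norm_sq f < \<infinity>) = integrable lborel (\<lambda>x. (norm (f x))\<^sup>2)"
    using True by (simp add: integrable_iff_bounded L2_norm_sq_def)
  with True show ?thesis by (simp add: L2_fun_def)
qed (simp add: L2_fun_def)

lemma L2_funI:
  assumes "f \<in> borel_measurable borel" "integrable lborel (\<lambda>x. (norm (f x))\<^sup>2)"
  shows "f \<in> L2_fun"
  using assms by (simp add: L2_fun_iff)

lemma L2_fun_measurable [measurable_dest]: "f \<in> L2_fun \<Longrightarrow> f \<in> borel_measurable borel"
  and L2_fun_integrable: "f \<in> L2_fun \<Longrightarrow> integrable lborel (\<lambda>x. (norm (f x))\<^sup>2)"
  by (simp_all add: L2_fun_iff)

lemma L2_fun_bound: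
  fixes f :: "'a::euclidean_space \<Rightarrow> 'b::real_normed_vector"
  assumes "f \<in> borel_measurable borel" "integrable lborel g" "\<And>x. (norm (f x))\<^sup>2 \<le> g x"
  shows "f \<in> L2_fun"
proof (rule L2_funI)
  show "integrable lborel (\<lambda>x. (norm (f x))\<^sup>2)"
    by (rule Bochner_Integration.integrable_bound[OF assms(2)])
       (use assms in \<open>auto intro: order_trans[OF _ abs_ge_self]\<close>)
qed (fact assms(1))

text \<open>Real-valued twin of \<open>L2_norm_sq\<close>, so that subtraction and limits can be
  done in the reals. A Bochner integral silently returns 0 when the square is not integrable, so
  agreement with \<open>L2_norm_sq\<close> is claimed on \<open>L2_fun\<close>.\<close>

definition nsq :: "(real \<Rightarrow> complex) \<Rightarrow> real" where
  "nsq f = (LINT x|lborel. (cmod (f x))\<^sup>2)"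

lemma nsq_nonneg [simp]: "0 \<le> nsq f"
  by (simp add: nsq_def)

lemma L2_norm_sq_eq_nsq: "f \<in> L2_fun \<Longrightarrow> L2_norm_sq f = ennreal (nsq f)"
  by (simp add: L2_norm_sq_def nsq_def nn_integral_eq_integral L2_fun_integrable)

lemma norm_add_sq_le: "(norm (a + b :: 'a::real_normed_vector))\<^sup>2 \<le> 2 * (norm a)\<^sup>2 + 2 * (norm b)\<^sup>2"
proof -
  have "(norm (a + b))\<^sup>2 \<le> (norm a + norm b)\<^sup>2"
    by (intro power_mono norm_triangle_ineq) auto
  also have "\<dots> \<le> 2 * (norm a)\<^sup>2 + 2 * (norm b)\<^sup>2"
    using zero_le_power2[of "norm a - norm b"] unfolding power2_sum power2_diff by linarith
  finally show ?thesis .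
qed

lemma norm_mult_norm_le: "norm a * norm b \<le> (norm (a :: 'a::real_normed_vector))\<^sup>2 + (norm (b :: 'b::real_normed_vector))\<^sup>2"
proof -
  have "0 \<le> norm a * norm b" by simp
  then show ?thesis using zero_le_power2[of "norm a - norm b"] unfolding power2_diff by linarith
qed

lemma L2_fun_add:
  fixes f g :: "real \<Rightarrow> complex"
  assumes f: "f \<in> L2_fun" and g: "g \<in> L2_fun"
  shows "(\<lambda>x. f x + g x) \<in> L2_fun"
  using f g by (intro L2_fun_bound[where g="\<lambda>x. 2 * (cmod (f x))\<^sup>2 + 2 * (cmod (g x))\<^sup>2"])
    (auto intro!: norm_add_sq_le L2_fun_integrable)

lemma L2_fun_mult:
  fixes f :: "real \<Rightarrow> complex"
  assumes f: "f \<in> L2_fun"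
  shows "(\<lambda>x. c * f x) \<in> L2_fun"
  using f by (intro L2_fun_bound[where g="\<lambda>x. (cmod c)\<^sup>2 * (cmod (f x))\<^sup>2"])
    (auto intro!: L2_fun_integrable simp: norm_mult power_mult_distrib)

lemma L2_fun_diff:
  fixes f g :: "real \<Rightarrow> complex"
  assumes f: "f \<in> L2_fun" and g: "g \<in> L2_fun"
  shows "(\<lambda>x. f x - g x) \<in> L2_fun"
  using L2_fun_add[OF f L2_fun_mult[OF g, of "-1"]] by simp

lemma L2_fun_zero [simp]: "(\<lambda>x. 0 :: complex) \<in> (L2_fun :: (real \<Rightarrow> complex) set)"
  by (simp add: L2_fun_iff)

lemma L2_fun_sum:
  fixes f :: "'i \<Rightarrow> real \<Rightarrow> complex"
  shows "(\<And>i. i \<in> I \<Longrightarrow> f i \<in> L2_fun) \<Longrightarrow> (\<lambda>x. \<Sum>i\<in>I. f i x) \<in> L2_fun"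
proof (induction I rule: infinite_finite_induct)
  case (insert i I) then show ?case by (simp add: L2_fun_add)
qed simp_all

lemma borel_measurable_cnj [measurable (raw)]:
  "f \<in> borel_measurable M \<Longrightarrow> (\<lambda>x. cnj (f x)) \<in> borel_measurable M"
  by (rule borel_measurable_continuous_on[OF continuous_on_cnj[OF continuous_on_id]])

lemma L2_inner_integrable:
  assumes f: "f \<in> L2_fun" and g: "g \<in> L2_fun"
  shows "integrable lborel (\<lambda>x. cnj (f x) * g x :: complex)"
proof (rule Bochner_Integration.integrable_bound[where f="\<lambda>x. (cmod (f x))\<^sup>2 + (cmod (g x))\<^sup>2"])
  show "AE x in lborel. norm (cnj (f x) * g x) \<le> norm ((cmod (f x))\<^sup>2 + (cmod (g x))\<^sup>2)"
    by (intro AE_I2) (use norm_mult_norm_le in \<open>simp add: norm_mult\<close>)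
  show "(\<lambda>x. cnj (f x) * g x) \<in> borel_measurable lborel"
    using f g by measurable
qed (use f g in \<open>auto intro: L2_fun_integrable\<close>)

lemma L2_inner_add_right:
  "f \<in> L2_fun \<Longrightarrow> g \<in> L2_fun \<Longrightarrow> h \<in> L2_fun \<Longrightarrow>
    L2_inner f (\<lambda>x. g x + h x) = L2_inner f g + L2_inner f h"
  unfolding L2_inner_def by (simp add: distrib_left L2_inner_integrable)

lemma L2_inner_diff_right:
  "f \<in> L2_fun \<Longrightarrow> g \<in> L2_fun \<Longrightarrow> h \<in> L2_fun \<Longrightarrow>
    L2_inner f (\<lambda>x. g x - h x) = L2_inner f g - L2_inner f h"
  unfolding L2_inner_def by (simp add: right_diff_distrib L2_inner_integrable)

lemma L2_inner_mult_right: "L2_inner f (\<lambda>x. c * g x) = c * L2_inner f g"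
proof -
  have "L2_inner f (\<lambda>x. c * g x) = (LINT x|lborel. c * (cnj (f x) * g x))"
    unfolding L2_inner_def by (simp add: mult.left_commute)
  then show ?thesis unfolding L2_inner_def by simp
qed

lemma L2_inner_commute: "L2_inner g f = cnj (L2_inner f g)"
proof -
  have "L2_inner g f = (LINT x|lborel. cnj (cnj (f x) * g x))"
    unfolding L2_inner_def by (simp add: mult.commute)
  also have "\<dots> = cnj (L2_inner f g)"
    unfolding L2_inner_def by (rule Bochner_Integration.integral_cnj)
  finally show ?thesis .
qed

lemma L2_inner_sum_right:
  assumes "f \<in> L2_fun" "\<And>i. i \<in> I \<Longrightarrow> g i \<in> L2_fun"
  shows "L2_inner f (\<lambda>x. \<Sum>i\<in>I. g i x) = (\<Sum>i\<in>I. L2_inner f (g i))"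
  unfolding L2_inner_def sum_distrib_left using assms
  by (intro Bochner_Integration.integral_sum L2_inner_integrable) auto

lemma L2_inner_self: "L2_inner f f = of_real (nsq f)"
proof -
  have "L2_inner f f = (LINT x|lborel. complex_of_real ((cmod (f x))\<^sup>2))"
    unfolding L2_inner_def by (simp only: complex_norm_square mult.commute)
  also have "\<dots> = of_real (nsq f)"
    unfolding nsq_def by (rule Bochner_Integration.integral_complex_of_real)
  finally show ?thesis .
qed

lemma nsq_diff:
  assumes f: "f \<in> L2_fun" and g: "g \<in> L2_fun"
  shows "nsq (\<lambda>x. f x - g x) = nsq f - 2 * Re (L2_inner f g) + nsq g"
proof -
  have fg: "(\<lambda>x. f x - g x) \<in> L2_fun" using f g by (rule L2_fun_diff)
  have left: "L2_inner (\<lambda>x. f x - g x) h = cnj (L2_inner h f - L2_inner h g)" if h: "h \<in> L2_fun" for h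
    by (simp add: L2_inner_commute[of "\<lambda>x. f x - g x" h] L2_inner_diff_right[OF h f g])
  have "L2_inner (\<lambda>x. f x - g x) (\<lambda>x. f x - g x)
      = L2_inner (\<lambda>x. f x - g x) f - L2_inner (\<lambda>x. f x - g x) g"
    by (rule L2_inner_diff_right[OF fg f g])
  also have "\<dots> = cnj (L2_inner f f - L2_inner f g) - cnj (L2_inner g f - L2_inner g g)"
    by (simp only: left[OF f] left[OF g])
  finally have "Re (L2_inner (\<lambda>x. f x - g x) (\<lambda>x. f x - g x)) = Re (L2_inner f f) - Re (L2_inner f g) - Re (L2_inner g f) + Re (L2_inner g g)"
    by simp
  moreover have "Re (L2_inner g f) = Re (L2_inner f g)"
    by (subst L2_inner_commute) simp
  ultimately show ?thesis by (simp add: L2_inner_self)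
qed

lemma nsq_mult: "nsq (\<lambda>x. c * f x) = (cmod c)\<^sup>2 * nsq f"
  unfolding nsq_def by (simp add: norm_mult power_mult_distrib)

text \<open>Nonnegativity of \<open>nsq\<close> along f minus t w g, with t real and w the inner
  product of g and f. The factor w makes the mixed term real, so a real parameter suffices in the
  complex case.\<close>

lemma L2_Cauchy_Schwarz:
  assumes f: "f \<in> L2_fun" and g: "g \<in> L2_fun"
  shows "(cmod (L2_inner f g))\<^sup>2 \<le> nsq f * nsq g"
proof -
  define w where "w = L2_inner g f"
  have w: "cmod (L2_inner f g) = cmod w"
    unfolding w_def by (subst L2_inner_commute) simp
  have quad: "0 \<le> nsq f - 2 * t * (cmod w)\<^sup>2 + t\<^sup>2 * (cmod w)\<^sup>2 * nsq g" for t :: real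
  proof -
    have "0 \<le> nsq (\<lambda>x. f x - (of_real t * w) * g x)" by simp
    also have "\<dots> = nsq f - 2 * Re (L2_inner f (\<lambda>x. (of_real t * w) * g x)) + nsq (\<lambda>x. (of_real t * w) * g x)"
      by (rule nsq_diff[OF f L2_fun_mult[OF g]])
    also have "L2_inner f (\<lambda>x. (of_real t * w) * g x) = of_real t * (w * cnj w)"
      by (simp add: L2_inner_mult_right w_def L2_inner_commute[of f g])
    also have "Re \<dots> = t * (cmod w)\<^sup>2"
      by (simp add: complex_norm_square[symmetric] flip: of_real_mult of_real_power)
    finally show ?thesis by (simp add: nsq_mult norm_mult power_mult_distrib algebra_simps)
  qed
  show ?thesis
  proof (cases "nsq g = 0")
    case True
    have "(cmod w)\<^sup>2 = 0"
    proof (rule ccontr)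
      assume nz: "(cmod w)\<^sup>2 \<noteq> 0"
      \<comment> \<open>When \<open>nsq g\<close> is 0 the polynomial is affine in the parameter;
        this value brings it down to -1.\<close>
      have "0 \<le> nsq f - 2 * ((nsq f + 1) / (2 * (cmod w)\<^sup>2)) * (cmod w)\<^sup>2"
        using quad[of "(nsq f + 1) / (2 * (cmod w)\<^sup>2)"] True by simp
      also have "2 * ((nsq f + 1) / (2 * (cmod w)\<^sup>2)) * (cmod w)\<^sup>2 = nsq f + 1" using nz by simp
      finally show False by simp
    qed
    then show ?thesis using w by simp
  next
    case False
    then have p: "0 < nsq g" using nsq_nonneg[of g] by linarith
    have "0 \<le> nsq f - 2 * (1 / nsq g) * (cmod w)\<^sup>2 + (1 / nsq g)\<^sup>2 * (cmod w)\<^sup>2 * nsq g" by (rule quad)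
    also have "\<dots> = nsq f - (cmod w)\<^sup>2 / nsq g" using p by (simp add: field_simps power2_eq_square)
    finally show ?thesis using p w by (simp add: field_simps)
  qed
qed

section \<open>Completeness and Parseval's identity\<close>

text \<open>Riesz-Fischer: a subsequence with geometrically small steps converges almost everywhere,
  and Fatou's lemma carries the Cauchy bound over to the pointwise limit.\<close>

theorem L2_complete:
  fixes s :: "nat \<Rightarrow> real \<Rightarrow> complex"
  assumes s: "\<And>n. s n \<in> L2_fun"
    and Cauchy: "\<And>e. 0 < e \<Longrightarrow> \<exists>N. \<forall>m\<ge>N. \<forall>n\<ge>N. nsq (\<lambda>x. s m x - s n x) < e"
  obtains g where "g \<in> L2_fun" "(\<lambda>n. nsq (\<lambda>x. s n x - g x)) \<longlonglongrightarrow> 0"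
proof -
  have [measurable]: "s n \<in> borel_measurable borel" for n
    using s by (rule L2_fun_measurable)
  have "\<exists>N. \<forall>m\<ge>N. \<forall>n\<ge>N. nsq (\<lambda>x. s m x - s n x) < (1/4)^i" for i :: nat
    by (rule Cauchy) simp
  then obtain N where N: "\<And>i m n. N i \<le> m \<Longrightarrow> N i \<le> n \<Longrightarrow> nsq (\<lambda>x. s m x - s n x) < (1/4)^i"
    by metis
  \<comment> \<open>The sum secures both monotonicity and \<open>N i \<le> k i\<close>; the added i
    secures \<open>m \<le> k m\<close>, which the Fatou step uses.\<close>
  define k where "k i = (\<Sum>j\<le>i. N j) + i" for i
  have k_mono: "k i \<le> k (Suc i)" for i by (simp add: k_def)
  have Nk: "N i \<le> k i" for i unfolding k_def by (auto intro!: trans_le_add1 member_le_sum)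
  define d where "d i x = s (k (Suc i)) x - s (k i) x" for i x
  have d: "d i \<in> L2_fun" for i unfolding d_def by (intro L2_fun_diff s)
  then have [measurable]: "d i \<in> borel_measurable borel" for i by (rule L2_fun_measurable)
  have d_small: "nsq (d i) \<le> (1/4)^i" for i
    using N[of i "k (Suc i)" "k i"] Nk[of i] k_mono[of i] unfolding d_def by force
  \<comment> \<open>The weights \<open>2^i\<close> turn a.e. finiteness of the sum into a geometric bound on \<open>d i x\<close>.\<close>
  have "(\<integral>\<^sup>+x. (\<Sum>i. ennreal (2^i * (cmod (d i x))\<^sup>2)) \<partial>lborel) = (\<Sum>i. \<integral>\<^sup>+x. ennreal (2^i * (cmod (d i x))\<^sup>2) \<partial>lborel)"
    by (rule nn_integral_suminf) measurable
  also have "\<dots> = (\<Sum>i. ennreal (2^i * nsq (d i)))"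
    unfolding nsq_def by (subst nn_integral_eq_integral) (auto simp: L2_fun_integrable[OF d])
  also have "\<dots> \<le> (\<Sum>i. ennreal ((1/2)^i))"
  proof (intro suminf_le ennreal_leI)
    fix i :: nat
    have "2^i * nsq (d i) \<le> 2^i * (1/4)^i" by (intro mult_left_mono d_small) simp
    also have "\<dots> = (1/2)^i" by (simp flip: power_mult_distrib)
    finally show "2^i * nsq (d i) \<le> (1/2)^i" .
  qed auto
  also have "\<dots> = ennreal (\<Sum>i. (1/2)^i)"
    by (intro suminf_ennreal2 summable_geometric) auto
  also have "\<dots> < \<infinity>" by simp
  finally have "AE x in lborel. (\<Sum>i. ennreal (2^i * (cmod (d i x))\<^sup>2)) \<noteq> \<infinity>"
    by (intro nn_integral_PInf_AE) auto
  then have conv: "AE x in lborel. convergent (\<lambda>n. s (k n) x)"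
  proof eventually_elim
    fix x assume x: "(\<Sum>i. ennreal (2^i * (cmod (d i x))\<^sup>2)) \<noteq> \<infinity>"
    then have S: "summable (\<lambda>i. 2^i * (cmod (d i x))\<^sup>2)"
      by (intro summable_suminf_not_top) auto
    define C where "C = (\<Sum>i. 2^i * (cmod (d i x))\<^sup>2)"
    have "2^i * (cmod (d i x))\<^sup>2 \<le> C" for i
      unfolding C_def using sum_le_suminf[OF S, of "{i}"] by simp
    then have le: "cmod (d i x) \<le> sqrt C * (1 / sqrt 2)^i" for i
    proof -
      assume *: "\<And>i. 2^i * (cmod (d i x))\<^sup>2 \<le> C"
      have "(cmod (d i x))\<^sup>2 \<le> C * (1/2)^i" using *[of i] by (simp add: field_simps)
      then have "cmod (d i x) \<le> sqrt (C * (1/2)^i)" by (rule real_le_rsqrt)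
      then show ?thesis by (simp add: real_sqrt_mult real_sqrt_power real_sqrt_divide)
    qed
    have "summable (\<lambda>i. sqrt C * (1 / sqrt 2)^i)"
      by (intro summable_mult summable_geometric) (simp add: real_less_rsqrt)
    then have "summable (\<lambda>i. d i x)"
      by (rule summable_comparison_test') (use le in auto)
    then have "convergent (\<lambda>n. s (k 0) x + (\<Sum>i<n. d i x))"
      by (intro convergent_add convergent_const) (simp add: summable_iff_convergent)
    moreover have "s (k 0) x + (\<Sum>i<n. d i x) = s (k n) x" for n
      using sum_lessThan_telescope[of "\<lambda>i. s (k i) x" n] by (simp add: d_def)
    ultimately show "convergent (\<lambda>n. s (k n) x)" by simp
  qed
  define g where "g x = lim (\<lambda>n. s (k n) x)" for x
  have [measurable]: "g \<in> borel_measurable borel"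
    unfolding g_def[abs_def] by measurable
  have lim: "AE x in lborel. (\<lambda>n. s (k n) x) \<longlonglongrightarrow> g x"
    using conv by eventually_elim (simp add: g_def convergent_LIMSEQ_iff)
  have tail: "L2_norm_sq (\<lambda>x. s n x - g x) \<le> ennreal ((1/4)^i)" if n: "N i \<le> n" for n i
  proof -
    have "L2_norm_sq (\<lambda>x. s n x - g x) = (\<integral>\<^sup>+x. liminf (\<lambda>m. ennreal ((cmod (s n x - s (k m) x))\<^sup>2)) \<partial>lborel)"
      unfolding L2_norm_sq_def using lim
    proof (intro nn_integral_cong_AE, eventually_elim)
      fix x assume x: "(\<lambda>n. s (k n) x) \<longlonglongrightarrow> g x"
      have "(\<lambda>m. ennreal ((cmod (s n x - s (k m) x))\<^sup>2)) \<longlonglongrightarrow> ennreal ((cmod (s n x - g x))\<^sup>2)"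
        by (intro tendsto_ennrealI tendsto_power tendsto_norm tendsto_diff tendsto_const x)
      then show "ennreal ((cmod (s n x - g x))\<^sup>2) = liminf (\<lambda>m. ennreal ((cmod (s n x - s (k m) x))\<^sup>2))"
        by (intro lim_imp_Liminf[symmetric]) auto
    qed
    also have "\<dots> \<le> liminf (\<lambda>m. \<integral>\<^sup>+x. ennreal ((cmod (s n x - s (k m) x))\<^sup>2) \<partial>lborel)"
      by (rule nn_integral_liminf) measurable
    also have "\<dots> \<le> ennreal ((1/4)^i)"
    proof (rule Liminf_le)
      show "eventually (\<lambda>m. (\<integral>\<^sup>+x. ennreal ((cmod (s n x - s (k m) x))\<^sup>2) \<partial>lborel) \<le> ennreal ((1/4)^i)) sequentially"
        using eventually_ge_at_top[of "N i"]
      proof eventually_elim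
        fix m assume "N i \<le> m"
        then have "N i \<le> k m" unfolding k_def by linarith
        then have "nsq (\<lambda>x. s n x - s (k m) x) \<le> (1/4)^i" using N n by (force intro: less_imp_le)
        then show "(\<integral>\<^sup>+x. ennreal ((cmod (s n x - s (k m) x))\<^sup>2) \<partial>lborel) \<le> ennreal ((1/4)^i)"
          using L2_norm_sq_eq_nsq[OF L2_fun_diff[OF s[of n] s[of "k m"]]]
          by (simp add: L2_norm_sq_def ennreal_leI)
      qed
    qed simp
    finally show ?thesis .
  qed
  have L2: "(\<lambda>x. s n x - g x) \<in> L2_fun" if "N 0 \<le> n" for n
    using tail[OF that] by (auto simp: L2_fun_def intro: le_less_trans)
  have "(\<lambda>x. s (N 0) x - (s (N 0) x - g x)) \<in> L2_fun"
    by (intro L2_fun_diff s L2) simp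
  then have g: "g \<in> L2_fun" by simp
  show ?thesis
  proof (rule that[OF g])
    show "(\<lambda>n. nsq (\<lambda>x. s n x - g x)) \<longlonglongrightarrow> 0"
    proof (rule LIMSEQ_I)
      fix e :: real assume e: "0 < e"
      obtain i where i: "(1/4::real)^i < e" using real_arch_pow_inv[OF e, of "1/4"] by auto
      have "norm (nsq (\<lambda>x. s n x - g x) - 0) < e" if "n \<ge> N i" for n
      proof -
        have "ennreal (nsq (\<lambda>x. s n x - g x)) \<le> ennreal ((1/4)^i)"
          using tail[OF that] L2_norm_sq_eq_nsq[OF L2_fun_diff[OF s[of n] g]] by simp
        then show ?thesis using i by (simp add: ennreal_le_iff)
      qed
      then show "\<exists>no. \<forall>n\<ge>no. norm (nsq (\<lambda>x. s n x - g x) - 0) < e" by blast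
    qed
  qed
qed

lemma L2_inner_tendsto:
  assumes "f \<in> L2_fun" "\<And>n. s n \<in> L2_fun" "g \<in> L2_fun"
    and "(\<lambda>n. nsq (\<lambda>x. s n x - g x)) \<longlonglongrightarrow> 0"
  shows "(\<lambda>n. L2_inner f (s n)) \<longlonglongrightarrow> L2_inner f g"
proof -
  have "(\<lambda>n. sqrt (nsq f * nsq (\<lambda>x. s n x - g x))) \<longlonglongrightarrow> sqrt (nsq f * 0)"
    by (intro tendsto_real_sqrt tendsto_mult tendsto_const assms)
  then have lim: "(\<lambda>n. sqrt (nsq f * nsq (\<lambda>x. s n x - g x))) \<longlonglongrightarrow> 0" by simp
  have "norm (L2_inner f (s n) - L2_inner f g) \<le> sqrt (nsq f * nsq (\<lambda>x. s n x - g x))" for n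
    using L2_Cauchy_Schwarz[of f "\<lambda>x. s n x - g x"] assms
    by (intro real_le_rsqrt) (simp add: L2_fun_diff L2_inner_diff_right)
  then have "(\<lambda>n. L2_inner f (s n) - L2_inner f g) \<longlonglongrightarrow> 0"
    by (intro Lim_null_comparison[OF _ lim]) auto
  then show ?thesis by (simp add: LIM_zero_iff)
qed

text \<open>A basis is defined by the absence of nonzero orthogonal vectors, so the series must
  first be given a limit: its partial sums are Cauchy by Bessel's inequality,
  \<open>L2_complete\<close> provides g, and f - g is orthogonal to every \<open>e k\<close>, hence
  0 almost everywhere.\<close>

lemma orthonormal_expansion:
  assumes e: "orthonormal_basis e" and f: "f \<in> L2_fun"
  shows Bessel_summable: "summable (\<lambda>j. (cmod (L2_inner (e j) f))\<^sup>2)"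
    and Parseval_self: "(\<Sum>j. (cmod (L2_inner (e j) f))\<^sup>2) = nsq f"
    and orthonormal_expansion_inner:
      "h \<in> L2_fun \<Longrightarrow> (\<lambda>j. L2_inner (e j) f * L2_inner h (e j)) sums L2_inner h f"
proof -
  have eL: "e j \<in> L2_fun" for j using e by (simp add: orthonormal_basis_def)
  have eo: "L2_inner (e j) (e k) = (if j = k then 1 else 0)" for j k
    using e by (simp add: orthonormal_basis_def)
  define c where "c j = L2_inner (e j) f" for j
  define S where "S I x = (\<Sum>j\<in>I. c j * e j x)" for I :: "nat set" and x
  have SL: "S I \<in> L2_fun" for I unfolding S_def by (intro L2_fun_sum L2_fun_mult eL)
  have hS: "L2_inner h (S I) = (\<Sum>j\<in>I. c j * L2_inner h (e j))" if "h \<in> L2_fun" for h I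
    unfolding S_def using that by (simp add: L2_inner_sum_right L2_fun_mult eL L2_inner_mult_right)
  have cc: "c j * cnj (c j) = of_real ((cmod (c j))\<^sup>2)" for j
    by (simp only: complex_norm_square)
  have fS: "L2_inner f (S I) = of_real (\<Sum>j\<in>I. (cmod (c j))\<^sup>2)" for I
    using hS[OF f, of I] unfolding L2_inner_commute[of f "e _"] c_def[symmetric] cc by simp
  have eS: "L2_inner (e k) (S I) = (if k \<in> I then c k else 0)" if "finite I" for k I
    using that by (simp add: hS[OF eL] eo if_distrib sum.delta' cong: if_cong)
  have SS: "nsq (S I) = (\<Sum>j\<in>I. (cmod (c j))\<^sup>2)" if "finite I" for I
  proof -
    have "of_real (nsq (S I)) = (\<Sum>j\<in>I. c j * cnj (c j))"
      unfolding L2_inner_self[symmetric] hS[OF SL]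
      using that by (intro sum.cong refl) (simp add: L2_inner_commute[of "S I" "e _"] eS)
    also have "\<dots> = of_real (\<Sum>j\<in>I. (cmod (c j))\<^sup>2)" unfolding cc by simp
    finally show ?thesis by (simp only: of_real_eq_iff)
  qed
  have fS_nsq: "nsq (\<lambda>x. f x - S I x) = nsq f - (\<Sum>j\<in>I. (cmod (c j))\<^sup>2)" if "finite I" for I
    unfolding nsq_diff[OF f SL] fS SS[OF that] by simp
  have partial: "(\<Sum>j\<in>I. (cmod (c j))\<^sup>2) \<le> nsq f" if "finite I" for I
    using fS_nsq[OF that] nsq_nonneg[of "\<lambda>x. f x - S I x"] by linarith
  have summ: "summable (\<lambda>j. (cmod (c j))\<^sup>2)"
    by (rule summableI_nonneg_bounded[where x="nsq f"]) (auto intro: partial)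
  then show "summable (\<lambda>j. (cmod (L2_inner (e j) f))\<^sup>2)" by (simp add: c_def)
  \<comment> \<open>Pythagoras: distances of partial sums are increments of the convergent real
    series of squared coefficients.\<close>
  have Sdiff: "nsq (\<lambda>x. S {..<m} x - S {..<n} x) = \<bar>(\<Sum>j<m. (cmod (c j))\<^sup>2) - (\<Sum>j<n. (cmod (c j))\<^sup>2)\<bar>" for m n
  proof -
    have *: "nsq (\<lambda>x. S {..<m} x - S {..<n} x) = (\<Sum>j<m. (cmod (c j))\<^sup>2) - (\<Sum>j<n. (cmod (c j))\<^sup>2)" if "n \<le> m" for m n
    proof -
      have "(\<lambda>x. S {..<m} x - S {..<n} x) = S {n..<m}"
        unfolding S_def lessThan_atLeast0 using that by (auto simp: fun_eq_iff sum_diff_nat_ivl)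
      moreover have "(\<Sum>j<m. (cmod (c j))\<^sup>2) - (\<Sum>j<n. (cmod (c j))\<^sup>2) = (\<Sum>j\<in>{n..<m}. (cmod (c j))\<^sup>2)"
        unfolding lessThan_atLeast0 using that by (subst sum_diff_nat_ivl) auto
      ultimately show ?thesis by (simp add: SS)
    qed
    have sym: "nsq (\<lambda>x. S {..<m} x - S {..<n} x) = nsq (\<lambda>x. S {..<n} x - S {..<m} x)"
      unfolding nsq_def by (simp add: norm_minus_commute)
    show ?thesis
    proof (cases "n \<le> m")
      case True
      then show ?thesis using *[OF True] nsq_nonneg[of "\<lambda>x. S {..<m} x - S {..<n} x"] by simp
    next
      case False
      then show ?thesis using *[of m n] sym nsq_nonneg[of "\<lambda>x. S {..<n} x - S {..<m} x"] by simp
    qed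
  qed
  obtain g where g: "g \<in> L2_fun" and lim: "(\<lambda>n. nsq (\<lambda>x. S {..<n} x - g x)) \<longlonglongrightarrow> 0"
  proof (rule L2_complete[of "\<lambda>n. S {..<n}"])
    fix \<epsilon> :: real assume "0 < \<epsilon>"
    then have "\<exists>N. \<forall>m\<ge>N. \<forall>n\<ge>N. norm ((\<Sum>j<m. (cmod (c j))\<^sup>2) - (\<Sum>j<n. (cmod (c j))\<^sup>2)) < \<epsilon>"
      using summ by (intro CauchyD) (auto simp: summable_iff_convergent convergent_eq_Cauchy[symmetric] convergent_def dest: LIMSEQ_imp_Cauchy)
    then show "\<exists>N. \<forall>m\<ge>N. \<forall>n\<ge>N. nsq (\<lambda>x. S {..<m} x - S {..<n} x) < \<epsilon>"
      unfolding Sdiff by simp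
  qed (rule SL)
  have "L2_inner (e k) (\<lambda>x. f x - g x) = 0" for k
  proof -
    have "(\<lambda>n. L2_inner (e k) (S {..<n})) \<longlonglongrightarrow> L2_inner (e k) g"
      by (rule L2_inner_tendsto[OF eL SL g lim])
    moreover have "(\<lambda>n. L2_inner (e k) (S {..<n})) \<longlonglongrightarrow> c k"
      by (rule tendsto_eventually) (use eventually_gt_at_top[of k] in \<open>eventually_elim, simp add: eS\<close>)
    ultimately have "L2_inner (e k) g = c k" by (rule LIMSEQ_unique)
    then show ?thesis by (simp add: L2_inner_diff_right[OF eL f g] c_def)
  qed
  then have fg: "AE x in lborel. f x - g x = 0"
    using e L2_fun_diff[OF f g] unfolding orthonormal_basis_def by blast
  have inner_fg: "L2_inner h g = L2_inner h f" if "h \<in> L2_fun" for h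
    unfolding L2_inner_def using that f g fg by (intro integral_cong_AE) auto
  have sums: "(\<lambda>j. c j * L2_inner h (e j)) sums L2_inner h f" if h: "h \<in> L2_fun" for h
    using L2_inner_tendsto[OF h SL g lim] unfolding inner_fg[OF h] sums_def hS[OF h] .
  then show "h \<in> L2_fun \<Longrightarrow> (\<lambda>j. L2_inner (e j) f * L2_inner h (e j)) sums L2_inner h f"
    by (simp add: c_def)
  have "(\<lambda>j. of_real ((cmod (c j))\<^sup>2)) sums complex_of_real (nsq f)"
    using sums[OF f] unfolding L2_inner_commute[of f "e _"] c_def[symmetric] cc L2_inner_self .
  then have "(\<lambda>j. (cmod (c j))\<^sup>2) sums nsq f" by (simp only: sums_of_real_iff)
  then show "(\<Sum>j. (cmod (L2_inner (e j) f))\<^sup>2) = nsq f" by (simp add: c_def sums_iff)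
qed

section \<open>Weyl operators\<close>

text \<open>The phase \<open>u * v / 2\<close> is the Baker-Campbell-Hausdorff correction for
  splitting the exponential into a multiplication and a translation; it makes the operators along a
  line a one-parameter group, see \<open>weyl_add\<close>.\<close>

definition weyl :: "real \<Rightarrow> real \<Rightarrow> operator" where
  "weyl u v f = (\<lambda>x. cis (u * x + u * v / 2) * f (x + v))"

lemma borel_measurable_cis [measurable (raw)]:
  "f \<in> borel_measurable M \<Longrightarrow> (\<lambda>x. cis (f x)) \<in> borel_measurable M"
  by (rule borel_measurable_continuous_on[where f=cis]) (auto intro!: continuous_intros)

lemma integral_shift:
  fixes f :: "real \<Rightarrow> 'a::{banach, second_countable_topology}"
  shows "(LINT x|lborel. f (x + v)) = (LINT x|lborel. f x)"
  using lborel_integral_real_affine[of 1 f v] by (simp add: add.commute)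

lemma integrable_shift:
  fixes f :: "real \<Rightarrow> 'a::{banach, second_countable_topology}"
  shows "integrable lborel f \<Longrightarrow> integrable lborel (\<lambda>x. f (x + v))"
  using lborel_integrable_real_affine[of f 1 v] by (simp add: add.commute)

lemma nn_integral_shift:
  "f \<in> borel_measurable borel \<Longrightarrow> (\<integral>\<^sup>+x. f (x + v :: real) \<partial>lborel) = (\<integral>\<^sup>+x. f x \<partial>lborel)"
  using nn_integral_real_affine[of f 1 v] by (simp add: add.commute)

lemma cmod_weyl: "cmod (weyl u v f x) = cmod (f (x + v))"
  by (simp add: weyl_def norm_mult)

lemma borel_measurable_weyl [measurable]:
  assumes [measurable]: "f \<in> borel_measurable borel"
  shows "weyl u v f \<in> borel_measurable borel"
  unfolding weyl_def by measurable

lemma weyl_L2_fun: "f \<in> L2_fun \<Longrightarrow> weyl u v f \<in> L2_fun"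
  using integrable_shift[of "\<lambda>x. (cmod (f x))\<^sup>2" v]
  by (simp add: L2_fun_iff cmod_weyl borel_measurable_weyl)

lemma nsq_weyl: "nsq (weyl u v f) = nsq f"
  using integral_shift[of "\<lambda>x. (cmod (f x))\<^sup>2" v] by (simp add: nsq_def cmod_weyl)

lemma L2_inner_weyl: "L2_inner (weyl u v f) (weyl u v g) = L2_inner f g"
proof -
  have "cnj (weyl u v f x) * weyl u v g x = cnj (f (x + v)) * g (x + v)" for x
  proof -
    have "cnj (weyl u v f x) * weyl u v g x = (cnj (cis (u * x + u * v / 2)) * cis (u * x + u * v / 2)) * (cnj (f (x + v)) * g (x + v))"
      by (simp add: weyl_def mult_ac)
    then show ?thesis by (simp add: cis_cnj cis_mult)
  qed
  then show ?thesis
    using integral_shift[of "\<lambda>x. cnj (f x) * g x" v] by (simp add: L2_inner_def)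
qed

lemma weyl_add:
  "weyl ((s + t) * u) ((s + t) * v) f = weyl (s * u) (s * v) (weyl (t * u) (t * v) f)"
proof
  fix x
  have phase: "(s + t) * u * x + (s + t) * u * ((s + t) * v) / 2
    = (s * u * x + s * u * (s * v) / 2) + (t * u * (x + s * v) + t * u * (t * v) / 2)"
    by (simp add: field_simps)
  have arg: "x + (s + t) * v = x + s * v + t * v" by (simp add: distrib_right)
  show "weyl ((s + t) * u) ((s + t) * v) f x = weyl (s * u) (s * v) (weyl (t * u) (t * v) f) x"
    unfolding weyl_def phase arg by (simp only: cis_mult mult.assoc[symmetric])
qed

lemma weyl_0 [simp]: "weyl 0 0 f = f"
  by (simp add: weyl_def)

lemma weyl_linear:
  "weyl u v (\<lambda>x. f x + g x) x = weyl u v f x + weyl u v g x"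
  "weyl u v (\<lambda>x. f x - g x) x = weyl u v f x - weyl u v g x"
  "weyl u v (\<lambda>x. c * f x) x = c * weyl u v f x"
  by (simp_all add: weyl_def algebra_simps)

text \<open>A unitary operator has its inverse as adjoint. This supplies the hypothesis
  \<open>adj\<close> of \<open>has_trace_mixture\<close>.\<close>

lemma L2_inner_weyl_adjoint: "L2_inner g (weyl u v f) = L2_inner (weyl (-u) (-v) g) f"
proof -
  have "weyl u v (weyl (-u) (-v) g) = g"
    using weyl_add[of 1 "-1" u v g] by simp
  then show ?thesis using L2_inner_weyl[of u v "weyl (-u) (-v) g" f] by simp
qed

lemma bounded_operator_weyl: "bounded_operator (weyl u v)"
  unfolding bounded_operator_def
proof (intro conjI ballI allI)
  show "\<exists>C::real. \<forall>f\<in>L2_fun. L2_norm_sq (weyl u v f) \<le> ennreal C * L2_norm_sq f"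
    by (intro exI[of _ 1]) (simp add: L2_norm_sq_eq_nsq weyl_L2_fun nsq_weyl)
qed (simp_all add: weyl_L2_fun weyl_linear)

section \<open>Strong continuity and generator of the Weyl group\<close>

lemma cmod_cis_minus_1_le: "cmod (cis x - 1) \<le> \<bar>x\<bar>"
  using iexp_approx1[of x 0] by (simp add: cis_conv_exp)

text \<open>Strong continuity is proved first in L1, where indicators can be treated by hand and the
  library induction for integrable functions applies; truncation then transfers it to L2.\<close>

definition weyl_dist1 :: "real \<Rightarrow> real \<Rightarrow> (real \<Rightarrow> complex) \<Rightarrow> real" where
  "weyl_dist1 u v f = (LINT x|lborel. cmod (weyl u v f x - f x))"

lemma integrable_weyl: "integrable lborel f \<Longrightarrow> integrable lborel (weyl u v f)"
  using integrable_norm[OF integrable_shift[of f v]]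
  by (rule Bochner_Integration.integrable_bound) (auto simp: cmod_weyl)

lemma weyl_dist1_le_norm:
  assumes "integrable lborel f"
  shows "weyl_dist1 u v f \<le> 2 * (LINT x|lborel. cmod (f x))"
proof -
  have "weyl_dist1 u v f \<le> (LINT x|lborel. cmod (f (x + v)) + cmod (f x))"
    unfolding weyl_dist1_def
    using assms integrable_weyl[OF assms] integrable_shift[OF assms]
    by (intro integral_mono) (auto simp: cmod_weyl intro!: order_trans[OF norm_triangle_ineq4])
  also have "\<dots> = (LINT x|lborel. cmod (f (x + v))) + (LINT x|lborel. cmod (f x))"
    using assms integrable_shift[OF assms] by (intro Bochner_Integration.integral_add) auto
  also have "(LINT x|lborel. cmod (f (x + v))) = (LINT x|lborel. cmod (f x))"
    by (rule integral_shift)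
  finally show ?thesis by simp
qed

lemma weyl_dist1_triangle:
  assumes f: "integrable lborel f" and g: "integrable lborel g"
  shows "weyl_dist1 u v (\<lambda>x. f x + g x) \<le> weyl_dist1 u v f + weyl_dist1 u v g"
proof -
  have "weyl_dist1 u v (\<lambda>x. f x + g x)
      \<le> (LINT x|lborel. cmod (weyl u v f x - f x) + cmod (weyl u v g x - g x))"
    unfolding weyl_dist1_def
    using f g integrable_weyl[OF f] integrable_weyl[OF g]
    by (intro integral_mono)
       (auto simp: weyl_linear add_diff_add intro!: norm_triangle_ineq integrable_weyl)
  also have "\<dots> = weyl_dist1 u v f + weyl_dist1 u v g"
    unfolding weyl_dist1_def using f g integrable_weyl[OF f] integrable_weyl[OF g]
    by (intro Bochner_Integration.integral_add) auto
  finally show ?thesis .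
qed

lemma weyl_dist1_nonneg [simp]: "0 \<le> weyl_dist1 u v f"
  by (simp add: weyl_dist1_def)

lemma weyl_dist1_mult: "weyl_dist1 u v (\<lambda>x. c * f x) = cmod c * weyl_dist1 u v f"
  by (simp add: weyl_dist1_def weyl_linear norm_mult flip: right_diff_distrib)

text \<open>Weyl operators preserve the L1 norm, so \<open>weyl_dist1\<close> is 2-Lipschitz in f
  uniformly in n, and convergence to 0 passes to L1 limits.\<close>

lemma weyl_dist1_approx:
  fixes X :: "nat \<Rightarrow> real"
  assumes f: "integrable lborel f"
    and approx: "\<And>e. 0 < e \<Longrightarrow> \<exists>g. integrable lborel g \<and> (LINT x|lborel. cmod (f x - g x)) < e \<and>
       (\<lambda>n. weyl_dist1 (X n * u) (X n * v) g) \<longlonglongrightarrow> 0"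
  shows "(\<lambda>n. weyl_dist1 (X n * u) (X n * v) f) \<longlonglongrightarrow> 0"
proof (rule LIMSEQ_I)
  fix e :: real assume e: "0 < e"
  obtain g where g: "integrable lborel g" and d: "(LINT x|lborel. cmod (f x - g x)) < e / 4"
    and lim: "(\<lambda>n. weyl_dist1 (X n * u) (X n * v) g) \<longlonglongrightarrow> 0"
    using approx[of "e / 4"] e by auto
  obtain N where N: "\<And>n. n \<ge> N \<Longrightarrow> norm (weyl_dist1 (X n * u) (X n * v) g - 0) < e / 2"
    using LIMSEQ_D[OF lim, of "e/2"] e by auto
  have "norm (weyl_dist1 (X n * u) (X n * v) f - 0) < e" if "n \<ge> N" for n
  proof -
    have "weyl_dist1 (X n * u) (X n * v) f = weyl_dist1 (X n * u) (X n * v) (\<lambda>x. g x + (f x - g x))"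
      by simp
    also have "\<dots> \<le> weyl_dist1 (X n * u) (X n * v) g + weyl_dist1 (X n * u) (X n * v) (\<lambda>x. f x - g x)"
      using f g by (intro weyl_dist1_triangle) auto
    also have "weyl_dist1 (X n * u) (X n * v) (\<lambda>x. f x - g x) \<le> 2 * (LINT x|lborel. cmod (f x - g x))"
      using f g by (intro weyl_dist1_le_norm) auto
    finally show ?thesis using N[OF that] d by simp
  qed
  then show "\<exists>no. \<forall>n\<ge>no. norm (weyl_dist1 (X n * u) (X n * v) f - 0) < e" by blast
qed

lemma cis_tendsto_1: "(X \<longlongrightarrow> 0) F \<Longrightarrow> ((\<lambda>n. cis (X n)) \<longlongrightarrow> 1) F"
  using tendsto_cis[of X 0 F] by simp

text \<open>
  For open \<open>U\<close> the product of the indicators of \<open>U\<close> at \<open>x\<close> and \<open>x + h\<close> tends pointwise to the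
  indicator of \<open>U\<close> as \<open>h\<close> tends to 0, so dominated convergence replaces the usual approximation by
  continuous functions; outer regularity then covers all Borel sets.
\<close>

lemma weyl_dist1_open:
  assumes X: "X \<longlonglongrightarrow> (0::real)" and U: "open U" "emeasure lborel U < \<infinity>"
  shows "(\<lambda>n. weyl_dist1 (X n * u) (X n * v) (\<lambda>x. of_real (indicator U x))) \<longlonglongrightarrow> 0"
proof -
  define I where "I = (indicator U :: real \<Rightarrow> real)"
  have [measurable]: "U \<in> sets borel" using U by simp
  have [measurable]: "I \<in> borel_measurable borel" unfolding I_def by measurable
  have I01: "0 \<le> I x" "I x \<le> 1" "I x * I x = I x" for x unfolding I_def by (auto simp: indicator_def)
  have int: "integrable lborel I" unfolding I_def using U by (intro integrable_real_indicator) auto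
  have ints: "integrable lborel (\<lambda>x. I (x + h))" for h by (rule integrable_shift[OF int])
  have intp: "integrable lborel (\<lambda>x. I x * I (x + h))" for h
    by (rule Bochner_Integration.integrable_bound[OF int]) (use I01 in \<open>auto simp: abs_mult intro: mult_left_le\<close>)
  have intc: "integrable lborel (\<lambda>x. I x * cmod (cis (w x) - 1))" if [measurable]: "w \<in> borel_measurable borel" for w
  proof (rule Bochner_Integration.integrable_bound[OF integrable_mult_right[OF int, of 2]])
    show "AE x in lborel. norm (I x * cmod (cis (w x) - 1)) \<le> norm (2 * I x)"
    proof (rule AE_I2)
      fix x
      have "cmod (cis (w x) - 1) \<le> 2"
        using norm_triangle_ineq4[of "cis (w x)" 1] by simp
      then show "norm (I x * cmod (cis (w x) - 1)) \<le> norm (2 * I x)"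
        using I01(1)[of x] by (simp add: abs_mult mult.commute[of 2] mult_left_mono)
    qed
  qed measurable
  define \<theta> where "\<theta> n x = X n * u * x + X n * u * (X n * v) / 2" for n x
  have [measurable]: "\<theta> n \<in> borel_measurable borel" for n unfolding \<theta>_def by measurable
  have \<theta>_lim: "(\<lambda>n. \<theta> n x) \<longlonglongrightarrow> 0" for x
    unfolding \<theta>_def by (auto intro!: tendsto_eq_intros X)
  \<comment> \<open>For 0/1 values the absolute difference equals the sum minus twice the product.
    Integrated, this leaves a constant minus twice an autocorrelation of \<open>U\<close>; the last
    summand is the error of the phase.\<close>
  define b where "b n = 2 * (LINT x|lborel. I x) - 2 * (LINT x|lborel. I x * I (x + X n * v)) + (LINT x|lborel. I x * cmod (cis (\<theta> n x) - 1))" for n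
  have le: "weyl_dist1 (X n * u) (X n * v) (\<lambda>x. of_real (I x)) \<le> b n" for n
  proof -
    have "weyl_dist1 (X n * u) (X n * v) (\<lambda>x. of_real (I x))
      \<le> (LINT x|lborel. (I (x + X n * v) + I x - 2 * (I x * I (x + X n * v))) + I x * cmod (cis (\<theta> n x) - 1))"
      unfolding weyl_dist1_def
    proof (rule integral_mono)
      fix x
      have "weyl (X n * u) (X n * v) (\<lambda>x. of_real (I x)) x - of_real (I x)
        = cis (\<theta> n x) * of_real (I (x + X n * v) - I x) + of_real (I x) * (cis (\<theta> n x) - 1)"
        unfolding weyl_def \<theta>_def by (simp add: algebra_simps)
      also have "cmod \<dots> \<le> \<bar>I (x + X n * v) - I x\<bar> + I x * cmod (cis (\<theta> n x) - 1)"
        by (rule order_trans[OF norm_triangle_ineq]) (use I01(1)[of x] in \<open>simp only: norm_mult norm_cis norm_of_real, simp\<close>)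
      also have "\<bar>I (x + X n * v) - I x\<bar> = I (x + X n * v) + I x - 2 * (I x * I (x + X n * v))"
        unfolding I_def by (auto simp: indicator_def)
      finally show "cmod (weyl (X n * u) (X n * v) (\<lambda>x. of_real (I x)) x - of_real (I x)) \<le>
        (I (x + X n * v) + I x - 2 * (I x * I (x + X n * v))) + I x * cmod (cis (\<theta> n x) - 1)" .
    next
      show "integrable lborel (\<lambda>x. cmod (weyl (X n * u) (X n * v) (\<lambda>x. of_real (I x)) x - of_real (I x)))"
        using int by (intro integrable_norm Bochner_Integration.integrable_diff integrable_weyl) auto
    qed (use int ints intp intc in auto)
    also have "\<dots> = b n"
      unfolding b_def using int ints intp intc integral_shift[of I "X n * v"] by simp
    finally show ?thesis .
  qed
  have "b \<longlonglongrightarrow> 2 * (LINT x|lborel. I x) - 2 * (LINT x|lborel. I x) + (LINT (x::real)|lborel. 0)"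
    unfolding b_def[abs_def]
  proof (intro tendsto_add tendsto_diff tendsto_mult tendsto_const)
    show "(\<lambda>n. LINT x|lborel. I x * I (x + X n * v)) \<longlonglongrightarrow> (LINT x|lborel. I x)"
    proof (rule integral_dominated_convergence[where w=I])
      show "AE x in lborel. (\<lambda>n. I x * I (x + X n * v)) \<longlonglongrightarrow> I x"
      proof (rule AE_I2)
        fix x
        show "(\<lambda>n. I x * I (x + X n * v)) \<longlonglongrightarrow> I x"
        \<comment> \<open>Openness is used only at points of \<open>U\<close>; elsewhere the factor
          \<open>I x\<close> vanishes, so boundary points do no harm.\<close>
        proof (cases "x \<in> U")
          case True
          have "(\<lambda>n. x + X n * v) \<longlonglongrightarrow> x" by (auto intro!: tendsto_eq_intros X)
          then have "eventually (\<lambda>n. x + X n * v \<in> U) sequentially"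
            using U(1) True by (rule topological_tendstoD)
          then show ?thesis
            by (intro tendsto_eventually) (use True in \<open>auto elim!: eventually_mono simp: I_def\<close>)
        qed (simp add: I_def)
      qed
      show "AE x in lborel. norm (I x * I (x + X n * v)) \<le> I x" for n
        using I01 by (auto simp: abs_mult intro: mult_left_le)
    qed (use int in auto)
    show "(\<lambda>n. LINT x|lborel. I x * cmod (cis (\<theta> n x) - 1)) \<longlonglongrightarrow> (LINT (x::real)|lborel. 0)"
    proof (rule integral_dominated_convergence[where w="\<lambda>x. 2 * I x"])
      show "AE x in lborel. (\<lambda>n. I x * cmod (cis (\<theta> n x) - 1)) \<longlonglongrightarrow> 0"
        by (rule AE_I2) (auto intro!: tendsto_eq_intros cis_tendsto_1 \<theta>_lim)
      show "AE x in lborel. norm (I x * cmod (cis (\<theta> n x) - 1)) \<le> 2 * I x" for n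
      proof (rule AE_I2)
        fix x
        have "cmod (cis (\<theta> n x) - 1) \<le> 2"
          using norm_triangle_ineq4[of "cis (\<theta> n x)" 1] by simp
        then show "norm (I x * cmod (cis (\<theta> n x) - 1)) \<le> 2 * I x"
          using I01(1)[of x] by (simp add: abs_mult mult.commute[of 2] mult_left_mono)
      qed
    qed (use int in auto)
  qed
  then have b0: "b \<longlonglongrightarrow> 0" by simp
  show ?thesis
    unfolding I_def[symmetric]
    by (rule tendsto_sandwich[OF _ _ tendsto_const b0]) (auto intro: le always_eventually)
qed

lemma weyl_dist1_tendsto_0:
  assumes X: "X \<longlonglongrightarrow> (0::real)" and f: "integrable lborel f"
  shows "(\<lambda>n. weyl_dist1 (X n * u) (X n * v) f) \<longlonglongrightarrow> 0"
  using f
proof (induction rule: integrable_induct)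
  case (base A c)
  then have [measurable]: "A \<in> sets borel" by simp
  have "(\<lambda>n. weyl_dist1 (X n * u) (X n * v) (\<lambda>x. of_real (indicator A x))) \<longlonglongrightarrow> 0"
  proof (rule weyl_dist1_approx)
    fix e :: real assume e: "0 < e"
    obtain U where U: "open U" "A \<subseteq> U" "emeasure lborel (U - A) < e"
      using outer_regular_lborel[of A e] e by auto
    have [measurable]: "U \<in> sets borel" using U by simp
    have "U = A \<union> (U - A)" using U by auto
    then have "emeasure lborel U \<le> emeasure lborel A + emeasure lborel (U - A)"
      using emeasure_subadditive[of A lborel "U - A"] by simp
    also have "\<dots> < \<infinity>" using base U(3) by (auto intro: less_trans)
    finally have Ufin: "emeasure lborel U < \<infinity>" .
    have diff: "cmod (of_real (indicator A x) - of_real (indicator U x)) = indicator (U - A) x" for x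
      using U(2) by (auto simp: indicator_def)
    have "(LINT x|lborel. cmod (of_real (indicator A x) - of_real (indicator U x))) < e"
      unfolding diff using U(3) e
      by (cases "emeasure lborel (U - A)" rule: ennreal_cases) (auto simp: measure_def ennreal_less_iff)
    moreover have "integrable lborel (\<lambda>x. complex_of_real (indicator U x))"
      using Ufin by (intro integrable_of_real integrable_real_indicator) auto
    ultimately show "\<exists>g. integrable lborel g \<and> (LINT x|lborel. cmod (of_real (indicator A x) - g x)) < e \<and>
       (\<lambda>n. weyl_dist1 (X n * u) (X n * v) g) \<longlonglongrightarrow> 0"
      using weyl_dist1_open[OF X U(1) Ufin] by blast
  qed (use base in \<open>auto intro!: integrable_of_real integrable_real_indicator\<close>)
  then have "(\<lambda>n. cmod c * weyl_dist1 (X n * u) (X n * v) (\<lambda>x. of_real (indicator A x))) \<longlonglongrightarrow> cmod c * 0"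
    by (intro tendsto_mult tendsto_const)
  then show ?case
    by (simp add: weyl_dist1_mult[symmetric] scaleR_conv_of_real mult.commute)
next
  case (add f g)
  have lim: "(\<lambda>n. weyl_dist1 (X n * u) (X n * v) f + weyl_dist1 (X n * u) (X n * v) g) \<longlonglongrightarrow> 0"
    using tendsto_add[OF add(3,4)] by simp
  show ?case
    by (rule tendsto_sandwich[OF _ _ tendsto_const lim])
       (use add in \<open>auto intro!: always_eventually weyl_dist1_triangle\<close>)
next
  case (lim f s)
  have sf: "(\<lambda>i. LINT x|lborel. cmod (f x - s i x)) \<longlonglongrightarrow> (LINT (x::real)|lborel. 0)"
  \<comment> \<open>The approximants of \<open>integrable_induct\<close> are bounded by twice the
    norm of f, hence the factor 3.\<close>
  proof (rule integral_dominated_convergence[where w="\<lambda>x. 3 * cmod (f x)"])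
    show "AE x in lborel. (\<lambda>i. cmod (f x - s i x)) \<longlonglongrightarrow> 0"
    proof (rule AE_I2)
      fix x
      have "(\<lambda>i. cmod (f x - s i x)) \<longlonglongrightarrow> cmod (f x - f x)"
        using lim(2)[of x] by (intro tendsto_norm tendsto_diff tendsto_const) auto
      then show "(\<lambda>i. cmod (f x - s i x)) \<longlonglongrightarrow> 0" by simp
    qed
    show "AE x in lborel. norm (cmod (f x - s i x)) \<le> 3 * cmod (f x)" for i
    proof (rule AE_I2)
      fix x
      show "norm (cmod (f x - s i x)) \<le> 3 * cmod (f x)"
        using norm_triangle_ineq4[of "f x" "s i x"] lim(3)[of x i] by simp
    qed
  qed (use lim in auto)
  show ?case
  proof (rule weyl_dist1_approx[OF lim(4)])
    fix e :: real assume "0 < e"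
    then obtain i where "norm ((LINT x|lborel. cmod (f x - s i x)) - 0) < e"
      using LIMSEQ_D[OF sf] by fastforce
    then show "\<exists>g. integrable lborel g \<and> (LINT x|lborel. cmod (f x - g x)) < e \<and>
       (\<lambda>n. weyl_dist1 (X n * u) (X n * v) g) \<longlonglongrightarrow> 0"
      using lim(1)[of i] lim(5)[of i] by auto
  qed
qed


text \<open>Truncation in the argument makes f integrable; truncation in the value bounds the
  squared difference by \<open>2 * real N\<close> times the difference, so L1 continuity controls
  the truncated part. The remainder is small in L2 and stays so because the operators are
  isometric.\<close>

lemma weyl_strongly_continuous:
  assumes f: "f \<in> L2_fun" and X: "X \<longlonglongrightarrow> (0::real)"
  shows "(\<lambda>n. nsq (\<lambda>x. weyl (X n * u) (X n * v) f x - f x)) \<longlonglongrightarrow> 0"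
proof (rule LIMSEQ_I)
  fix e :: real assume e: "0 < e"
  have [measurable]: "f \<in> borel_measurable borel" using f by (rule L2_fun_measurable)
  define T where "T N x = (if \<bar>x\<bar> \<le> real N \<and> cmod (f x) \<le> real N then f x else 0)" for N x
  have [measurable]: "T N \<in> borel_measurable borel" for N unfolding T_def by measurable
  have T_le: "cmod (T N x) \<le> cmod (f x)" "cmod (T N x) \<le> real N" "cmod (f x - T N x) \<le> cmod (f x)" for N x
    by (auto simp: T_def)
  have T_L2: "T N \<in> L2_fun" for N
    by (rule L2_fun_bound[OF _ L2_fun_integrable[OF f]]) (auto intro!: power_mono T_le)
  have T_int: "integrable lborel (T N)" for N
  proof (rule Bochner_Integration.integrable_bound)
    show "integrable lborel (\<lambda>x. real N * indicator {- real N..real N} x)" by simp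
    show "AE x in lborel. norm (T N x) \<le> norm (real N * indicator {- real N..real N} x)"
      by (auto simp: T_def indicator_def)
  qed measurable
  have "(\<lambda>N. LINT x|lborel. (cmod (f x - T N x))\<^sup>2) \<longlonglongrightarrow> (LINT (x::real)|lborel. 0)"
  proof (rule integral_dominated_convergence[where w="\<lambda>x. (cmod (f x))\<^sup>2"])
    show "AE x in lborel. (\<lambda>N. (cmod (f x - T N x))\<^sup>2) \<longlonglongrightarrow> 0"
    proof (intro AE_I2 tendsto_eventually)
      fix x :: real
      show "\<forall>\<^sub>F N in sequentially. (cmod (f x - T N x))\<^sup>2 = 0"
        using eventually_ge_at_top[of "nat \<lceil>max \<bar>x\<bar> (cmod (f x))\<rceil>"]
        by eventually_elim (auto simp: T_def nat_le_iff ceiling_le_iff)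
    qed
  qed (auto intro!: power_mono T_le L2_fun_integrable f)
  then have "(\<lambda>N. nsq (\<lambda>x. f x - T N x)) \<longlonglongrightarrow> 0" by (simp add: nsq_def)
  \<comment> \<open>The remainder enters the final estimate with factor 2 * 4 and so costs less than
    e / 2; the L1 term gets the other half.\<close>
  from LIMSEQ_D[OF this, of "e / 16"] e obtain N where N: "nsq (\<lambda>x. f x - T N x) < e / 16"
    by fastforce
  have "(\<lambda>n. 2 * (2 * real N * weyl_dist1 (X n * u) (X n * v) (T N))) \<longlonglongrightarrow> 2 * (2 * real N * 0)"
    by (intro tendsto_mult tendsto_const weyl_dist1_tendsto_0 X T_int)
  from LIMSEQ_D[OF this, of "e / 2"] e obtain n0 where
    n0: "\<And>n. n \<ge> n0 \<Longrightarrow> 2 * (2 * real N * weyl_dist1 (X n * u) (X n * v) (T N)) < e / 2"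
    by fastforce
  have nsq_add: "nsq (\<lambda>x. a x + b x) \<le> 2 * nsq a + 2 * nsq b" if a: "a \<in> L2_fun" and b: "b \<in> L2_fun" for a b
  proof -
    have "nsq (\<lambda>x. a x + b x) \<le> (LINT x|lborel. 2 * (cmod (a x))\<^sup>2 + 2 * (cmod (b x))\<^sup>2)"
      unfolding nsq_def
      by (intro integral_mono norm_add_sq_le Bochner_Integration.integrable_add integrable_mult_right
          L2_fun_integrable L2_fun_add a b)
    then show ?thesis using a b by (simp add: nsq_def L2_fun_integrable)
  qed
  have "norm (nsq (\<lambda>x. weyl (X n * u) (X n * v) f x - f x) - 0) < e" if n: "n \<ge> n0" for n
  proof -
    let ?W = "weyl (X n * u) (X n * v)"
    define r where "r = (\<lambda>x. f x - T N x)"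
    have r: "r \<in> L2_fun" unfolding r_def by (intro L2_fun_diff f T_L2)
    have "nsq (\<lambda>x. ?W f x - f x) = nsq (\<lambda>x. (?W (T N) x - T N x) + (?W r x - r x))"
      unfolding r_def weyl_linear by (simp add: algebra_simps)
    also have "\<dots> \<le> 2 * nsq (\<lambda>x. ?W (T N) x - T N x) + 2 * nsq (\<lambda>x. ?W r x - r x)"
      by (intro nsq_add L2_fun_diff weyl_L2_fun T_L2 r)
    also have "nsq (\<lambda>x. ?W r x - r x) \<le> 2 * nsq (?W r) + 2 * nsq (\<lambda>x. (-1) * r x)"
      using nsq_add[OF weyl_L2_fun[OF r] L2_fun_mult[OF r, of "-1"], of "X n * u" "X n * v"] by simp
    also have "\<dots> = 4 * nsq r" unfolding nsq_mult nsq_weyl by simp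
    also have "nsq (\<lambda>x. ?W (T N) x - T N x) \<le> 2 * real N * weyl_dist1 (X n * u) (X n * v) (T N)"
      unfolding nsq_def weyl_dist1_def integral_mult_right_zero[symmetric]
    proof (rule integral_mono)
      fix x
      have "cmod (?W (T N) x - T N x) \<le> 2 * real N"
        using norm_triangle_ineq4[of "?W (T N) x" "T N x"] T_le(2)[of N x] T_le(2)[of N "x + X n * v"]
        by (simp add: cmod_weyl)
      then show "(cmod (?W (T N) x - T N x))\<^sup>2 \<le> 2 * real N * cmod (?W (T N) x - T N x)"
        by (simp add: power2_eq_square mult_right_mono)
    qed (auto intro!: L2_fun_integrable L2_fun_diff weyl_L2_fun T_L2 integrable_mult_right integrable_norm integrable_weyl T_int)
    finally have "nsq (\<lambda>x. ?W f x - f x) < e" using n0[OF n] N unfolding r_def by simp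
    then show ?thesis by simp
  qed
  then show "\<exists>no. \<forall>n\<ge>no. norm (nsq (\<lambda>x. weyl (X n * u) (X n * v) f x - f x) - 0) < e" by blast
qed

text \<open>The interval, the sup bounds and the Lipschitz constant are what the dominating function
  in \<open>weyl_generator\<close> is built from.\<close>

lemma test_function_bounds:
  assumes "f \<in> test_functions"
  obtains D R F B where "\<And>x. (f has_vector_derivative D x) (at x)" "continuous_on UNIV D"
    "0 \<le> R" "\<And>x. R < \<bar>x\<bar> \<Longrightarrow> f x = 0" "\<And>x. R < \<bar>x\<bar> \<Longrightarrow> D x = 0"
    "\<And>x. cmod (f x) \<le> F" "\<And>x. cmod (D x) \<le> B" "\<And>x y. cmod (f x - f y) \<le> B * \<bar>x - y\<bar>"
    "continuous_on UNIV f"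
proof -
  obtain R0 where R0: "\<And>x. R0 < \<bar>x\<bar> \<Longrightarrow> f x = 0"
    and "f C1_differentiable_on UNIV" using assms by (auto simp: test_functions_def)
  then obtain D where D: "\<And>x. (f has_vector_derivative D x) (at x)" and cD: "continuous_on UNIV D"
    by (auto simp: C1_differentiable_on_def)
  define R where "R = \<bar>R0\<bar>"
  have R: "0 \<le> R" "\<And>x. R < \<bar>x\<bar> \<Longrightarrow> f x = 0" using R0 by (auto simp: R_def)
  have cf: "continuous_on UNIV f"
    using D by (intro continuous_at_imp_continuous_on) (auto intro: has_vector_derivative_continuous)
  have D0: "D x = 0" if x: "R < \<bar>x\<bar>" for x
  proof -
    have op: "open {y::real. R < \<bar>y\<bar>}" by (intro open_Collect_less continuous_intros)
    have "((\<lambda>_. 0::complex) has_vector_derivative D x) (at x)"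
      by (rule has_vector_derivative_transform_within_open[OF D op]) (use x R(2) in auto)
    then show ?thesis
      by (metis has_vector_derivative_const vector_derivative_unique_at)
  qed
  have bdd: "\<exists>C\<ge>0. \<forall>x. cmod (g x) \<le> C" if g: "continuous_on UNIV g" "\<And>x. R < \<bar>x\<bar> \<Longrightarrow> g x = 0" for g :: "real \<Rightarrow> complex"
  proof -
    have "compact (g ` {-R..R})"
      by (intro compact_continuous_image continuous_on_subset[OF g(1)]) auto
    then have "\<exists>C. \<forall>x\<in>{-R..R}. cmod (g x) \<le> C"
      using compact_imp_bounded[of "g ` {-R..R}"] unfolding bounded_iff by auto
    then obtain C where C: "\<And>x. x \<in> {-R..R} \<Longrightarrow> cmod (g x) \<le> C" by blast
    have "cmod (g x) \<le> \<bar>C\<bar>" for x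
    proof (cases "R < \<bar>x\<bar>")
      case False
      then have "x \<in> {-R..R}" by auto
      then show ?thesis using C[of x] abs_ge_self[of C] by linarith
    qed (simp add: g(2))
    then show ?thesis by (intro exI[of _ "\<bar>C\<bar>"]) auto
  qed
  obtain F where F: "\<And>x. cmod (f x) \<le> F" using bdd[OF cf R(2)] by blast
  obtain B where B: "\<And>x. cmod (D x) \<le> B" using bdd[OF cD D0] by blast
  have "cmod (f x - f y) \<le> B * norm (x - y)" for x y
  proof (rule differentiable_bound[where S=UNIV and f'="\<lambda>x h. h *\<^sub>R D x"])
    show "(f has_derivative (\<lambda>h. h *\<^sub>R D x)) (at x within UNIV)" for x
      using D by (simp add: has_vector_derivative_def)
    show "onorm (\<lambda>h. h *\<^sub>R D x) \<le> B" for x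
    proof (rule onorm_le)
      show "norm (h *\<^sub>R D x) \<le> B * norm h" for h
        using mult_left_mono[OF B[of x], of "\<bar>h\<bar>"] by (simp add: mult.commute)
    qed
  qed auto
  then show ?thesis using that[OF D cD R(1) R(2) D0 F B _ cf] by simp
qed

text \<open>The pointwise limit is the product rule at time 0. Domination comes from compact
  support: since \<open>\<bar>X n\<bar> \<le> 1\<close>, all difference quotients live on one
  interval, enlarged by \<open>\<bar>v\<bar>\<close>, and the Lipschitz bounds for f and the phase
  make them uniformly bounded.\<close>

lemma weyl_generator:
  fixes X :: "nat \<Rightarrow> real"
  assumes f: "f \<in> test_functions" and X: "X \<longlonglongrightarrow> 0" "\<And>n. X n \<noteq> 0" "\<And>n. \<bar>X n\<bar> \<le> 1"
  shows "(\<lambda>n. L2_norm_sq (\<lambda>x. (weyl (X n * u) (X n * v) f x - f x) / of_real (X n)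
     - \<i> * (of_real u * position_op f x + of_real v * momentum_op f x))) \<longlonglongrightarrow> 0"
proof -
  obtain D R F B where D: "\<And>x. (f has_vector_derivative D x) (at x)" and cD: "continuous_on UNIV D"
    and R: "0 \<le> R" "\<And>x. R < \<bar>x\<bar> \<Longrightarrow> f x = 0" and D0: "\<And>x. R < \<bar>x\<bar> \<Longrightarrow> D x = 0"
    and F: "\<And>x. cmod (f x) \<le> F" and B: "\<And>x. cmod (D x) \<le> B"
    and lip: "\<And>x y. cmod (f x - f y) \<le> B * \<bar>x - y\<bar>" and cf: "continuous_on UNIV f"
    using test_function_bounds[OF f] by blast
  have [measurable]: "f \<in> borel_measurable borel" "D \<in> borel_measurable borel"
    using cf cD by (auto intro: borel_measurable_continuous_onI)
  have F0: "0 \<le> F" using F[of 0] norm_ge_zero[of "f 0"] by linarith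
  have B0: "0 \<le> B" using B[of 0] norm_ge_zero[of "D 0"] by linarith
  define G where "G x = of_real (u * x) * (\<i> * f x) + of_real v * D x" for x
  have G: "\<i> * (of_real u * position_op f x + of_real v * momentum_op f x) = G x" for x
    using vector_derivative_at[OF D[of x]]
    by (simp add: G_def position_op_def momentum_op_def algebra_simps)
  have [measurable]: "G \<in> borel_measurable borel" unfolding G_def by measurable
  define Q where "Q n x = (weyl (X n * u) (X n * v) f x - f x) / of_real (X n)" for n x
  have [measurable]: "Q n \<in> borel_measurable borel" for n unfolding Q_def by measurable
  have lim: "(\<lambda>n. Q n x - G x) \<longlonglongrightarrow> 0" for x
  proof -
    have "((\<lambda>t. cis (t * u * x + t * u * (t * v) / 2) * f (x + t * v)) has_derivative
       (\<lambda>h. h *\<^sub>R G x)) (at 0)"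
    proof -
      have 1: "((\<lambda>t. cis (t * u * x + t * u * (t * v) / 2)) has_derivative (\<lambda>h. (h * (u * x)) *\<^sub>R \<i>)) (at 0)"
        by (auto intro!: derivative_eq_intros)
      have 2: "((\<lambda>t. f (x + t * v)) has_derivative (\<lambda>h. (h * v) *\<^sub>R D x)) (at 0)"
      proof (rule has_derivative_compose[where f="\<lambda>t. x + t * v" and g=f])
        show "((\<lambda>t. x + t * v) has_derivative (\<lambda>h. h * v)) (at 0)"
          by (auto intro!: derivative_eq_intros)
        show "(f has_derivative (\<lambda>h. h *\<^sub>R D x)) (at (x + 0 * v))"
          using D[of x] by (simp add: has_vector_derivative_def)
      qed
      show ?thesis
        by (rule has_derivative_eq_rhs[OF has_derivative_mult[OF 1 2]])
           (simp add: fun_eq_iff G_def scaleR_conv_of_real algebra_simps)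
    qed
    then have "(\<lambda>h. norm (cis (h * u * x + h * u * (h * v) / 2) * f (x + h * v) - f x - h *\<^sub>R G x) / norm h) \<midarrow>0\<rightarrow> 0"
      by (simp add: has_derivative_at)
    then have "((\<lambda>h. norm (cis (h * u * x + h * u * (h * v) / 2) * f (x + h * v) - f x - h *\<^sub>R G x) / norm h) \<circ> X) \<longlonglongrightarrow> 0"
      using X(1,2) unfolding tendsto_at_iff_sequentially by simp
    moreover have "norm (cis (X n * u * x + X n * u * (X n * v) / 2) * f (x + X n * v) - f x - X n *\<^sub>R G x) / norm (X n) = norm (Q n x - G x)" for n
    proof -
      have "Q n x - G x = (cis (X n * u * x + X n * u * (X n * v) / 2) * f (x + X n * v) - f x - X n *\<^sub>R G x) / of_real (X n)"
        using X(2)[of n] by (simp add: Q_def weyl_def scaleR_conv_of_real divide_simps)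
      then show ?thesis by (simp add: norm_divide)
    qed
    ultimately show ?thesis by (simp add: comp_def tendsto_norm_zero_iff)
  qed
  define R' where "R' = R + \<bar>v\<bar>"
  \<comment> \<open>The first two summands bound the difference quotient \<open>Q n x\<close>, the
    bracket bounds its limit \<open>G x\<close>.\<close>
  define M where "M = (\<bar>u\<bar> * R' + \<bar>u\<bar> * \<bar>v\<bar>) * F + B * \<bar>v\<bar> + (\<bar>u\<bar> * R' * F + \<bar>v\<bar> * B)"
  have M0: "0 \<le> M" unfolding M_def R'_def using R(1) F0 B0 by simp
  have bound: "cmod (Q n x - G x) \<le> M * indicator {-R'..R'} x" for n x
  proof (cases "\<bar>x\<bar> \<le> R'")
    case False
    have "\<bar>X n * v\<bar> \<le> \<bar>v\<bar>" using X(3)[of n] by (simp add: abs_mult mult_left_le_one_le)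
    then have "R < \<bar>x + X n * v\<bar>" "R < \<bar>x\<bar>" using False unfolding R'_def by linarith+
    then show ?thesis using R D0 M0 by (simp add: Q_def G_def weyl_def)
  next
    case True
    define th where "th = X n * u * x + X n * u * (X n * v) / 2"
    have "\<bar>th\<bar> \<le> \<bar>X n\<bar> * (\<bar>u\<bar> * \<bar>x\<bar> + \<bar>u\<bar> * \<bar>v\<bar> * \<bar>X n\<bar>)"
      unfolding th_def by (rule order_trans[OF abs_triangle_ineq]) (simp add: abs_mult algebra_simps)
    also have "\<dots> \<le> \<bar>X n\<bar> * (\<bar>u\<bar> * R' + \<bar>u\<bar> * \<bar>v\<bar> * 1)"
      using True X(3)[of n] by (intro mult_left_mono add_mono) auto
    finally have th: "\<bar>th\<bar> \<le> \<bar>X n\<bar> * (\<bar>u\<bar> * R' + \<bar>u\<bar> * \<bar>v\<bar>)" by simp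
    have "cmod (weyl (X n * u) (X n * v) f x - f x) = cmod ((cis th - 1) * f (x + X n * v) + (f (x + X n * v) - f x))"
      unfolding weyl_def th_def by (simp add: algebra_simps)
    also have "\<dots> \<le> cmod (cis th - 1) * cmod (f (x + X n * v)) + cmod (f (x + X n * v) - f x)"
      by (rule order_trans[OF norm_triangle_ineq]) (simp add: norm_mult)
    also have "\<dots> \<le> (\<bar>X n\<bar> * (\<bar>u\<bar> * R' + \<bar>u\<bar> * \<bar>v\<bar>)) * F + B * \<bar>X n * v\<bar>"
      using order_trans[OF cmod_cis_minus_1_le th] F[of "x + X n * v"] lip[of "x + X n * v" x] order_trans[OF abs_ge_zero th]
      by (intro add_mono mult_mono) auto
    also have "\<dots> = \<bar>X n\<bar> * ((\<bar>u\<bar> * R' + \<bar>u\<bar> * \<bar>v\<bar>) * F + B * \<bar>v\<bar>)"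
      by (simp add: abs_mult algebra_simps)
    finally have Q: "cmod (Q n x) \<le> (\<bar>u\<bar> * R' + \<bar>u\<bar> * \<bar>v\<bar>) * F + B * \<bar>v\<bar>"
      using X(2)[of n] by (simp add: Q_def norm_divide pos_divide_le_eq mult.commute)
    have "cmod (G x) \<le> cmod (of_real (u * x) * (\<i> * f x)) + cmod (of_real v * D x)"
      unfolding G_def by (rule norm_triangle_ineq)
    also have "\<dots> = \<bar>u\<bar> * \<bar>x\<bar> * cmod (f x) + \<bar>v\<bar> * cmod (D x)"
      by (simp add: norm_mult abs_mult)
    also have "\<dots> \<le> \<bar>u\<bar> * R' * F + \<bar>v\<bar> * B"
      using True F[of x] B[of x] R(1) F0 B0 unfolding R'_def by (intro add_mono mult_mono) auto
    finally have "cmod (Q n x - G x) \<le> M"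
      using Q norm_triangle_ineq4[of "Q n x" "G x"] unfolding M_def by linarith
    then show ?thesis using True by (simp add: indicator_def abs_le_iff)
  qed
  have "(\<lambda>n. \<integral>\<^sup>+x. ennreal ((cmod (Q n x - G x))\<^sup>2) \<partial>lborel) \<longlonglongrightarrow> (\<integral>\<^sup>+(x::real). 0 \<partial>lborel)"
  proof (rule nn_integral_dominated_convergence[where w="\<lambda>x. ennreal (M\<^sup>2) * indicator {-R'..R'} x"])
    show "AE x in lborel. ennreal ((cmod (Q n x - G x))\<^sup>2) \<le> ennreal (M\<^sup>2) * indicator {-R'..R'} x" for n
    proof (rule AE_I2)
      fix x
      show "ennreal ((cmod (Q n x - G x))\<^sup>2) \<le> ennreal (M\<^sup>2) * indicator {-R'..R'} x"
        using bound[of n x] by (auto simp: indicator_def intro!: ennreal_leI power_mono)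
    qed
    show "(\<integral>\<^sup>+x. ennreal (M\<^sup>2) * indicator {-R'..R'} x \<partial>lborel) < \<infinity>"
      by (simp add: nn_integral_cmult_indicator ennreal_mult_less_top emeasure_lborel_Icc_eq)
    show "AE x in lborel. (\<lambda>n. ennreal ((cmod (Q n x - G x))\<^sup>2)) \<longlonglongrightarrow> 0"
    proof (rule AE_I2)
      fix x
      have "(\<lambda>n. (cmod (Q n x - G x))\<^sup>2) \<longlonglongrightarrow> (cmod 0)\<^sup>2"
        by (intro tendsto_power tendsto_norm lim)
      then show "(\<lambda>n. ennreal ((cmod (Q n x - G x))\<^sup>2)) \<longlonglongrightarrow> 0"
        using tendsto_ennrealI by fastforce
    qed
  qed measurable
  then show ?thesis unfolding L2_norm_sq_def G Q_def by simp
qed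

lemma unitary_group_weyl:
  "unitary_group_generated_by (\<lambda>f x. of_real u * position_op f x + of_real v * momentum_op f x)
     (\<lambda>t. weyl (t * u) (t * v))"
proof -
  \<comment> \<open>Restricting the filter to a neighbourhood provides the bound
    \<open>\<bar>X n\<bar> \<le> 1\<close> that \<open>weyl_generator\<close> asks of the
    sequences.\<close>
  have within: "at (0::real) = at 0 within {-1<..<1}"
    by (rule at_within_open[symmetric]) auto
  have "((\<lambda>t. L2_norm_sq (\<lambda>x. weyl (t * u) (t * v) f x - f x)) \<longlongrightarrow> 0) (at 0)" if f: "f \<in> L2_fun" for f
    unfolding tendsto_at_iff_sequentially
  proof (intro allI impI)
    fix X :: "nat \<Rightarrow> real" assume X: "X \<longlonglongrightarrow> 0"
    have "(\<lambda>n. ennreal (nsq (\<lambda>x. weyl (X n * u) (X n * v) f x - f x))) \<longlonglongrightarrow> ennreal 0"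
      by (intro tendsto_ennrealI weyl_strongly_continuous f X)
    then show "((\<lambda>t. L2_norm_sq (\<lambda>x. weyl (t * u) (t * v) f x - f x)) \<circ> X) \<longlonglongrightarrow> 0"
      using f by (simp add: comp_def L2_norm_sq_eq_nsq L2_fun_diff weyl_L2_fun)
  qed
  moreover have "((\<lambda>t. L2_norm_sq (\<lambda>x. (weyl (t * u) (t * v) f x - f x) / of_real t
     - \<i> * (of_real u * position_op f x + of_real v * momentum_op f x))) \<longlongrightarrow> 0) (at 0)" if f: "f \<in> test_functions" for f
    unfolding within tendsto_at_iff_sequentially
  proof (intro allI impI)
    fix X :: "nat \<Rightarrow> real" assume X: "\<forall>i. X i \<in> {-1<..<1} - {0}" "X \<longlonglongrightarrow> 0"
    have "X n \<noteq> 0" "\<bar>X n\<bar> \<le> 1" for n using X(1)[rule_format, of n] by auto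
    then show "((\<lambda>t. L2_norm_sq (\<lambda>x. (weyl (t * u) (t * v) f x - f x) / of_real t
     - \<i> * (of_real u * position_op f x + of_real v * momentum_op f x))) \<circ> X) \<longlonglongrightarrow> 0"
      using weyl_generator[OF f X(2)] by (simp add: comp_def)
  qed
  ultimately show ?thesis
    unfolding unitary_group_generated_by_def
    by (auto simp: bounded_operator_weyl L2_inner_weyl weyl_add)
qed

lemma is_exp_i_weyl:
  "is_exp_i (\<lambda>f x. of_real u * position_op f x + of_real v * momentum_op f x) (weyl u v)"
  unfolding is_exp_i_def using unitary_group_weyl[of u v]
  by (intro exI[of _ "\<lambda>t. weyl (t * u) (t * v)"]) simp

section \<open>Mixtures of pure states\<close>

text \<open>The average over z of the rank-one operators built from \<open>G z\<close>. Integrating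
  pointwise in x gives a concrete representative and avoids operator-valued integrals.\<close>

definition mixture :: "'z measure \<Rightarrow> ('z \<Rightarrow> real \<Rightarrow> complex) \<Rightarrow> operator" where
  "mixture M G f = (\<lambda>x. LINT z|M. L2_inner (G z) f * G z x)"

text \<open>The uniform bound \<open>B\<close> makes the integral in \<open>mixture\<close> converge
  at every x; the unit norms make the trace equal to 1.\<close>

locale pure_state_family = prob_space M for M :: "'z measure" +
  fixes G :: "'z \<Rightarrow> real \<Rightarrow> complex" and B :: real
  assumes G_measurable [measurable]: "(\<lambda>(z, x). G z x) \<in> borel_measurable (M \<Otimes>\<^sub>M borel)"
    and G_bound: "cmod (G z x) \<le> B"
    and G_L2: "G z \<in> L2_fun"
    and G_unit: "nsq (G z) = 1"
begin

sublocale pair_sigma_finite M "lborel :: real measure" ..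

lemma inner_G_measurable [measurable]:
  assumes "f \<in> L2_fun"
  shows "(\<lambda>z. L2_inner (G z) f) \<in> borel_measurable M" "(\<lambda>z. L2_inner f (G z)) \<in> borel_measurable M"
proof -
  have [measurable]: "f \<in> borel_measurable borel" using assms by (rule L2_fun_measurable)
  show "(\<lambda>z. L2_inner (G z) f) \<in> borel_measurable M" "(\<lambda>z. L2_inner f (G z)) \<in> borel_measurable M"
    unfolding L2_inner_def by measurable
qed

lemma inner_G_le:
  assumes "f \<in> L2_fun"
  shows "cmod (L2_inner (G z) f) \<le> sqrt (nsq f)" "cmod (L2_inner f (G z)) \<le> sqrt (nsq f)"
  using L2_Cauchy_Schwarz[OF G_L2 assms, of z] L2_Cauchy_Schwarz[OF assms G_L2, of z]
  by (auto simp: G_unit intro!: real_le_rsqrt)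

lemma integrable_inner_G:
  assumes "f \<in> L2_fun" "h \<in> L2_fun"
  shows "integrable M (\<lambda>z. L2_inner (G z) f * L2_inner h (G z))"
proof (rule integrable_const_bound[where B="sqrt (nsq f) * sqrt (nsq h)"])
  show "AE z in M. norm (L2_inner (G z) f * L2_inner h (G z)) \<le> sqrt (nsq f) * sqrt (nsq h)"
    using inner_G_le[OF assms(1)] inner_G_le[OF assms(2)]
    by (intro AE_I2) (auto simp: norm_mult intro!: mult_mono)
qed (use assms in measurable)

lemma mixture_integrand_bound:
  assumes "f \<in> L2_fun"
  shows "cmod (L2_inner (G z) f * G z x) \<le> sqrt (nsq f) * B"
  using inner_G_le[OF assms] G_bound[of z x] by (auto simp: norm_mult intro!: mult_mono)

lemma mixture_integrable:
  assumes "f \<in> L2_fun"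
  shows "integrable M (\<lambda>z. L2_inner (G z) f * G z x)"
  using assms mixture_integrand_bound[OF assms]
  by (intro integrable_const_bound[where B="sqrt (nsq f) * B"]) auto

lemma mixture_measurable [measurable]:
  assumes "f \<in> L2_fun"
  shows "mixture M G f \<in> borel_measurable borel"
  unfolding mixture_def using assms by measurable

text \<open>Pointwise, the square of a mean is at most the mean of the square (a variance is
  nonnegative), and Cauchy-Schwarz bounds the coefficient. Tonelli with \<open>G_unit\<close> then
  shows that a mixture is a contraction.\<close>

lemma L2_norm_sq_mixture_le:
  assumes f: "f \<in> L2_fun"
  shows "L2_norm_sq (mixture M G f) \<le> L2_norm_sq f"
proof -
  have le: "ennreal ((cmod (mixture M G f x))\<^sup>2) \<le> ennreal (nsq f) * (\<integral>\<^sup>+z. ennreal ((cmod (G z x))\<^sup>2) \<partial>M)" for x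
  proof -
    define a where "a z = cmod (L2_inner (G z) f * G z x)" for z
    have [measurable]: "a \<in> borel_measurable M" unfolding a_def using f by measurable
    have a0: "0 \<le> a z" for z unfolding a_def by simp
    have aB: "a z \<le> sqrt (nsq f) * B" for z unfolding a_def by (rule mixture_integrand_bound[OF f])
    have a: "integrable M a"
      using a0 aB by (intro integrable_const_bound[where B="sqrt (nsq f) * B"]) auto
    have a2: "integrable M (\<lambda>z. (a z)\<^sup>2)"
      using a0 aB by (intro integrable_const_bound[where B="(sqrt (nsq f) * B)\<^sup>2"]) (auto intro!: power_mono)
    have "(cmod (mixture M G f x))\<^sup>2 \<le> (LINT z|M. a z)\<^sup>2"
      unfolding mixture_def a_def by (intro power_mono integral_norm_bound) auto
    also have "\<dots> \<le> (LINT z|M. (a z)\<^sup>2)"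
      using variance_eq[OF a a2] variance_positive[of a] by linarith
    also have "\<dots> \<le> (LINT z|M. nsq f * (cmod (G z x))\<^sup>2)"
    proof (rule integral_mono[OF a2])
      show "integrable M (\<lambda>z. nsq f * (cmod (G z x))\<^sup>2)"
        using G_bound by (intro integrable_mult_right integrable_const_bound[where B="B\<^sup>2"]) (auto intro!: power_mono)
      show "(a z)\<^sup>2 \<le> nsq f * (cmod (G z x))\<^sup>2" for z
        unfolding a_def norm_mult power_mult_distrib
        using L2_Cauchy_Schwarz[OF G_L2 f, of z] by (intro mult_right_mono) (auto simp: G_unit)
    qed
    finally have "ennreal ((cmod (mixture M G f x))\<^sup>2) \<le> ennreal (LINT z|M. nsq f * (cmod (G z x))\<^sup>2)"
      by (rule ennreal_leI)
    also have "\<dots> = (\<integral>\<^sup>+z. ennreal (nsq f * (cmod (G z x))\<^sup>2) \<partial>M)"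
      using G_bound by (intro nn_integral_eq_integral[symmetric] integrable_mult_right integrable_const_bound[where B="B\<^sup>2"]) (auto intro!: power_mono)
    also have "\<dots> = ennreal (nsq f) * (\<integral>\<^sup>+z. ennreal ((cmod (G z x))\<^sup>2) \<partial>M)"
      by (simp add: ennreal_mult nn_integral_cmult)
    finally show ?thesis .
  qed
  have "L2_norm_sq (mixture M G f) \<le> (\<integral>\<^sup>+x. ennreal (nsq f) * (\<integral>\<^sup>+z. ennreal ((cmod (G z x))\<^sup>2) \<partial>M) \<partial>lborel)"
    unfolding L2_norm_sq_def by (intro nn_integral_mono le)
  also have "\<dots> = ennreal (nsq f) * (\<integral>\<^sup>+x. (\<integral>\<^sup>+z. ennreal ((cmod (G z x))\<^sup>2) \<partial>M) \<partial>lborel)"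
    by (rule nn_integral_cmult) measurable
  also have "(\<integral>\<^sup>+x. (\<integral>\<^sup>+z. ennreal ((cmod (G z x))\<^sup>2) \<partial>M) \<partial>lborel) = (\<integral>\<^sup>+z. (\<integral>\<^sup>+x. ennreal ((cmod (G z x))\<^sup>2) \<partial>lborel) \<partial>M)"
    by (rule Fubini') measurable
  also have "\<dots> = (\<integral>\<^sup>+z. 1 \<partial>M)"
    using L2_norm_sq_eq_nsq[OF G_L2] by (simp add: L2_norm_sq_def G_unit)
  also have "\<dots> = 1" by (simp add: emeasure_space_1)
  finally show ?thesis using f by (simp add: L2_norm_sq_eq_nsq)
qed

lemma mixture_L2:
  assumes f: "f \<in> L2_fun"
  shows "mixture M G f \<in> L2_fun"
  using L2_norm_sq_mixture_le[OF f] f mixture_measurable[OF f] unfolding L2_fun_def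
  by (auto intro: le_less_trans)

lemma L2_inner_mixture:
  assumes h: "h \<in> L2_fun" and f: "f \<in> L2_fun"
  shows "L2_inner h (mixture M G f) = (LINT z|M. L2_inner (G z) f * L2_inner h (G z))"
proof -
  have [measurable]: "f \<in> borel_measurable borel" "h \<in> borel_measurable borel"
    using f h by (auto dest: L2_fun_measurable)
  define F where "F z x = L2_inner (G z) f * (cnj (h x) * G z x)" for z x
  have [measurable]: "(\<lambda>(z, x). F z x) \<in> borel_measurable (M \<Otimes>\<^sub>M lborel)"
    unfolding F_def using f by measurable
  have "integrable (M \<Otimes>\<^sub>M lborel) (\<lambda>(z, x). F z x)"
  proof (rule Fubini_integrable)
    have "cmod (LINT x|lborel. norm (F z x)) \<le> sqrt (nsq f) * (nsq h + 1)" for z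
    proof -
      have "(LINT x|lborel. norm (F z x)) \<le> (LINT x|lborel. sqrt (nsq f) * ((cmod (h x))\<^sup>2 + (cmod (G z x))\<^sup>2))"
      proof (rule integral_mono)
        show "integrable lborel (\<lambda>x. norm (F z x))"
          unfolding F_def by (intro integrable_norm integrable_mult_right L2_inner_integrable h G_L2)
        show "integrable lborel (\<lambda>x. sqrt (nsq f) * ((cmod (h x))\<^sup>2 + (cmod (G z x))\<^sup>2))"
          by (intro integrable_mult_right Bochner_Integration.integrable_add L2_fun_integrable h G_L2)
        fix x
        show "norm (F z x) \<le> sqrt (nsq f) * ((cmod (h x))\<^sup>2 + (cmod (G z x))\<^sup>2)"
          unfolding F_def norm_mult complex_mod_cnj
          using inner_G_le[OF f, of z] by (intro mult_mono norm_mult_norm_le) auto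
      qed
      also have "\<dots> = sqrt (nsq f) * (nsq h + nsq (G z))"
        unfolding nsq_def by (simp add: L2_fun_integrable h G_L2)
      finally show ?thesis by (simp add: G_unit)
    qed
    then show "integrable M (\<lambda>z. LINT x|lborel. norm (case (z, x) of (z, x) \<Rightarrow> F z x))"
      by (intro integrable_const_bound[where B="sqrt (nsq f) * (nsq h + 1)"]) auto
    show "AE z in M. integrable lborel (\<lambda>x. case (z, x) of (z, x) \<Rightarrow> F z x)"
      unfolding F_def by (auto intro!: AE_I2 integrable_mult_right L2_inner_integrable h G_L2)
  qed measurable
  then have "(LINT x|lborel. LINT z|M. F z x) = (LINT z|M. LINT x|lborel. F z x)"
    by (rule Fubini_integral)
  moreover have "(LINT x|lborel. LINT z|M. F z x) = L2_inner h (mixture M G f)"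
  proof -
    have "(LINT z|M. F z x) = cnj (h x) * mixture M G f x" for x
    proof -
      have "(LINT z|M. F z x) = (LINT z|M. cnj (h x) * (L2_inner (G z) f * G z x))"
        unfolding F_def by (simp add: mult.left_commute)
      then show ?thesis by (simp add: mixture_def)
    qed
    then show ?thesis by (simp add: L2_inner_def)
  qed
  moreover have "(LINT x|lborel. F z x) = L2_inner (G z) f * L2_inner h (G z)" for z
    unfolding F_def L2_inner_def[of h] by simp
  ultimately show ?thesis by simp
qed

lemma bounded_operator_mixture: "bounded_operator (mixture M G)"
  unfolding bounded_operator_def
proof (intro conjI ballI allI)
  fix f g :: "real \<Rightarrow> complex" assume f: "f \<in> L2_fun" and g: "g \<in> L2_fun"
  have "mixture M G (\<lambda>y. f y + g y) x = mixture M G f x + mixture M G g x" for x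
    using mixture_integrable[OF f] mixture_integrable[OF g]
    by (simp add: mixture_def L2_inner_add_right[OF G_L2 f g] distrib_right)
  then show "AE x in lborel. mixture M G (\<lambda>y. f y + g y) x = mixture M G f x + mixture M G g x" by simp
next
  show "\<exists>C::real. \<forall>f\<in>L2_fun. L2_norm_sq (mixture M G f) \<le> ennreal C * L2_norm_sq f"
    using L2_norm_sq_mixture_le by (intro exI[of _ 1]) simp
next
  show "mixture M G f \<in> L2_fun" if "f \<in> L2_fun" for f using that by (rule mixture_L2)
qed (simp_all add: mixture_def L2_inner_mult_right mult.assoc)

lemma self_adjoint_mixture: "self_adjoint_operator (mixture M G)"
  unfolding self_adjoint_operator_def
proof (intro ballI)
  fix f g :: "real \<Rightarrow> complex" assume f: "f \<in> L2_fun" and g: "g \<in> L2_fun"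
  have "L2_inner (mixture M G f) g = cnj (L2_inner g (mixture M G f))"
    by (rule L2_inner_commute)
  also have "\<dots> = (LINT z|M. cnj (L2_inner (G z) f * L2_inner g (G z)))"
    unfolding L2_inner_mixture[OF g f] by (rule Bochner_Integration.integral_cnj[symmetric])
  also have "\<dots> = (LINT z|M. L2_inner (G z) g * L2_inner f (G z))"
    by (simp add: L2_inner_commute[of "G _" g] L2_inner_commute[of f "G _"] mult.commute)
  also have "\<dots> = L2_inner f (mixture M G g)"
    by (rule L2_inner_mixture[OF f g, symmetric])
  finally show "L2_inner f (mixture M G g) = L2_inner (mixture M G f) g" ..
qed

lemma positive_mixture: "positive_semidefinite (mixture M G)"
  unfolding positive_semidefinite_def
proof (intro ballI)
  fix f :: "real \<Rightarrow> complex" assume f: "f \<in> L2_fun"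
  have "L2_inner f (mixture M G f) = (LINT z|M. complex_of_real ((cmod (L2_inner (G z) f))\<^sup>2))"
    unfolding L2_inner_mixture[OF f f] complex_norm_square
    by (simp add: L2_inner_commute[of f "G _"])
  also have "\<dots> = of_real (LINT z|M. (cmod (L2_inner (G z) f))\<^sup>2)"
    by (rule Bochner_Integration.integral_complex_of_real)
  finally show "0 \<le> Re (L2_inner f (mixture M G f))" by simp
qed

text \<open>No adjoint operator is built: only its values \<open>H z\<close> on the family matter.
  For fixed z the summands add up to the inner product of \<open>H z\<close> and \<open>G z\<close>
  by Parseval. They are dominated by half the sum of two squared coefficients, whose total is 1 by
  Parseval for both unit vectors, so sum and integral may be exchanged in any basis.\<close>

theorem has_trace_mixture:
  assumes A: "\<And>f. f \<in> L2_fun \<Longrightarrow> A f \<in> L2_fun"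
    and H: "\<And>z. H z \<in> L2_fun" "\<And>z. nsq (H z) = 1"
    and adj: "\<And>f z. f \<in> L2_fun \<Longrightarrow> L2_inner (G z) (A f) = L2_inner (H z) f"
  shows "has_trace (mixture M G \<circ> A) (LINT z|M. L2_inner (H z) (G z))"
  unfolding has_trace_def
proof (intro allI impI)
  fix e assume e: "orthonormal_basis e"
  have eL: "e j \<in> L2_fun" for j using e by (simp add: orthonormal_basis_def)
  define t where "t j z = L2_inner (e j) (G z) * L2_inner (H z) (e j)" for j z
  have t_eq: "t j z = L2_inner (G z) (A (e j)) * L2_inner (e j) (G z)" for j z
    unfolding t_def adj[OF eL] by simp
  have t_int: "integrable M (t j)" for j
    unfolding t_eq[abs_def] by (intro integrable_inner_G A eL)
  have summand: "L2_inner (e j) ((mixture M G \<circ> A) (e j)) = (LINT z|M. t j z)" for j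
    unfolding t_eq comp_def by (intro L2_inner_mixture A eL)
  have t_sums: "(\<lambda>j. t j z) sums L2_inner (H z) (G z)" for z
    unfolding t_def by (rule orthonormal_expansion_inner[OF e G_L2 H(1)])
  define a b where "a j z = (cmod (L2_inner (e j) (G z)))\<^sup>2" and "b j z = (cmod (L2_inner (e j) (H z)))\<^sup>2" for j z
  have t_le: "cmod (t j z) \<le> (a j z + b j z) / 2" for j z
  proof -
    have "cmod (t j z) = cmod (L2_inner (e j) (G z)) * cmod (L2_inner (e j) (H z))"
      unfolding t_def L2_inner_commute[of "H z"] by (simp add: norm_mult)
    also have "\<dots> \<le> (a j z + b j z) / 2"
      using zero_le_power2[of "cmod (L2_inner (e j) (G z)) - cmod (L2_inner (e j) (H z))"]
      unfolding power2_diff a_def b_def by simp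
    finally show ?thesis .
  qed
  have a: "summable (\<lambda>j. a j z)" "(\<Sum>j. a j z) = 1" for z
    using Bessel_summable[OF e G_L2[of z]] Parseval_self[OF e G_L2[of z]] by (simp_all add: a_def G_unit)
  have b: "summable (\<lambda>j. b j z)" "(\<Sum>j. b j z) = 1" for z
    using Bessel_summable[OF e H(1)[of z]] Parseval_self[OF e H(1)[of z]] by (simp_all add: b_def H(2))
  have ab: "summable (\<lambda>j. (a j z + b j z) / 2)" "(\<Sum>j. (a j z + b j z) / 2) = 1" for z
    using summable_add[OF a(1)[of z] b(1)[of z]] suminf_add[OF a(1)[of z] b(1)[of z]] a(2)[of z] b(2)[of z]
    by (simp_all add: suminf_divide summable_divide)
  have t_summable: "summable (\<lambda>j. cmod (t j z))" for z
    by (rule summable_comparison_test'[OF ab(1)[of z]]) (use t_le in auto)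
  have int_summable: "summable (\<lambda>j. LINT z|M. cmod (t j z))"
  proof (rule summableI_nonneg_bounded[where x=1])
    fix n
    have "(\<Sum>j<n. LINT z|M. cmod (t j z)) = (LINT z|M. (\<Sum>j<n. cmod (t j z)))"
      by (rule Bochner_Integration.integral_sum[symmetric]) (use t_int in auto)
    also have "\<dots> \<le> (LINT z|M. 1)"
    proof (rule integral_mono)
      fix z
      have "(\<Sum>j<n. cmod (t j z)) \<le> (\<Sum>j<n. (a j z + b j z) / 2)" by (intro sum_mono t_le)
      also have "\<dots> \<le> (\<Sum>j. (a j z + b j z) / 2)"
        by (intro sum_le_suminf ab) (auto simp: a_def b_def)
      finally show "(\<Sum>j<n. cmod (t j z)) \<le> 1" by (simp only: ab(2))
    qed (use t_int in auto)
    finally show "(\<Sum>j<n. LINT z|M. cmod (t j z)) \<le> 1" by (simp add: prob_space)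
  qed simp
  have sums: "(\<lambda>j. LINT z|M. t j z) sums (LINT z|M. (\<Sum>j. t j z))"
    by (rule sums_integral) (use t_int t_summable int_summable in auto)
  have "(\<lambda>j. LINT z|M. t j z) sums (LINT z|M. L2_inner (H z) (G z))"
    using sums t_sums[THEN sums_unique] by simp
  \<comment> \<open>\<open>has_sum\<close> means unconditional convergence, so the ordered sum must
    be backed by absolute summability.\<close>
  moreover have "summable (\<lambda>j. norm (LINT z|M. t j z))"
    by (rule summable_comparison_test'[OF int_summable]) auto
  ultimately show "((\<lambda>j. L2_inner (e j) ((mixture M G \<circ> A) (e j))) has_sum (LINT z|M. L2_inner (H z) (G z))) UNIV"
    unfolding summand by (intro norm_summable_imp_has_sum)
qed

theorem quantum_state_mixture: "quantum_state (mixture M G)"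
proof -
  have "has_trace (mixture M G \<circ> (\<lambda>f. f)) (LINT z|M. L2_inner (G z) (G z))"
    by (rule has_trace_mixture) (simp_all add: G_L2 G_unit)
  then show ?thesis
    unfolding quantum_state_def
    by (simp add: bounded_operator_mixture self_adjoint_mixture positive_mixture L2_inner_self G_unit prob_space comp_def)
qed

text \<open>\<open>has_trace_mixture\<close> with \<open>weyl u v\<close> as operator and
  \<open>weyl (-u) (-v) (G z)\<close>, again a unit vector, as \<open>H z\<close>. The definition
  asks for some exponential, so exhibiting the Weyl operator is enough.\<close>

lemma characteristic_function_mixture:
  assumes "\<And>u v. (LINT z|M. L2_inner (G z) (weyl u v (G z))) = \<psi> (u, v)"
  shows "characteristic_function (mixture M G) \<psi>"
  unfolding characteristic_function_def
proof (intro allI)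
  fix u v
  have "has_trace (mixture M G \<circ> weyl u v) (LINT z|M. L2_inner (weyl (-u) (-v) (G z)) (G z))"
    by (rule has_trace_mixture) (simp_all add: weyl_L2_fun G_L2 G_unit nsq_weyl L2_inner_weyl_adjoint)
  then have "has_trace (mixture M G \<circ> weyl u v) (\<psi> (u, v))"
    by (simp add: assms flip: L2_inner_weyl_adjoint)
  then show "\<exists>A. is_exp_i (\<lambda>f x. of_real u * position_op f x + of_real v * momentum_op f x) A \<and>
      has_trace (mixture M G \<circ> A) (\<psi> (u, v))"
    using is_exp_i_weyl by blast
qed

end

section \<open>Gaussian densities with an oscillating factor\<close>

text \<open>Parametrised by the variance, because variances are what convolution adds and
  deconvolution subtracts.\<close>

definition gauss :: "real \<Rightarrow> real \<Rightarrow> real \<Rightarrow> real" where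
  "gauss m V x = exp (- (x - m)\<^sup>2 / (2 * V)) / sqrt (2 * pi * V)"

lemma gauss_eq_normal_density: "0 < V \<Longrightarrow> gauss m V = normal_density m (sqrt V)"
  by (simp add: gauss_def normal_density_def fun_eq_iff)

lemma gauss_nonneg [simp]: "0 < V \<Longrightarrow> 0 \<le> gauss m V x"
  by (simp add: gauss_def)

lemma gauss_measurable [measurable (raw)]:
  assumes [measurable]: "m \<in> borel_measurable M" "f \<in> borel_measurable M"
  shows "(\<lambda>z. gauss (m z) V (f z)) \<in> borel_measurable M"
  unfolding gauss_def by measurable

lemma gauss_continuous [continuous_intros]:
  "0 < V \<Longrightarrow> continuous_on S f \<Longrightarrow> continuous_on S (\<lambda>x. gauss m V (f x))"
  unfolding gauss_def by (auto intro!: continuous_intros)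

lemma gauss_integrable [simp]: "0 < V \<Longrightarrow> integrable lborel (gauss m V)"
  by (simp add: gauss_eq_normal_density)

lemma gauss_integral [simp]: "0 < V \<Longrightarrow> (LINT x|lborel. gauss m V x) = 1"
  by (simp add: gauss_eq_normal_density)

lemma gauss_nn_integral [simp]: "0 < V \<Longrightarrow> (\<integral>\<^sup>+x. ennreal (gauss m V x) \<partial>lborel) = 1"
  by (simp add: nn_integral_eq_integral)

lemma gauss_le: "0 < V \<Longrightarrow> gauss m V x \<le> 1 / sqrt (2 * pi * V)"
  unfolding gauss_def by (intro divide_right_mono) auto

lemma cmod_bounded_mult_integrable:
  fixes g :: "'a \<Rightarrow> complex"
  assumes f: "integrable M f" and g: "g \<in> borel_measurable M" "\<And>x. cmod (g x) \<le> C"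
  shows "integrable M (\<lambda>x. g x * complex_of_real (f x))"
proof (rule Bochner_Integration.integrable_bound[where f="\<lambda>x. C * f x"])
  show "AE x in M. norm (g x * complex_of_real (f x)) \<le> norm (C * f x)"
    using g(2) by (intro AE_I2) (auto simp: norm_mult abs_mult intro!: mult_right_mono order_trans[OF g(2) abs_ge_self])
qed (use f g(1) in auto)

lemma gauss_cf:
  assumes V: "0 < V"
  shows "(LINT x|lborel. cis (u * x) * of_real (gauss m V x)) = cis (u * m) * of_real (exp (- V * u\<^sup>2 / 2))"
proof -
  have std: "(LINT x|lborel. cis (t * x) * of_real (std_normal_density x)) = of_real (exp (- t\<^sup>2 / 2))" for t
  proof -
    have "char std_normal_distribution t = (LINT x|lborel. std_normal_density x *\<^sub>R iexp (t * x))"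
      unfolding char_def by (rule integral_density) auto
    then show ?thesis
      by (simp add: char_std_normal_distribution cis_conv_exp scaleR_conv_of_real mult.commute)
  qed
  define s where "s = sqrt V"
  have s: "0 < s" "s\<^sup>2 = V" using V by (auto simp: s_def)
  have "(LINT x|lborel. cis (u * x) * of_real (gauss m V x))
     = s *\<^sub>R (LINT x|lborel. cis (u * (m + s * x)) * of_real (gauss m V (m + s * x)))"
    using lborel_integral_real_affine[of s "\<lambda>x. cis (u * x) * of_real (gauss m V x)" m] s(1) by simp
  also have "(\<lambda>x. cis (u * (m + s * x)) * of_real (gauss m V (m + s * x)))
     = (\<lambda>x. (cis (u * m) / of_real s) * (cis ((u * s) * x) * of_real (std_normal_density x)))"
  proof
    fix x
    have "gauss m V (m + s * x) = std_normal_density x / s"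
      using s V by (simp add: gauss_def std_normal_density_def power_mult_distrib s_def[symmetric] real_sqrt_mult)
    moreover have "cis (u * (m + s * x)) = cis (u * m) * cis ((u * s) * x)"
      by (simp add: cis_mult algebra_simps)
    ultimately show "cis (u * (m + s * x)) * of_real (gauss m V (m + s * x)) = (cis (u * m) / of_real s) * (cis ((u * s) * x) * of_real (std_normal_density x))"
      by simp
  qed
  also have "s *\<^sub>R (LINT x|lborel. (cis (u * m) / of_real s) * (cis ((u * s) * x) * of_real (std_normal_density x)))
     = cis (u * m) * of_real (exp (- (u * s)\<^sup>2 / 2))"
    using s(1) by (simp add: std scaleR_conv_of_real)
  finally show ?thesis using s by (simp add: power_mult_distrib mult.commute)
qed

lemma gauss_cf_integrable: "0 < V \<Longrightarrow> integrable lborel (\<lambda>x. cis (u * x) * complex_of_real (gauss m V x))"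
  by (rule cmod_bounded_mult_integrable[where C=1]) auto

lemma gauss_cos: "0 < V \<Longrightarrow> (LINT x|lborel. cos (u * x) * gauss m V x) = cos (u * m) * exp (- V * u\<^sup>2 / 2)"
  and gauss_sin: "0 < V \<Longrightarrow> (LINT x|lborel. sin (u * x) * gauss m V x) = sin (u * m) * exp (- V * u\<^sup>2 / 2)"
proof -
  assume V: "0 < V"
  have "(LINT x|lborel. Re (cis (u * x) * complex_of_real (gauss m V x))) = Re (cis (u * m) * of_real (exp (- V * u\<^sup>2 / 2)))"
    unfolding gauss_cf[OF V, symmetric] by (rule integral_Re[OF gauss_cf_integrable[OF V]])
  then show "(LINT x|lborel. cos (u * x) * gauss m V x) = cos (u * m) * exp (- V * u\<^sup>2 / 2)" by simp
next
  assume V: "0 < V"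
  have "(LINT x|lborel. Im (cis (u * x) * complex_of_real (gauss m V x))) = Im (cis (u * m) * of_real (exp (- V * u\<^sup>2 / 2)))"
    unfolding gauss_cf[OF V, symmetric] by (rule integral_Im[OF gauss_cf_integrable[OF V]])
  then show "(LINT x|lborel. sin (u * x) * gauss m V x) = sin (u * m) * exp (- V * u\<^sup>2 / 2)" by simp
qed

text \<open>
  The normalisation of the amplitude is chosen so that convolution with a centred Gaussian changes
  only \<open>V\<close>: up to the phase, the oscillating part is the Gaussian density at a complex argument
  \<open>x + \<i> l\<close>, a solution of the heat equation.
\<close>

definition modulated :: "real \<Rightarrow> real \<Rightarrow> real \<Rightarrow> real \<Rightarrow> real" where
  "modulated V \<eta> l x = gauss 0 V x * (1 + \<eta> * exp (l\<^sup>2 / (2 * V)) * sin (l * x / V))"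

lemma modulated_measurable [measurable (raw)]:
  assumes [measurable]: "l \<in> borel_measurable M" "f \<in> borel_measurable M"
  shows "(\<lambda>z. modulated V \<eta> (l z) (f z)) \<in> borel_measurable M"
  unfolding modulated_def by measurable

lemma modulated_continuous [continuous_intros]:
  fixes f :: "'a::t2_space \<Rightarrow> real"
  shows "0 < V \<Longrightarrow> continuous_on S f \<Longrightarrow> continuous_on S (\<lambda>x. modulated V \<eta> l (f x))"
  unfolding modulated_def
  by (intro continuous_on_mult continuous_on_add continuous_on_const gauss_continuous continuous_on_sin
      continuous_on_divide) auto

lemma modulated_integrable [simp]:
  assumes V: "0 < V"
  shows "integrable lborel (modulated V \<eta> l)"
proof (rule Bochner_Integration.integrable_bound)
  define c where "c = \<eta> * exp (l\<^sup>2 / (2 * V))"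
  show "integrable lborel (\<lambda>x. (1 + \<bar>c\<bar>) * gauss 0 V x)" using V by simp
  show "AE x in lborel. norm (modulated V \<eta> l x) \<le> norm ((1 + \<bar>c\<bar>) * gauss 0 V x)"
  proof (rule AE_I2)
    fix x
    have "\<bar>1 + c * sin (l * x / V)\<bar> \<le> 1 + \<bar>c\<bar> * 1"
      by (rule order_trans[OF abs_triangle_ineq]) (simp add: abs_mult mult_left_le)
    then show "norm (modulated V \<eta> l x) \<le> norm ((1 + \<bar>c\<bar>) * gauss 0 V x)"
      using V by (simp add: modulated_def c_def abs_mult mult.commute mult_left_mono)
  qed
qed simp

lemma oscillation_le_1:
  fixes c k x :: real
  assumes "\<bar>c\<bar> * exp k \<le> 1"
  shows "\<bar>c * exp k * sin x\<bar> \<le> 1"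
  using mult_mono[OF assms abs_sin_le_one[of x]] by (simp add: abs_mult)

lemma modulated_nonneg:
  assumes V: "0 < V" and \<eta>: "\<bar>\<eta>\<bar> * exp (l\<^sup>2 / (2 * V)) \<le> 1"
  shows "0 \<le> modulated V \<eta> l x"
proof -
  have "0 \<le> 1 + \<eta> * exp (l\<^sup>2 / (2 * V)) * sin (l * x / V)"
    using oscillation_le_1[OF \<eta>, of "l * x / V"] by linarith
  then show ?thesis using V by (simp add: modulated_def)
qed

lemma modulated_le:
  assumes V: "0 < V" and \<eta>: "\<bar>\<eta>\<bar> * exp (l\<^sup>2 / (2 * V)) \<le> 1"
  shows "modulated V \<eta> l x \<le> 2 / sqrt (2 * pi * V)"
proof -
  have le: "1 + \<eta> * exp (l\<^sup>2 / (2 * V)) * sin (l * x / V) \<le> 2"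
    using oscillation_le_1[OF \<eta>, of "l * x / V"] by linarith
  have "modulated V \<eta> l x \<le> gauss 0 V x * 2"
    unfolding modulated_def using V le by (intro mult_left_mono) auto
  also have "\<dots> \<le> (1 / sqrt (2 * pi * V)) * 2" by (intro mult_right_mono gauss_le V) auto
  finally show ?thesis by simp
qed

text \<open>Writing the sine as two exponentials shifts the frequency by \<open>l / V\<close> either
  way. On completing the square the prefactor \<open>exp (l^2 / (2 * V))\<close> cancels exactly, so
  the oscillation contributes \<open>\<eta> * sinh (l * u)\<close>, in which \<open>V\<close> does
  not occur.\<close>

lemma modulated_cf:
  assumes V: "0 < V"
  shows "(LINT x|lborel. cis (u * x) * of_real (modulated V \<eta> l x))
    = of_real (exp (- V * u\<^sup>2 / 2)) * (1 + \<i> * of_real (\<eta> * sinh (l * u)))"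
proof -
  define c k where "c = \<eta> * exp (l\<^sup>2 / (2 * V))" and "k = l / V"
  have split: "cis (u * x) * of_real (modulated V \<eta> l x)
      = cis (u * x) * of_real (gauss 0 V x)
        + (of_real c / (2 * \<i>)) * (cis ((u + k) * x) * of_real (gauss 0 V x) - cis ((u - k) * x) * of_real (gauss 0 V x))" for x
  proof -
    have "complex_of_real (sin (k * x)) = (cis (k * x) - cis (- (k * x))) / (2 * \<i>)"
      by (simp add: complex_eq_iff)
    moreover have "cis ((u + k) * x) = cis (u * x) * cis (k * x)" "cis ((u - k) * x) = cis (u * x) * cis (- (k * x))"
      by (simp_all add: cis_mult algebra_simps)
    moreover have "modulated V \<eta> l x = gauss 0 V x * (1 + c * sin (k * x))"
      by (simp add: modulated_def c_def k_def)
    moreover have "cis (u * x) * of_real (gauss 0 V x * (1 + c * sin (k * x)))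
      = cis (u * x) * of_real (gauss 0 V x) + of_real c * (cis (u * x) * of_real (sin (k * x)) * of_real (gauss 0 V x))"
      by (simp add: algebra_simps)
    ultimately show ?thesis by (simp only:) (simp add: field_simps)
  qed
  have ex: "exp (l\<^sup>2 / (2 * V)) * exp (- V * (u + k)\<^sup>2 / 2) = exp (- V * u\<^sup>2 / 2) * exp (- (l * u))"
           "exp (l\<^sup>2 / (2 * V)) * exp (- V * (u - k)\<^sup>2 / 2) = exp (- V * u\<^sup>2 / 2) * exp (l * u)"
    unfolding exp_add[symmetric] using V by (simp_all add: k_def power2_eq_square field_simps)
  have "(LINT x|lborel. cis (u * x) * of_real (modulated V \<eta> l x))
     = of_real (exp (- V * u\<^sup>2 / 2)) + (of_real c / (2 * \<i>)) * (of_real (exp (- V * (u + k)\<^sup>2 / 2)) - of_real (exp (- V * (u - k)\<^sup>2 / 2)))"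
    unfolding split using gauss_cf_integrable[OF V] gauss_cf[OF V] by simp
  also have "(of_real c / (2 * \<i>)) * (of_real (exp (- V * (u + k)\<^sup>2 / 2)) - of_real (exp (- V * (u - k)\<^sup>2 / 2)))
     = of_real (\<eta> * (exp (l\<^sup>2 / (2 * V)) * exp (- V * (u + k)\<^sup>2 / 2) - exp (l\<^sup>2 / (2 * V)) * exp (- V * (u - k)\<^sup>2 / 2))) / (2 * \<i>)"
    by (simp add: c_def field_simps)
  also have "\<dots> = of_real (exp (- V * u\<^sup>2 / 2)) * (\<i> * of_real (\<eta> * sinh (l * u)))"
  proof -
    have i: "complex_of_real X / (2 * \<i>) = \<i> * of_real (- X / 2)" for X
      by (simp add: complex_eq_iff Re_divide Im_divide)
    have "- (\<eta> * (exp (- V * u\<^sup>2 / 2) * exp (- (l * u)) - exp (- V * u\<^sup>2 / 2) * exp (l * u))) / 2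
      = exp (- V * u\<^sup>2 / 2) * (\<eta> * sinh (l * u))"
      by (simp add: sinh_def field_simps)
    then show ?thesis unfolding ex i by simp
  qed
  finally show ?thesis by (simp add: distrib_left)
qed

lemma modulated_integral [simp]:
  assumes V: "0 < V"
  shows "(LINT x|lborel. modulated V \<eta> l x) = 1"
proof -
  have "complex_of_real (LINT x|lborel. modulated V \<eta> l x) = (LINT x|lborel. cis (0 * x) * of_real (modulated V \<eta> l x))"
    by simp
  also have "\<dots> = 1" unfolding modulated_cf[OF V] by simp
  finally show ?thesis by (simp only: of_real_eq_1_iff)
qed

text \<open>As a function of \<xi> the product of the two Gaussians is \<open>gauss 0 S z\<close>
  times a density with mean \<open>m\<close> and variance \<open>W\<close>; the sine is then
  averaged by \<open>gauss_cos\<close> and \<open>gauss_sin\<close>. This direct computation needs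
  no uniqueness theorem for characteristic functions.\<close>

lemma modulated_convolution:
  assumes V: "0 < V"
  shows "(LINT \<xi>|lborel. modulated V \<eta> l (z - \<tau> * \<xi>) * std_normal_density \<xi>) = modulated (V + \<tau>\<^sup>2) \<eta> l z"
    and "integrable lborel (\<lambda>\<xi>. modulated V \<eta> l (z - \<tau> * \<xi>) * std_normal_density \<xi>)"
proof -
  define S k m W c where "S = V + \<tau>\<^sup>2" and "k = l / V" and "m = \<tau> * z / S" and "W = V / S" and "c = \<eta> * exp (l\<^sup>2 / (2 * V))"
  have S: "0 < S" using V unfolding S_def by (simp add: add_pos_nonneg)
  have W: "0 < W" using V S by (simp add: W_def)
  have gg: "gauss 0 V (z - \<tau> * \<xi>) * std_normal_density \<xi> = gauss 0 S z * gauss m W \<xi>" for \<xi>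
  proof -
    have "(z - \<tau> * \<xi>)\<^sup>2 / (2 * V) + \<xi>\<^sup>2 / 2 = z\<^sup>2 / (2 * S) + (\<xi> - m)\<^sup>2 / (2 * W)"
    proof -
      have "(\<xi> - m)\<^sup>2 = (S * \<xi> - \<tau> * z)\<^sup>2 / S\<^sup>2" using S by (simp add: m_def power_divide[symmetric] diff_divide_distrib)
      then have "(\<xi> - m)\<^sup>2 / (2 * W) = (S * \<xi> - \<tau> * z)\<^sup>2 / (2 * V * S)" using S V by (simp add: W_def power2_eq_square)
      moreover have "(z - \<tau> * \<xi>)\<^sup>2 * S + \<xi>\<^sup>2 * (V * S) = z\<^sup>2 * V + (S * \<xi> - \<tau> * z)\<^sup>2"
        unfolding S_def by (simp add: power2_eq_square algebra_simps)
      then have "((z - \<tau> * \<xi>)\<^sup>2 * S + \<xi>\<^sup>2 * (V * S)) / (2 * V * S) = (z\<^sup>2 * V + (S * \<xi> - \<tau> * z)\<^sup>2) / (2 * V * S)" by simp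
      ultimately show ?thesis using S V by (simp add: add_divide_distrib)
    qed
    then have "exp (- ((z - \<tau> * \<xi>)\<^sup>2 / (2 * V))) * exp (- (\<xi>\<^sup>2 / 2)) = exp (- (z\<^sup>2 / (2 * S))) * exp (- ((\<xi> - m)\<^sup>2 / (2 * W)))"
      unfolding exp_add[symmetric] by simp
    moreover have "sqrt (2 * pi * V) * sqrt (2 * pi) = sqrt (2 * pi * S) * sqrt (2 * pi * W)"
      using S by (simp add: W_def flip: real_sqrt_mult)
    ultimately show ?thesis
      unfolding gauss_def std_normal_density_def by (simp add: field_simps)
  qed
  have eq: "modulated V \<eta> l (z - \<tau> * \<xi>) * std_normal_density \<xi> = gauss 0 S z * (gauss m W \<xi> + c * sin (k * z) * (cos ((k * \<tau>) * \<xi>) * gauss m W \<xi>) - c * cos (k * z) * (sin ((k * \<tau>) * \<xi>) * gauss m W \<xi>))" for \<xi>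
  proof -
    have "modulated V \<eta> l (z - \<tau> * \<xi>) * std_normal_density \<xi> = (gauss 0 V (z - \<tau> * \<xi>) * std_normal_density \<xi>) * (1 + c * sin (k * z - (k * \<tau>) * \<xi>))"
      unfolding modulated_def c_def k_def by (simp add: algebra_simps diff_divide_distrib)
    then show ?thesis unfolding gg sin_diff by (simp add: algebra_simps)
  qed
  have int_cos: "integrable lborel (\<lambda>\<xi>. cos ((k * \<tau>) * \<xi>) * gauss m W \<xi>)" and int_sin: "integrable lborel (\<lambda>\<xi>. sin ((k * \<tau>) * \<xi>) * gauss m W \<xi>)"
    using W by (auto intro!: Bochner_Integration.integrable_bound[OF gauss_integrable[OF W, of m]] AE_I2 mult_left_le_one_le simp: abs_mult)
  show "integrable lborel (\<lambda>\<xi>. modulated V \<eta> l (z - \<tau> * \<xi>) * std_normal_density \<xi>)"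
    unfolding eq using int_cos int_sin W by auto
  have "(LINT \<xi>|lborel. modulated V \<eta> l (z - \<tau> * \<xi>) * std_normal_density \<xi>)
    = gauss 0 S z * (1 + c * sin (k * z) * (cos ((k * \<tau>) * m) * exp (- W * (k * \<tau>)\<^sup>2 / 2)) - c * cos (k * z) * (sin ((k * \<tau>) * m) * exp (- W * (k * \<tau>)\<^sup>2 / 2)))"
    unfolding eq using int_cos int_sin W by (simp add: gauss_cos gauss_sin)
  also have "\<dots> = gauss 0 S z * (1 + (c * exp (- W * (k * \<tau>)\<^sup>2 / 2)) * sin (k * z - (k * \<tau>) * m))"
    unfolding sin_diff by (simp add: algebra_simps)
  \<comment> \<open>Frequency and amplitude exponent are both multiplied by \<open>V / S\<close>: so
    \<open>l / V\<close> becomes \<open>l / S\<close>, and the prefactor becomes the one belonging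
    to variance \<open>S\<close>.\<close>
  also have "k * z - (k * \<tau>) * m = l * z / S"
  proof -
    have "k * z - (k * \<tau>) * m = k * z * (1 - \<tau>\<^sup>2 / S)" by (simp add: m_def power2_eq_square algebra_simps)
    also have "1 - \<tau>\<^sup>2 / S = V / S" using S by (simp add: S_def field_simps)
    finally show ?thesis using V by (simp add: k_def)
  qed
  also have "c * exp (- W * (k * \<tau>)\<^sup>2 / 2) = \<eta> * exp (l\<^sup>2 / (2 * S))"
  proof -
    have "l\<^sup>2 / (2 * V) - W * (k * \<tau>)\<^sup>2 / 2 = l\<^sup>2 / (2 * V) * (1 - \<tau>\<^sup>2 / S)"
      using V S by (simp add: W_def k_def power2_eq_square field_simps)
    also have "1 - \<tau>\<^sup>2 / S = V / S" using S by (simp add: S_def field_simps)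
    also have "l\<^sup>2 / (2 * V) * (V / S) = l\<^sup>2 / (2 * S)" using V by simp
    finally show ?thesis unfolding c_def by (simp add: mult.assoc exp_add[symmetric])
  qed
  finally show "(LINT \<xi>|lborel. modulated V \<eta> l (z - \<tau> * \<xi>) * std_normal_density \<xi>) = modulated (V + \<tau>\<^sup>2) \<eta> l z"
    unfolding modulated_def S_def by simp
qed

lemma lborel_prod_mult:
  fixes f g :: "real \<Rightarrow> 'a::{real_normed_field, banach, second_countable_topology}"
  assumes f: "integrable lborel f" and g: "integrable lborel g"
  shows integrable_lborel_prod_mult: "integrable lborel (\<lambda>(x, y). f x * g y)"
    and integral_lborel_prod_mult: "(LINT (x, y)|lborel. f x * g y) = (LINT x|lborel. f x) * (LINT y|lborel. g y)"
proof -
  have int: "integrable (lborel \<Otimes>\<^sub>M lborel) (\<lambda>(x, y). f x * g y)"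
  proof (rule lborel_pair.Fubini_integrable)
    show "integrable lborel (\<lambda>x. LINT y|lborel. norm (case (x, y) of (x, y) \<Rightarrow> f x * g y))"
      using f g by (simp add: norm_mult)
  qed (use f g in auto)
  then show "integrable lborel (\<lambda>(x, y). f x * g y)" by (simp add: lborel_prod)
  show "(LINT (x, y)|lborel. f x * g y) = (LINT x|lborel. f x) * (LINT y|lborel. g y)"
    using lborel_pair.integral_fst'[OF int] g by (simp add: lborel_prod)
qed

lemma nn_integral_lborel_prod_mult:
  fixes f g :: "real \<Rightarrow> ennreal"
  assumes [measurable]: "f \<in> borel_measurable borel" "g \<in> borel_measurable borel"
  shows "(\<integral>\<^sup>+(x, y). f x * g y \<partial>lborel) = (\<integral>\<^sup>+x. f x \<partial>lborel) * (\<integral>\<^sup>+y. g y \<partial>lborel)"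
proof -
  have "(\<integral>\<^sup>+(x, y). f x * g y \<partial>lborel) = (\<integral>\<^sup>+x. \<integral>\<^sup>+y. f x * g y \<partial>lborel \<partial>lborel)"
    unfolding lborel_prod[symmetric] by (subst lborel.nn_integral_fst[symmetric]) auto
  then show ?thesis by (simp add: nn_integral_cmult nn_integral_multc)
qed

section \<open>Mixtures of squeezed coherent states\<close>

text \<open>
  Displaced squeezed states: position variance \<open>a\<close>, momentum variance \<open>1 / (4 a)\<close>, so that \<open>V - a\<close> and
  \<open>V - 1 / (4 a)\<close> are the variances left to the mixing density in \<open>state\<close> below.
\<close>

definition coherent :: "real \<Rightarrow> real \<times> real \<Rightarrow> real \<Rightarrow> complex" where
  "coherent a = (\<lambda>(q, p) x. of_real (sqrt (gauss q a x)) * cis (p * x))"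

lemma cmod_coherent: "0 < a \<Longrightarrow> (cmod (coherent a z x))\<^sup>2 = gauss (fst z) a x"
  by (simp add: coherent_def norm_mult split_beta)

lemma coherent_measurable: "(\<lambda>(z, x). coherent a z x) \<in> borel_measurable (borel \<Otimes>\<^sub>M borel)"
  unfolding coherent_def split_beta borel_prod[symmetric] by measurable

lemma coherent_L2: "0 < a \<Longrightarrow> coherent a z \<in> L2_fun"
  by (rule L2_funI) (simp_all add: cmod_coherent, simp add: coherent_def split_beta)

lemma nsq_coherent: "0 < a \<Longrightarrow> nsq (coherent a z) = 1"
  by (simp add: nsq_def cmod_coherent)

text \<open>The geometric mean of two Gaussians a distance v apart is the Gaussian at their
  midpoint, damped by \<open>exp (- v^2 / (8 * a))\<close>. The phase \<open>u * v / 2\<close> of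
  the Weyl operator compensates for the midpoint being shifted by \<open>v / 2\<close>.\<close>

lemma inner_weyl_coherent:
  assumes a: "0 < a"
  shows "L2_inner (coherent a (q, p)) (weyl u v (coherent a (q, p)))
    = of_real (exp (- a * u\<^sup>2 / 2 - v\<^sup>2 / (8 * a))) * cis (u * q + v * p)"
proof -
  define m where "m = q - v / 2"
  have "cnj (coherent a (q, p) x) * weyl u v (coherent a (q, p)) x
     = (of_real (exp (- v\<^sup>2 / (8 * a))) * cis (u * v / 2 + v * p)) * (cis (u * x) * of_real (gauss m a x))" for x
  proof -
    have "(x - q)\<^sup>2 / (2 * a) + (x + v - q)\<^sup>2 / (2 * a) = 2 * ((x - m)\<^sup>2 / (2 * a) + v\<^sup>2 / (8 * a))"
      using a unfolding m_def by (simp add: power2_eq_square field_simps)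
    then have "gauss q a x * gauss q a (x + v) = (exp (- v\<^sup>2 / (8 * a)) * gauss m a x)\<^sup>2"
      using a unfolding gauss_def
      by (simp add: power_divide power_mult_distrib exp_add[symmetric] exp_of_nat_mult[of 2, symmetric, simplified] field_simps)
    then have "sqrt (gauss q a x) * sqrt (gauss q a (x + v)) = exp (- v\<^sup>2 / (8 * a)) * gauss m a x"
      using a by (simp add: real_sqrt_mult[symmetric])
    then have 1: "complex_of_real (sqrt (gauss q a x)) * of_real (sqrt (gauss q a (x + v))) = of_real (exp (- v\<^sup>2 / (8 * a)) * gauss m a x)"
      by (metis of_real_mult)
    have "cnj (coherent a (q, p) x) * weyl u v (coherent a (q, p)) x
       = (complex_of_real (sqrt (gauss q a x)) * of_real (sqrt (gauss q a (x + v))))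
         * (cis (- (p * x)) * (cis (u * x + u * v / 2) * cis (p * (x + v))))"
      by (simp add: coherent_def weyl_def cis_cnj)
    also have "cis (- (p * x)) * (cis (u * x + u * v / 2) * cis (p * (x + v))) = cis (u * v / 2 + v * p) * cis (u * x)"
      by (simp add: cis_mult algebra_simps)
    finally show ?thesis unfolding 1 by simp
  qed
  then have "L2_inner (coherent a (q, p)) (weyl u v (coherent a (q, p)))
     = (of_real (exp (- v\<^sup>2 / (8 * a))) * cis (u * v / 2 + v * p)) * (cis (u * m) * of_real (exp (- a * u\<^sup>2 / 2)))"
    unfolding L2_inner_def by (simp add: gauss_cf[OF a])
  also have "\<dots> = of_real (exp (- a * u\<^sup>2 / 2) * exp (- v\<^sup>2 / (8 * a))) * (cis (u * v / 2 + v * p) * cis (u * m))"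
    by simp
  also have "exp (- a * u\<^sup>2 / 2) * exp (- v\<^sup>2 / (8 * a)) = exp (- a * u\<^sup>2 / 2 - v\<^sup>2 / (8 * a))"
    by (simp add: exp_add[symmetric])
  also have "cis (u * v / 2 + v * p) * cis (u * m) = cis (u * q + v * p)"
  proof -
    have "u * v / 2 + v * p + u * m = u * q + v * p" by (simp add: m_def right_diff_distrib)
    then show ?thesis by (simp only: cis_mult)
  qed
  finally show ?thesis .
qed

text \<open>Two variances, because the same family serves as mixing density (unequal ones,
  \<open>V - a\<close> and \<open>V - 1 / (4 * a)\<close>) and as Wigner function (equal
  ones).\<close>

definition plane_density :: "real \<Rightarrow> real \<Rightarrow> real \<Rightarrow> real \<Rightarrow> real \<times> real \<Rightarrow> real" where
  "plane_density V V' \<eta> l = (\<lambda>(q, p). modulated V \<eta> l q * gauss 0 V' p)"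

lemma plane_density_measurable [measurable]: "plane_density V V' \<eta> l \<in> borel_measurable borel"
  unfolding plane_density_def split_beta borel_prod[symmetric] by measurable

lemma plane_density_integrable:
  assumes "0 < V" "0 < V'"
  shows "integrable lborel (plane_density V V' \<eta> l)"
  unfolding plane_density_def using assms by (intro integrable_lborel_prod_mult) auto

lemma plane_density_integral:
  assumes "0 < V" "0 < V'"
  shows "(LINT z|lborel. plane_density V V' \<eta> l z) = 1"
  unfolding plane_density_def using assms by (subst integral_lborel_prod_mult) auto

lemma plane_density_cf:
  assumes V: "0 < V" and V': "0 < V'"
  shows "(LINT (q, p)|lborel. cis (u * q + v * p) * of_real (plane_density V V' \<eta> l (q, p)))
    = of_real (exp (- (V * u\<^sup>2 + V' * v\<^sup>2) / 2)) * (1 + \<i> * of_real (\<eta> * sinh (l * u)))"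
proof -
  have 1: "integrable lborel (\<lambda>x. cis (u * x) * complex_of_real (modulated V \<eta> l x))"
    using V by (intro cmod_bounded_mult_integrable[where C=1]) auto
  have "(LINT (q, p)|lborel. cis (u * q + v * p) * of_real (plane_density V V' \<eta> l (q, p)))
     = (LINT (q, p)|lborel. (cis (u * q) * of_real (modulated V \<eta> l q)) * (cis (v * p) * of_real (gauss 0 V' p)))"
    by (simp add: plane_density_def cis_mult[symmetric] mult_ac)
  also have "\<dots> = (LINT q|lborel. cis (u * q) * of_real (modulated V \<eta> l q)) * (LINT p|lborel. cis (v * p) * of_real (gauss 0 V' p))"
    by (rule integral_lborel_prod_mult[OF 1 gauss_cf_integrable[OF V']])
  also have "\<dots> = of_real (exp (- V * u\<^sup>2 / 2) * exp (- V' * v\<^sup>2 / 2)) * (1 + \<i> * of_real (\<eta> * sinh (l * u)))"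
    unfolding modulated_cf[OF V] gauss_cf[OF V'] by simp
  also have "exp (- V * u\<^sup>2 / 2) * exp (- V' * v\<^sup>2 / 2) = exp (- (V * u\<^sup>2 + V' * v\<^sup>2) / 2)"
    unfolding exp_add[symmetric] by (simp add: field_simps)
  finally show ?thesis .
qed

definition state :: "real \<Rightarrow> real \<Rightarrow> real \<Rightarrow> real \<Rightarrow> operator" where
  "state V a \<eta> l = mixture (density lborel (\<lambda>z. ennreal (plane_density (V - a) (V - 1 / (4 * a)) \<eta> l z))) (coherent a)"

definition state_cf :: "real \<Rightarrow> real \<Rightarrow> real \<Rightarrow> real \<times> real \<Rightarrow> complex" where
  "state_cf V \<eta> l = (\<lambda>(u, v). of_real (exp (- (V * u\<^sup>2 + V * v\<^sup>2) / 2)) * (1 + \<i> * of_real (\<eta> * sinh (l * u))))"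

lemma state_cf_measurable [measurable]: "state_cf V \<eta> l \<in> borel_measurable borel"
  unfolding state_cf_def split_beta sinh_def borel_prod[symmetric] by measurable

text \<open>The condition on \<eta> is the one that makes the mixing density, of variance
  \<open>V - a\<close>, nonnegative. Averaging the overlaps of \<open>inner_weyl_coherent\<close>
  multiplies its characteristic function by a Gaussian, which restores variance \<open>V\<close> in
  both directions and leaves \<eta> and \<open>l\<close> alone.\<close>

lemma state_quantum:
  assumes a: "0 < a" "a < V" "1 / (4 * a) < V" and \<eta>: "\<bar>\<eta>\<bar> * exp (l\<^sup>2 / (2 * (V - a))) \<le> 1"
  shows "quantum_state (state V a \<eta> l)" "characteristic_function (state V a \<eta> l) (state_cf V \<eta> l)"
proof -
  define d where "d = plane_density (V - a) (V - 1 / (4 * a)) \<eta> l"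
  define M where "M = density lborel (\<lambda>z. ennreal (d z))"
  have [measurable]: "d \<in> borel_measurable borel" unfolding d_def by measurable
  have V: "0 < V - a" "0 < V - 1 / (4 * a)" using a by auto
  have d0: "0 \<le> d z" for z
    unfolding d_def plane_density_def split_beta
    by (intro mult_nonneg_nonneg modulated_nonneg V \<eta> gauss_nonneg)
  have "(\<integral>\<^sup>+z. ennreal (d z) \<partial>lborel) = 1"
    using plane_density_integrable[OF V] plane_density_integral[OF V] d0
    by (simp add: nn_integral_eq_integral d_def)
  then have "prob_space M"
    by (intro prob_spaceI) (simp add: M_def emeasure_density)
  moreover have "(\<lambda>(z, x). coherent a z x) \<in> borel_measurable (M \<Otimes>\<^sub>M borel)"
    using coherent_measurable by (simp add: M_def cong: measurable_cong_sets)
  moreover have "cmod (coherent a z x) \<le> sqrt (1 / sqrt (2 * pi * a))" for z x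
    using gauss_le[OF a(1), of "fst z" x] cmod_coherent[OF a(1), of z x] by (intro real_le_rsqrt) simp
  ultimately interpret pure_state_family M "coherent a" "sqrt (1 / sqrt (2 * pi * a))"
    by (simp add: pure_state_family_def pure_state_family_axioms_def coherent_L2 nsq_coherent a)
  have st: "state V a \<eta> l = mixture M (coherent a)" by (simp add: state_def M_def d_def)
  show "quantum_state (state V a \<eta> l)" unfolding st by (rule quantum_state_mixture)
  show "characteristic_function (state V a \<eta> l) (state_cf V \<eta> l)"
    unfolding st
  proof (rule characteristic_function_mixture)
    fix u v
    let ?c = "complex_of_real (exp (- a * u\<^sup>2 / 2 - v\<^sup>2 / (8 * a)))"
    have "(LINT z|M. L2_inner (coherent a z) (weyl u v (coherent a z)))
       = (LINT z|M. ?c * cis (u * fst z + v * snd z))"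
      using inner_weyl_coherent[OF a(1)] by (metis prod.collapse)
    also have "\<dots> = (LINT z|lborel. d z *\<^sub>R (?c * cis (u * fst z + v * snd z)))"
    proof -
      have [measurable]: "(\<lambda>z::real \<times> real. cis (u * fst z + v * snd z)) \<in> borel_measurable borel"
        unfolding borel_prod[symmetric] by measurable
      show ?thesis unfolding M_def by (rule integral_density) (use d0 in auto)
    qed
    also have "\<dots> = (LINT (q, p)|lborel. ?c * (cis (u * q + v * p) * of_real (d (q, p))))"
      by (simp only: case_prod_unfold prod.collapse fst_conv snd_conv scaleR_conv_of_real mult_ac)
    also have "\<dots> = ?c * (LINT (q, p)|lborel. cis (u * q + v * p) * of_real (d (q, p)))"
      by (simp add: case_prod_unfold)
    also have "\<dots> = of_real (exp (- a * u\<^sup>2 / 2 - v\<^sup>2 / (8 * a)) * exp (- ((V - a) * u\<^sup>2 + (V - 1 / (4 * a)) * v\<^sup>2) / 2))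
        * (1 + \<i> * of_real (\<eta> * sinh (l * u)))"
      unfolding d_def plane_density_cf[OF V] by simp
    also have "exp (- a * u\<^sup>2 / 2 - v\<^sup>2 / (8 * a)) * exp (- ((V - a) * u\<^sup>2 + (V - 1 / (4 * a)) * v\<^sup>2) / 2)
       = exp (- (V * u\<^sup>2 + V * v\<^sup>2) / 2)"
      unfolding exp_add[symmetric] using a(1) by (simp add: field_simps)
    finally show "(LINT z|M. L2_inner (coherent a z) (weyl u v (coherent a z))) = state_cf V \<eta> l (u, v)"
      by (simp add: state_cf_def)
  qed
qed

text \<open>The weight lowers the decay rate from \<open>V\<close> to
  \<open>A = V - 2 * \<beta>\<close>, and a Gaussian of rate \<open>A\<close> has variance
  \<open>1 / (2 * A)\<close>. Bounding the squared sinh by two exponentials and completing the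
  square gives Gaussians centred at \<open>m\<close> and \<open>- m\<close>, each with weight
  \<open>E\<close>. The case of \<beta> equal to 0 gives square integrability.\<close>

lemma state_cf_weighted:
  assumes \<beta>: "0 \<le> \<beta>" "2 * \<beta> < V"
  shows "(\<integral>\<^sup>+w. ennreal ((cmod (state_cf V \<eta> l w))\<^sup>2 * exp (2 * \<beta> * (norm w)\<^sup>2)) \<partial>lborel)
    \<le> ennreal (pi / (V - 2 * \<beta>) * (1 + \<eta>\<^sup>2 / 2 * exp (l\<^sup>2 / (V - 2 * \<beta>))))"
proof -
  define A \<sigma> m E where "A = V - 2 * \<beta>" and "\<sigma> = 1 / (2 * A)" and "m = l / A" and "E = exp (l\<^sup>2 / A)"
  have A: "0 < A" and \<sigma>: "0 < \<sigma>" using \<beta> by (auto simp: A_def \<sigma>_def)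
  have gauss_A: "gauss k \<sigma> x * sqrt (pi / A) = exp (- A * (x - k)\<^sup>2)" for k x
    using A by (simp add: gauss_def \<sigma>_def)
  define F where "F u = gauss 0 \<sigma> u + \<eta>\<^sup>2 / 4 * E * (gauss m \<sigma> u + gauss (- m) \<sigma> u)" for u
  have F0: "0 \<le> F u" for u unfolding F_def E_def using \<sigma> by (intro add_nonneg_nonneg mult_nonneg_nonneg) auto
  have F_int: "integrable lborel F" unfolding F_def[abs_def] using \<sigma> by simp
  have F_integral: "(LINT u|lborel. F u) = 1 + \<eta>\<^sup>2 / 2 * E"
    unfolding F_def using \<sigma> by simp
  have pointwise: "(cmod (state_cf V \<eta> l (u, v)))\<^sup>2 * exp (2 * \<beta> * (norm (u, v))\<^sup>2) \<le> pi / A * F u * gauss 0 \<sigma> v" for u v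
  proof -
    have "(cmod (state_cf V \<eta> l (u, v)))\<^sup>2 = (exp (- (V * u\<^sup>2 + V * v\<^sup>2) / 2))\<^sup>2 * (1 + (\<eta> * sinh (l * u))\<^sup>2)"
      unfolding state_cf_def by (simp add: norm_mult power_mult_distrib cmod_power2 del: of_real_mult)
    also have "(exp (- (V * u\<^sup>2 + V * v\<^sup>2) / 2))\<^sup>2 = exp (- (V * u\<^sup>2 + V * v\<^sup>2))"
      by (simp add: power2_eq_square exp_add[symmetric])
    also have "exp (- (V * u\<^sup>2 + V * v\<^sup>2)) * (1 + (\<eta> * sinh (l * u))\<^sup>2) * exp (2 * \<beta> * (norm (u, v))\<^sup>2)
       = exp (- A * v\<^sup>2) * (exp (- A * u\<^sup>2) * (1 + \<eta>\<^sup>2 * (sinh (l * u))\<^sup>2))"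
    proof -
      have "exp (- (V * u\<^sup>2 + V * v\<^sup>2)) * exp (2 * \<beta> * (norm (u, v))\<^sup>2) = exp (- A * v\<^sup>2) * exp (- A * u\<^sup>2)"
        unfolding exp_add[symmetric] A_def norm_Pair by (simp add: algebra_simps)
      then show ?thesis by (simp add: power_mult_distrib mult_ac)
    qed
    finally have "(cmod (state_cf V \<eta> l (u, v)))\<^sup>2 * exp (2 * \<beta> * (norm (u, v))\<^sup>2) = exp (- A * v\<^sup>2) * (exp (- A * u\<^sup>2) * (1 + \<eta>\<^sup>2 * (sinh (l * u))\<^sup>2))" .
    also have "\<dots> \<le> exp (- A * v\<^sup>2) * (sqrt (pi / A) * F u)"
    proof (intro mult_left_mono)
      have "(sinh (l * u))\<^sup>2 \<le> (exp (2 * l * u) + exp (- (2 * l * u))) / 4"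
      proof -
        have "(sinh (l * u))\<^sup>2 = ((exp (l * u))\<^sup>2 + (exp (- (l * u)))\<^sup>2 - 2 * (exp (l * u) * exp (- (l * u)))) / 4"
          unfolding sinh_def by (simp add: power2_eq_square field_simps)
        also have "\<dots> = (exp (2 * l * u) + exp (- (2 * l * u)) - 2) / 4"
          by (simp add: power2_eq_square exp_add[symmetric] mult.assoc)
        finally show ?thesis by simp
      qed
      then have "exp (- A * u\<^sup>2) * (1 + \<eta>\<^sup>2 * (sinh (l * u))\<^sup>2)
         \<le> exp (- A * u\<^sup>2) * (1 + \<eta>\<^sup>2 * ((exp (2 * l * u) + exp (- (2 * l * u))) / 4))"
        by (intro mult_left_mono add_left_mono) auto
      also have "\<dots> = exp (- A * u\<^sup>2) + \<eta>\<^sup>2 / 4 * (exp (- A * u\<^sup>2) * exp (2 * l * u) + exp (- A * u\<^sup>2) * exp (- (2 * l * u)))"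
        by (simp add: field_simps)
      also have "exp (- A * u\<^sup>2) * exp (2 * l * u) = E * exp (- A * (u - m)\<^sup>2)"
        unfolding E_def exp_add[symmetric] m_def using A by (simp add: power2_eq_square field_simps)
      also have "exp (- A * u\<^sup>2) * exp (- (2 * l * u)) = E * exp (- A * (u - (- m))\<^sup>2)"
        unfolding E_def exp_add[symmetric] m_def using A by (simp add: power2_eq_square field_simps)
      also have "exp (- A * u\<^sup>2) + \<eta>\<^sup>2 / 4 * (E * exp (- A * (u - m)\<^sup>2) + E * exp (- A * (u - (- m))\<^sup>2))
         = sqrt (pi / A) * F u"
        unfolding gauss_A[symmetric] F_def using gauss_A[of 0 u] by (simp add: algebra_simps)
      finally show "exp (- A * u\<^sup>2) * (1 + \<eta>\<^sup>2 * (sinh (l * u))\<^sup>2) \<le> sqrt (pi / A) * F u" .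
    qed simp
    also have "exp (- A * v\<^sup>2) = gauss 0 \<sigma> v * sqrt (pi / A)" using gauss_A[of 0 v] by simp
    also have "gauss 0 \<sigma> v * sqrt (pi / A) * (sqrt (pi / A) * F u) = (sqrt (pi / A) * sqrt (pi / A)) * F u * gauss 0 \<sigma> v"
      by (simp only: mult_ac)
    also have "sqrt (pi / A) * sqrt (pi / A) = pi / A" using A by simp
    finally show ?thesis .
  qed
  have "(\<integral>\<^sup>+w. ennreal ((cmod (state_cf V \<eta> l w))\<^sup>2 * exp (2 * \<beta> * (norm w)\<^sup>2)) \<partial>lborel)
     \<le> (\<integral>\<^sup>+(u, v). ennreal (pi / A * F u) * ennreal (gauss 0 \<sigma> v) \<partial>lborel)"
    using pointwise F0 A \<sigma> by (intro nn_integral_mono) (auto simp: ennreal_mult[symmetric] intro!: ennreal_leI)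
  also have "\<dots> = (\<integral>\<^sup>+u. ennreal (pi / A * F u) \<partial>lborel) * (\<integral>\<^sup>+v. ennreal (gauss 0 \<sigma> v) \<partial>lborel)"
    by (rule nn_integral_lborel_prod_mult) (use F_int in auto)
  also have "\<dots> = ennreal (pi / A * (1 + \<eta>\<^sup>2 / 2 * E))"
    using F_int F0 A \<sigma> by (simp add: nn_integral_eq_integral F_integral)
  finally show ?thesis unfolding A_def E_def .
qed

section \<open>Wigner functions and homodyne densities of the hypotheses\<close>

lemma plane_density_fourier:
  assumes V: "0 < V" and \<eta>: "\<bar>\<eta>\<bar> * exp (l\<^sup>2 / (2 * V)) \<le> 1"
  shows "fourier_transform (plane_density V V \<eta> l) (state_cf V \<eta> l)"
proof -
  let ?W = "plane_density V V \<eta> l" and ?C = "2 / sqrt (2 * pi * V) * (1 / sqrt (2 * pi * V))"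
  have W0: "0 \<le> ?W z" for z
    unfolding plane_density_def split_beta using V \<eta> by (intro mult_nonneg_nonneg modulated_nonneg) auto
  have WC: "?W z \<le> ?C" for z
    unfolding plane_density_def split_beta using V \<eta> by (intro mult_mono modulated_le gauss_le) auto
  have W_L2: "?W \<in> L2_fun"
  proof (rule L2_fun_bound)
    show "integrable lborel (\<lambda>z. ?C * ?W z)"
      by (intro integrable_mult_right plane_density_integrable V)
    show "(norm (?W z))\<^sup>2 \<le> ?C * ?W z" for z
      using W0[of z] WC[of z] by (simp only: real_norm_def abs_of_nonneg power2_eq_square mult_right_mono)
  qed measurable
  have cf_L2: "state_cf V \<eta> l \<in> L2_fun"
    using state_cf_weighted[of 0 V \<eta> l] V unfolding L2_fun_def L2_norm_sq_def
    by (auto intro: le_less_trans)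
  have "fourier_integral ?W = state_cf V \<eta> l"
    using plane_density_cf[OF V V] by (auto simp: fourier_integral_def state_cf_def)
  moreover have "L2_norm_sq (\<lambda>z. 0 :: 'b::real_normed_vector) = 0" by (simp add: L2_norm_sq_def)
  \<comment> \<open>The function is itself in L1 and L2, so the constant sequence serves as the
    approximation in the definition.\<close>
  ultimately show ?thesis
    unfolding fourier_transform_def using W_L2 cf_L2 plane_density_integrable[OF V V]
    by (intro conjI exI[of _ "\<lambda>k. ?W"]) (auto simp: L2_norm_sq_def)
qed

text \<open>The Radon transform of \<open>plane_density V V \<eta> l\<close>: the isotropic Gaussian
  has the same marginal in every direction, and the oscillation vector \<open>(l, 0)\<close> is
  projected to \<open>l * cos \<phi>\<close>.\<close>

definition homodyne :: "real \<Rightarrow> real \<Rightarrow> real \<Rightarrow> real \<Rightarrow> real \<Rightarrow> real" where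
  "homodyne V \<eta> l x \<phi> = modulated V \<eta> (l * cos \<phi>) x"

text \<open>The exponent decreases when the variance grows or the oscillation is projected. The
  condition imposed on the mixing density therefore also covers the Wigner function and the homodyne
  densities, with and without noise.\<close>

lemma homodyne_amplitude_le:
  fixes \<phi> :: real
  assumes V: "0 < V" "V' \<le> V" "0 < V'" and \<eta>: "\<bar>\<eta>\<bar> * exp (l\<^sup>2 / (2 * V')) \<le> 1"
  shows "\<bar>\<eta>\<bar> * exp ((l * cos \<phi>)\<^sup>2 / (2 * V)) \<le> 1"
proof -
  have "(l * cos \<phi>)\<^sup>2 \<le> l\<^sup>2"
    using abs_cos_le_one[of \<phi>] by (simp add: power_mult_distrib mult_left_le abs_square_le_1)
  then have "(l * cos \<phi>)\<^sup>2 / (2 * V) \<le> l\<^sup>2 / (2 * V')"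
    using V by (intro frac_le) auto
  then have "\<bar>\<eta>\<bar> * exp ((l * cos \<phi>)\<^sup>2 / (2 * V)) \<le> \<bar>\<eta>\<bar> * exp (l\<^sup>2 / (2 * V'))"
    by (intro mult_left_mono) auto
  with \<eta> show ?thesis by linarith
qed

theorem state_admissible:
  assumes a: "0 < a" "a < V" "1 / (4 * a) < V" and \<eta>: "\<bar>\<eta>\<bar> * exp (l\<^sup>2 / (2 * (V - a))) \<le> 1"
    and \<beta>: "0 \<le> \<beta>" "2 * \<beta> < V"
    and L: "pi / (V - 2 * \<beta>) * (1 + \<eta>\<^sup>2 / 2 * exp (l\<^sup>2 / (V - 2 * \<beta>))) \<le> (2 * pi)\<^sup>2 * L"
  shows "(state V a \<eta> l, plane_density V V \<eta> l, homodyne V \<eta> l) \<in> admissible_states \<beta> L"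
proof -
  have V: "0 < V" using a by linarith
  note amp = homodyne_amplitude_le[OF V _ _ \<eta>]
  have \<eta>V: "\<bar>\<eta>\<bar> * exp ((l * cos \<phi>)\<^sup>2 / (2 * V)) \<le> 1" for \<phi> using amp a by simp
  have ft: "fourier_transform (plane_density V V \<eta> l) (state_cf V \<eta> l)"
    using \<eta>V[of 0] by (intro plane_density_fourier V) simp
  note cf = state_quantum(2)[OF a \<eta>]
  have "continuous_on UNIV (plane_density V V \<eta> l)"
    unfolding plane_density_def split_beta using V by (auto intro!: continuous_intros)
  then have "wigner_function (state V a \<eta> l) (plane_density V V \<eta> l)"
    unfolding wigner_function_def using cf ft by blast
  moreover have "homodyne_density (state V a \<eta> l) (homodyne V \<eta> l)"
    unfolding homodyne_density_def
  proof (intro conjI ballI exI[of _ "state_cf V \<eta> l"] allI)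
    show "(\<lambda>(x, \<phi>). homodyne V \<eta> l x \<phi>) \<in> borel_measurable borel"
      unfolding homodyne_def split_beta borel_prod[symmetric] by measurable
    fix \<phi> t
    show "(LINT x|lborel. cis (t * x) * of_real (homodyne V \<eta> l x \<phi>)) = state_cf V \<eta> l (t * cos \<phi>, t * sin \<phi>)"
    proof -
      have "V * (t * cos \<phi>)\<^sup>2 + V * (t * sin \<phi>)\<^sup>2 = V * t\<^sup>2 * ((cos \<phi>)\<^sup>2 + (sin \<phi>)\<^sup>2)"
        by (simp add: algebra_simps power_mult_distrib del: sin_cos_squared_add sin_cos_squared_add2)
      then have "V * (t * cos \<phi>)\<^sup>2 + V * (t * sin \<phi>)\<^sup>2 = V * t\<^sup>2" by simp
      then show ?thesis unfolding homodyne_def modulated_cf[OF V] state_cf_def by (simp add: mult_ac)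
    qed
  qed (use V cf modulated_nonneg[OF V \<eta>V] in \<open>auto simp: homodyne_def\<close>)
  moreover have "plane_density V V \<eta> l \<in> smoothness_class \<beta> L"
    unfolding smoothness_class_def using ft order_trans[OF state_cf_weighted[OF \<beta>] ennreal_leI[OF L]] by blast
  ultimately show ?thesis
    unfolding admissible_states_def using state_quantum(1)[OF a \<eta>] by simp
qed

section \<open>Law of the observations and the two-point bound\<close>

lemma observed_density_measurable [measurable]:
  "(\<lambda>(z, \<phi>). ennreal (indicator {0..pi} \<phi> * homodyne V \<eta> l z \<phi> / pi)) \<in> borel_measurable borel"
  unfolding homodyne_def case_prod_unfold borel_prod[symmetric] by measurable

text \<open>Noise leaves the angle untouched, so for each angle it is a convolution in the first
  coordinate; \<open>modulated_convolution\<close> with \<tau> equal to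
  \<open>sqrt (2 * \<gamma>)\<close> adds \<open>2 * \<gamma>\<close> to the variance.\<close>

lemma observation_law_homodyne:
  assumes V: "0 < V" and \<gamma>: "0 \<le> \<gamma>"
    and amp: "\<And>\<phi>. \<bar>\<eta>\<bar> * exp ((l * cos \<phi>)\<^sup>2 / (2 * V)) \<le> 1"
  shows "observation_law \<gamma> (homodyne V \<eta> l) =
    density lborel (\<lambda>(z, \<phi>). ennreal (indicator {0..pi} \<phi> * homodyne (V + 2 * \<gamma>) \<eta> l z \<phi> / pi))"
proof (rule measure_eqI)
  fix A assume "A \<in> sets (observation_law \<gamma> (homodyne V \<eta> l))"
  then have A [measurable]: "A \<in> sets borel" by (simp add: observation_law_def)
  define s where "s = sqrt (2 * \<gamma>)"
  define f where "f = (\<lambda>w. ennreal (indicator {0..pi} (snd w) * homodyne V \<eta> l (fst w) (snd w) / pi))"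
  define g where "g \<xi> = ennreal (std_normal_density \<xi>)" for \<xi>
  define T where "T = (\<lambda>wx::(real \<times> real) \<times> real. (fst (fst wx) + s * snd wx, snd (fst wx)))"
  have A2 [measurable]: "A \<in> sets (borel \<Otimes>\<^sub>M borel)" unfolding borel_prod by (rule A)
  have f_prod: "f \<in> borel_measurable (borel \<Otimes>\<^sub>M borel)"
    unfolding f_def homodyne_def by measurable
  then have [measurable]: "f \<in> borel_measurable borel" unfolding borel_prod .
  note f_prod [measurable]
  have [measurable]: "g \<in> borel_measurable borel" unfolding g_def by measurable
  have T_prod [measurable]: "T \<in> (borel \<Otimes>\<^sub>M borel) \<Otimes>\<^sub>M borel \<rightarrow>\<^sub>M borel \<Otimes>\<^sub>M borel"
    unfolding T_def by measurable
  then have [measurable]: "T \<in> borel \<Otimes>\<^sub>M borel \<rightarrow>\<^sub>M borel"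
    unfolding borel_prod .
  have law: "observation_law \<gamma> (homodyne V \<eta> l) = distr (density lborel f \<Otimes>\<^sub>M density lborel g) borel T"
    unfolding observation_law_def f_def g_def T_def s_def by (simp add: case_prod_unfold)
  have inner: "(\<integral>\<^sup>+\<xi>. f (z - s * \<xi>, \<phi>) * g \<xi> \<partial>lborel) = ennreal (indicator {0..pi} \<phi> * homodyne (V + 2 * \<gamma>) \<eta> l z \<phi> / pi)" for z \<phi>
  proof -
    have "(\<integral>\<^sup>+\<xi>. f (z - s * \<xi>, \<phi>) * g \<xi> \<partial>lborel)
      = (\<integral>\<^sup>+\<xi>. ennreal (indicator {0..pi} \<phi> / pi * (modulated V \<eta> (l * cos \<phi>) (z - s * \<xi>) * std_normal_density \<xi>)) \<partial>lborel)"
      using modulated_nonneg[OF V amp]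
      by (intro nn_integral_cong) (simp add: f_def g_def homodyne_def mult_ac flip: ennreal_mult)
    also have "\<dots> = ennreal (LINT \<xi>|lborel. indicator {0..pi} \<phi> / pi * (modulated V \<eta> (l * cos \<phi>) (z - s * \<xi>) * std_normal_density \<xi>))"
      by (intro nn_integral_eq_integral integrable_mult_right modulated_convolution V)
         (simp add: modulated_nonneg[OF V amp])
    also have "(LINT \<xi>|lborel. indicator {0..pi} \<phi> / pi * (modulated V \<eta> (l * cos \<phi>) (z - s * \<xi>) * std_normal_density \<xi>))
      = indicator {0..pi} \<phi> / pi * modulated (V + s\<^sup>2) \<eta> (l * cos \<phi>) z"
      by (simp add: modulated_convolution[OF V])
    finally show ?thesis using \<gamma> by (simp add: homodyne_def s_def)
  qed
  have "emeasure (observation_law \<gamma> (homodyne V \<eta> l)) A = (\<integral>\<^sup>+w. indicator A w \<partial>observation_law \<gamma> (homodyne V \<eta> l))"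
    by (simp add: observation_law_def)
  also have "\<dots> = (\<integral>\<^sup>+wx. indicator A (T wx) \<partial>(density lborel f \<Otimes>\<^sub>M density lborel g))"
    unfolding law by (rule nn_integral_distr) auto
  also have "density lborel f \<Otimes>\<^sub>M density lborel g = density (lborel \<Otimes>\<^sub>M lborel) (\<lambda>(w, \<xi>). f w * g \<xi>)"
  proof -
    have "prob_space (density lborel g)" unfolding g_def by (rule prob_space_normal_density) simp
    then have "sigma_finite_measure (density lborel g)"
      by (rule prob_space_imp_sigma_finite)
    then show ?thesis by (intro pair_measure_density) (auto intro: sigma_finite_lborel)
  qed
  also have "(\<integral>\<^sup>+wx. indicator A (T wx) \<partial>density (lborel \<Otimes>\<^sub>M lborel) (\<lambda>(w, \<xi>). f w * g \<xi>))
     = (\<integral>\<^sup>+wx. f (fst wx) * g (snd wx) * indicator A (T wx) \<partial>(lborel \<Otimes>\<^sub>M lborel))"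
    by (subst nn_integral_density) (auto simp: case_prod_unfold)
  also have "\<dots> = (\<integral>\<^sup>+\<xi>. \<integral>\<^sup>+w. f w * g \<xi> * indicator A (T (w, \<xi>)) \<partial>lborel \<partial>lborel)"
    by (subst lborel_pair.nn_integral_snd[symmetric]) auto
  also have "\<dots> = (\<integral>\<^sup>+\<xi>. \<integral>\<^sup>+\<phi>. \<integral>\<^sup>+x. f (x, \<phi>) * g \<xi> * indicator A (x + s * \<xi>, \<phi>) \<partial>lborel \<partial>lborel \<partial>lborel)"
    unfolding lborel_prod[symmetric] T_def
    by (subst lborel_pair.nn_integral_snd[symmetric]) auto
  \<comment> \<open>With \<xi> and \<phi> fixed the change of variables is a translation of one real
    variable. The later exchange moves \<xi> innermost, where \<open>inner\<close> applies.\<close>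
  also have "\<dots> = (\<integral>\<^sup>+\<xi>. \<integral>\<^sup>+\<phi>. \<integral>\<^sup>+z. f (z - s * \<xi>, \<phi>) * g \<xi> * indicator A (z, \<phi>) \<partial>lborel \<partial>lborel \<partial>lborel)"
  proof (rule nn_integral_cong, rule nn_integral_cong)
    fix \<xi> \<phi> :: real
    show "(\<integral>\<^sup>+x. f (x, \<phi>) * g \<xi> * indicator A (x + s * \<xi>, \<phi>) \<partial>lborel) = (\<integral>\<^sup>+z. f (z - s * \<xi>, \<phi>) * g \<xi> * indicator A (z, \<phi>) \<partial>lborel)"
      using nn_integral_shift[of "\<lambda>x. f (x, \<phi>) * g \<xi> * indicator A (x + s * \<xi>, \<phi>)" "- (s * \<xi>)"] by simp
  qed
  also have "\<dots> = (\<integral>\<^sup>+\<xi>. \<integral>\<^sup>+w. f (fst w - s * \<xi>, snd w) * g \<xi> * indicator A w \<partial>lborel \<partial>lborel)"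
  proof (rule nn_integral_cong)
    fix \<xi> :: real
    have "(\<lambda>w. f (fst w - s * \<xi>, snd w) * g \<xi> * indicator A w) \<in> borel_measurable (lborel \<Otimes>\<^sub>M lborel)"
      by measurable
    from lborel_pair.nn_integral_snd[OF this]
    show "(\<integral>\<^sup>+\<phi>. \<integral>\<^sup>+z. f (z - s * \<xi>, \<phi>) * g \<xi> * indicator A (z, \<phi>) \<partial>lborel \<partial>lborel)
       = (\<integral>\<^sup>+w. f (fst w - s * \<xi>, snd w) * g \<xi> * indicator A w \<partial>lborel)"
      unfolding lborel_prod by simp
  qed
  also have "\<dots> = (\<integral>\<^sup>+w. \<integral>\<^sup>+\<xi>. f (fst w - s * \<xi>, snd w) * g \<xi> * indicator A w \<partial>lborel \<partial>lborel)"
  proof (rule lborel_pair.Fubini')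
    have "(\<lambda>wx. f (fst (fst wx) - s * snd wx, snd (fst wx)) * g (snd wx) * indicator A (fst wx)) \<in> borel_measurable ((borel \<Otimes>\<^sub>M borel) \<Otimes>\<^sub>M borel)"
      by measurable
    then have "(\<lambda>wx. f (fst (fst wx) - s * snd wx, snd (fst wx)) * g (snd wx) * indicator A (fst wx)) \<in> borel_measurable (borel \<Otimes>\<^sub>M borel)"
      unfolding borel_prod .
    then show "(\<lambda>(w, \<xi>). f (fst w - s * \<xi>, snd w) * g \<xi> * indicator A w) \<in> borel_measurable (lborel \<Otimes>\<^sub>M lborel)"
      by (simp add: case_prod_unfold cong: measurable_cong_sets)
  qed
  also have "\<dots> = (\<integral>\<^sup>+w. (\<integral>\<^sup>+\<xi>. f (fst w - s * \<xi>, snd w) * g \<xi> \<partial>lborel) * indicator A w \<partial>lborel)"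
  proof (intro nn_integral_cong nn_integral_multc)
    fix w :: "real \<times> real"
    show "(\<lambda>\<xi>. f (fst w - s * \<xi>, snd w) * g \<xi>) \<in> borel_measurable lborel" by measurable
  qed
  also have "\<dots> = emeasure (density lborel (\<lambda>(z, \<phi>). ennreal (indicator {0..pi} \<phi> * homodyne (V + 2 * \<gamma>) \<eta> l z \<phi> / pi))) A"
    unfolding inner
    using observed_density_measurable[of "V + 2 * \<gamma>" \<eta> l] by (subst emeasure_density) (auto simp: case_prod_unfold)
  finally show "emeasure (observation_law \<gamma> (homodyne V \<eta> l)) A
    = emeasure (density lborel (\<lambda>(z, \<phi>). ennreal (indicator {0..pi} \<phi> * homodyne (V + 2 * \<gamma>) \<eta> l z \<phi> / pi))) A" .
qed (simp add: observation_law_def)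

section \<open>Change of measure and Le Cam's two-point bound\<close>

lemma PiM_density:
  fixes h :: "'a \<Rightarrow> real"
  assumes M: "prob_space M" and [measurable]: "h \<in> borel_measurable M" and h0: "\<And>x. 0 \<le> h x"
    and h1: "(\<integral>\<^sup>+x. ennreal (h x) \<partial>M) = 1"
  shows "PiM {..<n::nat} (\<lambda>_. density M (\<lambda>x. ennreal (h x)))
    = density (PiM {..<n} (\<lambda>_. M)) (\<lambda>s. ennreal (\<Prod>i<n. h (s i)))"
proof -
  interpret M: prob_space M by (rule M)
  interpret D: prob_space "density M (\<lambda>x. ennreal (h x))"
    using h1 by (intro prob_spaceI) (simp add: emeasure_density cong: nn_integral_cong)
  interpret P: product_sigma_finite "\<lambda>_::nat. density M (\<lambda>x. ennreal (h x))" by unfold_locales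
  interpret Q: product_sigma_finite "\<lambda>_::nat. M" by unfold_locales
  show ?thesis
  proof (rule P.PiM_eqI[symmetric])
    show "sets (density (PiM {..<n} (\<lambda>_. M)) (\<lambda>s. ennreal (\<Prod>i<n. h (s i)))) = sets (PiM {..<n} (\<lambda>_. density M (\<lambda>x. ennreal (h x))))"
      unfolding sets_density by (rule sets_PiM_cong) simp_all
    fix A assume "\<And>i. i \<in> {..<n} \<Longrightarrow> A i \<in> sets (density M (\<lambda>x. ennreal (h x)))"
    then have A: "A i \<in> sets M" if "i < n" for i using that by simp
    have "emeasure (density (PiM {..<n} (\<lambda>_. M)) (\<lambda>s. ennreal (\<Prod>i<n. h (s i)))) (Pi\<^sub>E {..<n} A)
      = (\<integral>\<^sup>+s. ennreal (\<Prod>i<n. h (s i)) * indicator (Pi\<^sub>E {..<n} A) s \<partial>PiM {..<n} (\<lambda>_. M))"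
      using A by (subst emeasure_density) (auto intro!: sets_PiM_I_finite)
    also have "\<dots> = (\<integral>\<^sup>+s. (\<Prod>i<n. ennreal (h (s i)) * indicator (A i) (s i)) \<partial>PiM {..<n} (\<lambda>_. M))"
    proof (rule nn_integral_cong)
      fix s assume "s \<in> space (PiM {..<n} (\<lambda>_. M))"
      then have "s \<in> Pi\<^sub>E {..<n} A \<longleftrightarrow> (\<forall>i<n. s i \<in> A i)" by (auto simp: space_PiM PiE_iff)
      then have "(indicator (Pi\<^sub>E {..<n} A) s :: ennreal) = (\<Prod>i<n. indicator (A i) (s i))"
        by (auto simp: indicator_def)
      then show "ennreal (\<Prod>i<n. h (s i)) * indicator (Pi\<^sub>E {..<n} A) s = (\<Prod>i<n. ennreal (h (s i)) * indicator (A i) (s i))"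
        by (simp add: prod.distrib prod_ennreal h0)
    qed
    also have "\<dots> = (\<Prod>i<n. \<integral>\<^sup>+x. ennreal (h x) * indicator (A i) x \<partial>M)"
      using A by (intro Q.product_nn_integral_prod) auto
    also have "\<dots> = (\<Prod>i<n. emeasure (density M (\<lambda>x. ennreal (h x))) (A i))"
      using A by (intro prod.cong refl) (simp add: emeasure_density)
    finally show "emeasure (density (PiM {..<n} (\<lambda>_. M)) (\<lambda>s. ennreal (\<Prod>i<n. h (s i)))) (Pi\<^sub>E {..<n} A)
      = (\<Prod>i<n. emeasure (density M (\<lambda>x. ennreal (h x))) (A i))" .
  qed simp
qed

text \<open>With \<Lambda> the likelihood ratio of the sample, both losses are integrated under the
  first law, where their sum dominates \<Delta> times \<open>min 1 (\<Lambda> s)\<close>. The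
  minimum has mean at least 1/4, because the mean of \<Lambda> is 1 and its second moment is at most
  3/2.\<close>

theorem two_point_bound:
  fixes h :: "'a \<Rightarrow> real" and \<Delta> \<delta> :: real
  assumes M: "prob_space M" and h [measurable]: "h \<in> borel_measurable M" and h0: "\<And>x. 0 \<le> h x"
    and h1: "(\<integral>\<^sup>+x. ennreal (h x) \<partial>M) = 1"
    and h2: "(\<integral>\<^sup>+x. ennreal ((h x)\<^sup>2) \<partial>M) \<le> ennreal (1 + \<delta>)" and \<delta>: "0 \<le> \<delta>" "(1 + \<delta>) ^ n \<le> 3 / 2"
    and d [measurable]: "d0 \<in> borel_measurable (PiM {..<n::nat} (\<lambda>_. M))" "d1 \<in> borel_measurable (PiM {..<n} (\<lambda>_. M))"
    and \<Delta>: "0 \<le> \<Delta>" "\<And>s. s \<in> space (PiM {..<n} (\<lambda>_. M)) \<Longrightarrow> ennreal \<Delta> \<le> d0 s + d1 s"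
  shows "ennreal (\<Delta> / 4) \<le> (\<integral>\<^sup>+s. d0 s \<partial>PiM {..<n} (\<lambda>_. M)) + (\<integral>\<^sup>+s. d1 s \<partial>PiM {..<n} (\<lambda>_. density M (\<lambda>x. ennreal (h x))))"
proof -
  interpret M: prob_space M by (rule M)
  interpret Q: product_sigma_finite "\<lambda>_::nat. M" by unfold_locales
  let ?P = "PiM {..<n} (\<lambda>_. M)"
  define \<Lambda> where "\<Lambda> s = (\<Prod>i<n. h (s i))" for s
  have [measurable]: "\<Lambda> \<in> borel_measurable ?P" unfolding \<Lambda>_def by measurable
  have \<Lambda>0: "0 \<le> \<Lambda> s" for s unfolding \<Lambda>_def by (intro prod_nonneg) (simp add: h0)
  have \<Lambda>1: "(\<integral>\<^sup>+s. ennreal (\<Lambda> s) \<partial>?P) = 1"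
    unfolding \<Lambda>_def prod_ennreal[OF h0, symmetric]
    by (subst Q.product_nn_integral_prod) (auto simp: h1)
  have "(\<integral>\<^sup>+s. ennreal ((\<Lambda> s)\<^sup>2) \<partial>?P) = (\<integral>\<^sup>+s. (\<Prod>i<n. ennreal ((h (s i))\<^sup>2)) \<partial>?P)"
    unfolding \<Lambda>_def prod_power_distrib by (simp add: prod_ennreal)
  also have "\<dots> = (\<integral>\<^sup>+x. ennreal ((h x)\<^sup>2) \<partial>M) ^ n"
    by (subst Q.product_nn_integral_prod) auto
  also have "\<dots> \<le> ennreal (1 + \<delta>) ^ n"
    by (intro power_mono h2) simp
  also have "\<dots> \<le> ennreal (3 / 2)"
    using \<delta> ennreal_power[of "1 + \<delta>" n] ennreal_leI[OF \<delta>(2)] by simp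
  finally have \<Lambda>2: "(\<integral>\<^sup>+s. ennreal ((\<Lambda> s)\<^sup>2) \<partial>?P) \<le> ennreal (3 / 2)" .
  define m where "m s = min 1 (\<Lambda> s)" for s
  have [measurable]: "m \<in> borel_measurable ?P" unfolding m_def by measurable
  have m0: "0 \<le> m s" for s unfolding m_def using \<Lambda>0 by simp
  \<comment> \<open>For ratios above 1 this is the arithmetic-geometric mean inequality. Integrated,
    it gives 1 on the left and at most the mass of the minimum plus 3/4 on the right.\<close>
  have m_le: "\<Lambda> s \<le> m s + (\<Lambda> s)\<^sup>2 / 2" for s
  proof (cases "\<Lambda> s \<le> 1")
    case False
    have "0 \<le> (\<Lambda> s - 1)\<^sup>2" by simp
    then have "2 * \<Lambda> s \<le> (\<Lambda> s)\<^sup>2 + 1" unfolding power2_diff by simp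
    then show ?thesis using False by (simp add: m_def)
  qed (simp add: m_def)
  have "1 \<le> (\<integral>\<^sup>+s. ennreal (m s) + ennreal (1 / 2) * ennreal ((\<Lambda> s)\<^sup>2) \<partial>?P)"
    unfolding \<Lambda>1[symmetric]
  proof (rule nn_integral_mono)
    fix s
    have "ennreal (\<Lambda> s) \<le> ennreal (m s + 1 / 2 * (\<Lambda> s)\<^sup>2)"
      using m_le[of s] by (intro ennreal_leI) simp
    then show "ennreal (\<Lambda> s) \<le> ennreal (m s) + ennreal (1 / 2) * ennreal ((\<Lambda> s)\<^sup>2)"
      using ennreal_plus[of "m s" "1 / 2 * (\<Lambda> s)\<^sup>2"] ennreal_mult[of "1 / 2" "(\<Lambda> s)\<^sup>2"] m0[of s] by simp
  qed
  also have "\<dots> = (\<integral>\<^sup>+s. ennreal (m s) \<partial>?P) + ennreal (1 / 2) * (\<integral>\<^sup>+s. ennreal ((\<Lambda> s)\<^sup>2) \<partial>?P)"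
    by (subst nn_integral_add) (auto simp: nn_integral_cmult)
  also have "\<dots> \<le> (\<integral>\<^sup>+s. ennreal (m s) \<partial>?P) + ennreal (1 / 2) * ennreal (3 / 2)"
    by (intro add_left_mono mult_left_mono \<Lambda>2) simp
  finally have "ennreal 1 \<le> (\<integral>\<^sup>+s. ennreal (m s) \<partial>?P) + ennreal (3 / 4)"
    by (subst (asm) ennreal_mult[symmetric]) auto
  then have m_int: "ennreal (1 / 4) \<le> (\<integral>\<^sup>+s. ennreal (m s) \<partial>?P)"
    by (cases "\<integral>\<^sup>+s. ennreal (m s) \<partial>?P") (auto simp: ennreal_le_iff simp flip: ennreal_plus)
  have "ennreal (\<Delta> / 4) = ennreal \<Delta> * ennreal (1 / 4)" using \<Delta>(1) by (simp flip: ennreal_mult)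
  also have "\<dots> \<le> ennreal \<Delta> * (\<integral>\<^sup>+s. ennreal (m s) \<partial>?P)" by (intro mult_left_mono m_int) simp
  also have "\<dots> = (\<integral>\<^sup>+s. ennreal \<Delta> * ennreal (m s) \<partial>?P)" by (rule nn_integral_cmult[symmetric]) measurable
  also have "\<dots> \<le> (\<integral>\<^sup>+s. d0 s + ennreal (\<Lambda> s) * d1 s \<partial>?P)"
  proof (rule nn_integral_mono)
    fix s assume "s \<in> space ?P"
    then have "ennreal \<Delta> * ennreal (m s) \<le> (d0 s + d1 s) * ennreal (m s)" by (intro mult_right_mono \<Delta>) auto
    also have "\<dots> = d0 s * ennreal (m s) + ennreal (m s) * d1 s" by (simp only: distrib_right mult.commute[of "ennreal (m s)" "d1 s"])
    also have "\<dots> \<le> d0 s * 1 + ennreal (\<Lambda> s) * d1 s"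
      by (intro add_mono mult_left_mono mult_right_mono) (auto simp: m_def intro!: ennreal_leI ennreal_le_1[THEN iffD2])
    finally show "ennreal \<Delta> * ennreal (m s) \<le> d0 s + ennreal (\<Lambda> s) * d1 s" by simp
  qed
  also have "\<dots> = (\<integral>\<^sup>+s. d0 s \<partial>?P) + (\<integral>\<^sup>+s. ennreal (\<Lambda> s) * d1 s \<partial>?P)"
    by (rule nn_integral_add) measurable
  also have "(\<integral>\<^sup>+s. ennreal (\<Lambda> s) * d1 s \<partial>?P) = (\<integral>\<^sup>+s. d1 s \<partial>PiM {..<n} (\<lambda>_. density M (\<lambda>x. ennreal (h x))))"
    unfolding PiM_density[OF M h h0 h1] \<Lambda>_def[symmetric] by (rule nn_integral_density[symmetric]) measurable
  finally show ?thesis .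
qed

lemma max_risk_ge:
  fixes R :: "'p \<Rightarrow> ennreal"
  assumes "x \<in> S" "y \<in> S" "0 \<le> \<Delta>" "ennreal (\<Delta> / 4) \<le> R x + R y"
  shows "ennreal (\<Delta> / 8) \<le> (SUP p\<in>S. R p)"
proof -
  define X where "X = (SUP p\<in>S. R p)"
  have "R x \<le> X" "R y \<le> X" unfolding X_def using assms by (auto intro: SUP_upper)
  with assms(4) have "ennreal (\<Delta> / 4) \<le> X + X"
    by (meson add_mono order_trans)
  then have "ennreal (\<Delta> / 8) \<le> X"
    using assms(3) by (cases X) (auto simp: ennreal_le_iff simp flip: ennreal_plus)
  then show ?thesis unfolding X_def .
qed

section \<open>Chi-square distance of the two hypotheses\<close>

text \<open>Here \<open>V\<close> is the variance after the noise has been added. The case of \<eta>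
  equal to 0 is the dominating measure for all likelihood ratios.\<close>

definition observed :: "real \<Rightarrow> real \<Rightarrow> real \<Rightarrow> (real \<times> real) measure" where
  "observed V \<eta> l = density lborel (\<lambda>(z, \<phi>). ennreal (indicator {0..pi} \<phi> * homodyne V \<eta> l z \<phi> / pi))"

definition likelihood_ratio :: "real \<Rightarrow> real \<Rightarrow> real \<Rightarrow> real \<times> real \<Rightarrow> real" where
  "likelihood_ratio V \<eta> l = (\<lambda>(z, \<phi>). 1 + \<eta> * exp ((l * cos \<phi>)\<^sup>2 / (2 * V)) * sin (l * cos \<phi> * z / V))"

lemma sets_observed [simp, measurable_cong]: "sets (observed V \<eta> l) = sets borel"
  by (simp add: observed_def)

lemma homodyne_0: "homodyne V 0 l z \<phi> = gauss 0 V z"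
  by (simp add: homodyne_def modulated_def)

lemma homodyne_likelihood_ratio: "homodyne V \<eta> l z \<phi> = homodyne V 0 l z \<phi> * likelihood_ratio V \<eta> l (z, \<phi>)"
  by (simp add: homodyne_def modulated_def likelihood_ratio_def)

lemma likelihood_ratio_measurable [measurable]: "likelihood_ratio V \<eta> l \<in> borel_measurable borel"
  unfolding likelihood_ratio_def case_prod_unfold borel_prod[symmetric] by measurable

lemma likelihood_ratio_nonneg:
  assumes "\<And>\<phi>. \<bar>\<eta>\<bar> * exp ((l * cos \<phi>)\<^sup>2 / (2 * V)) \<le> 1"
  shows "0 \<le> likelihood_ratio V \<eta> l w"
  using oscillation_le_1[OF assms[of "snd w"], of "l * cos (snd w) * fst w / V"]
  unfolding likelihood_ratio_def case_prod_unfold by linarith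

lemma nn_integral_observed_0:
  assumes V: "0 < V" and k: "k \<in> borel_measurable borel" "\<And>w. 0 \<le> k w"
  shows "(\<integral>\<^sup>+w. ennreal (k w) \<partial>observed V 0 l)
    = (\<integral>\<^sup>+\<phi>. ennreal (indicator {0..pi} \<phi> / pi) * (\<integral>\<^sup>+z. ennreal (gauss 0 V z * k (z, \<phi>)) \<partial>lborel) \<partial>lborel)"
proof -
  have [measurable]: "k \<in> borel_measurable (borel \<Otimes>\<^sub>M borel)" using k(1) by (simp add: borel_prod)
  define F where "F w = ennreal (indicator {0..pi} (snd w) / pi) * ennreal (gauss 0 V (fst w) * k w)" for w
  have F_meas: "F \<in> borel_measurable (lborel \<Otimes>\<^sub>M lborel)" unfolding F_def by measurable
  have "(\<integral>\<^sup>+w. ennreal (k w) \<partial>observed V 0 l)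
      = (\<integral>\<^sup>+w. ennreal (indicator {0..pi} (snd w) * homodyne V 0 l (fst w) (snd w) / pi) * ennreal (k w) \<partial>lborel)"
    unfolding observed_def using observed_density_measurable[of V 0 l] k(1)
    by (subst nn_integral_density) (auto simp: case_prod_unfold)
  also have "\<dots> = (\<integral>\<^sup>+w. F w \<partial>lborel)"
    using V k(2) unfolding F_def homodyne_0
    by (intro nn_integral_cong) (simp add: mult_ac flip: ennreal_mult)
  also have "\<dots> = (\<integral>\<^sup>+\<phi>. \<integral>\<^sup>+z. F (z, \<phi>) \<partial>lborel \<partial>lborel)"
    using lborel_pair.nn_integral_snd[OF F_meas] by (simp add: lborel_prod)
  also have "\<dots> = (\<integral>\<^sup>+\<phi>. ennreal (indicator {0..pi} \<phi> / pi) * (\<integral>\<^sup>+z. ennreal (gauss 0 V z * k (z, \<phi>)) \<partial>lborel) \<partial>lborel)"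
    unfolding F_def by (intro nn_integral_cong) (simp add: nn_integral_cmult)
  finally show ?thesis .
qed

lemma nn_integral_angle: "(\<integral>\<^sup>+\<phi>. ennreal (indicator {0..pi} \<phi> / pi) \<partial>lborel) = 1"
proof -
  have "(\<integral>\<^sup>+\<phi>. ennreal (indicator {0..pi} \<phi> / pi) \<partial>lborel) = (\<integral>\<^sup>+\<phi>. ennreal (1 / pi) * indicator {0..pi} \<phi> \<partial>lborel)"
    by (intro nn_integral_cong) (auto simp: indicator_def)
  also have "\<dots> = ennreal (1 / pi) * ennreal pi"
    by (simp add: nn_integral_cmult_indicator)
  also have "\<dots> = 1" by (subst ennreal_mult[symmetric]) auto
  finally show ?thesis .
qed

lemma nn_integral_likelihood_ratio:
  assumes V: "0 < V" and amp: "\<And>\<phi>. \<bar>\<eta>\<bar> * exp ((l * cos \<phi>)\<^sup>2 / (2 * V)) \<le> 1"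
  shows "(\<integral>\<^sup>+w. ennreal (likelihood_ratio V \<eta> l w) \<partial>observed V 0 l) = 1"
proof -
  have "(\<integral>\<^sup>+z. ennreal (gauss 0 V z * likelihood_ratio V \<eta> l (z, \<phi>)) \<partial>lborel) = 1" for \<phi>
  proof -
    have "(\<integral>\<^sup>+z. ennreal (gauss 0 V z * likelihood_ratio V \<eta> l (z, \<phi>)) \<partial>lborel) = (\<integral>\<^sup>+z. ennreal (modulated V \<eta> (l * cos \<phi>) z) \<partial>lborel)"
      by (simp add: likelihood_ratio_def modulated_def)
    also have "\<dots> = 1"
      using V modulated_nonneg[OF V amp] by (subst nn_integral_eq_integral) auto
    finally show ?thesis .
  qed
  then show ?thesis
    using V by (subst nn_integral_observed_0) (auto simp: likelihood_ratio_nonneg[OF amp] nn_integral_angle)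
qed

lemma prob_space_observed_0:
  assumes V: "0 < V"
  shows "prob_space (observed V 0 l)"
proof (rule prob_spaceI)
  have "(\<integral>\<^sup>+w. ennreal (likelihood_ratio V 0 l w) \<partial>observed V 0 l) = 1"
    by (rule nn_integral_likelihood_ratio[OF V]) simp
  then show "emeasure (observed V 0 l) (space (observed V 0 l)) = 1"
    by (simp add: likelihood_ratio_def case_prod_unfold)
qed

lemma observed_eq_density:
  assumes V: "0 < V" and amp: "\<And>\<phi>. \<bar>\<eta>\<bar> * exp ((l * cos \<phi>)\<^sup>2 / (2 * V)) \<le> 1"
  shows "observed V \<eta> l = density (observed V 0 l) (\<lambda>w. ennreal (likelihood_ratio V \<eta> l w))"
proof -
  have "density (observed V 0 l) (\<lambda>w. ennreal (likelihood_ratio V \<eta> l w))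
    = density lborel (\<lambda>w. (case w of (z, \<phi>) \<Rightarrow> ennreal (indicator {0..pi} \<phi> * homodyne V 0 l z \<phi> / pi)) * ennreal (likelihood_ratio V \<eta> l w))"
    unfolding observed_def
    by (rule density_density_eq) (use observed_density_measurable[of V 0 l] in auto)
  also have "(\<lambda>w. (case w of (z, \<phi>) \<Rightarrow> ennreal (indicator {0..pi} \<phi> * homodyne V 0 l z \<phi> / pi)) * ennreal (likelihood_ratio V \<eta> l w))
    = (\<lambda>(z, \<phi>). ennreal (indicator {0..pi} \<phi> * homodyne V \<eta> l z \<phi> / pi))"
    using V likelihood_ratio_nonneg[OF amp] unfolding homodyne_likelihood_ratio[of V \<eta>] homodyne_0
    by (auto simp: fun_eq_iff mult_ac simp flip: ennreal_mult)
  finally show ?thesis by (simp add: observed_def)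
qed

text \<open>At a fixed angle the term linear in the sine integrates to 0 against the centred
  Gaussian, and the squared sine is bounded by 1. What remains is an average over the angle, which
  \<delta> bounds.\<close>

lemma nn_integral_likelihood_ratio_sq:
  assumes V: "0 < V" and amp: "\<And>\<phi>. \<bar>\<eta>\<bar> * exp ((l * cos \<phi>)\<^sup>2 / (2 * V)) \<le> 1" and \<delta>0: "0 \<le> \<delta>"
    and \<delta>: "(\<integral>\<^sup>+\<phi>. ennreal (indicator {0..pi} \<phi> / pi) * ennreal (\<eta>\<^sup>2 * exp ((l * cos \<phi>)\<^sup>2 / V)) \<partial>lborel) \<le> ennreal \<delta>"
  shows "(\<integral>\<^sup>+w. ennreal ((likelihood_ratio V \<eta> l w)\<^sup>2) \<partial>observed V 0 l) \<le> ennreal (1 + \<delta>)"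
proof -
  define d where "d \<phi> = \<eta>\<^sup>2 * exp ((l * cos \<phi>)\<^sup>2 / V)" for \<phi>
  have [measurable]: "d \<in> borel_measurable borel" unfolding d_def by measurable
  have d0: "0 \<le> d \<phi>" for \<phi> by (simp add: d_def)
  have inner: "(\<integral>\<^sup>+z. ennreal (gauss 0 V z * (likelihood_ratio V \<eta> l (z, \<phi>))\<^sup>2) \<partial>lborel) \<le> ennreal (1 + d \<phi>)" for \<phi>
  proof -
    define c k where "c = \<eta> * exp ((l * cos \<phi>)\<^sup>2 / (2 * V))" and "k = l * cos \<phi> / V"
    have c2: "c\<^sup>2 = d \<phi>"
      unfolding c_def d_def power_mult_distrib by (simp add: power2_eq_square exp_add[symmetric])
    have int: "integrable lborel (\<lambda>z. sin (k * z) * gauss 0 V z)"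
      using V by (auto intro!: Bochner_Integration.integrable_bound[OF gauss_integrable[OF V, of 0]] AE_I2 mult_left_le_one_le simp: abs_mult)
    have "gauss 0 V z * (likelihood_ratio V \<eta> l (z, \<phi>))\<^sup>2 \<le> (1 + c\<^sup>2) * gauss 0 V z + 2 * c * (sin (k * z) * gauss 0 V z)" for z
    proof -
      have "likelihood_ratio V \<eta> l (z, \<phi>) = 1 + c * sin (k * z)" by (simp add: likelihood_ratio_def c_def k_def)
      moreover have "(1 + c * sin (k * z))\<^sup>2 \<le> 1 + c\<^sup>2 + 2 * c * sin (k * z)"
      proof -
        have "c\<^sup>2 * (sin (k * z))\<^sup>2 \<le> c\<^sup>2 * 1" by (intro mult_left_mono) (auto simp: abs_square_le_1)
        then show ?thesis by (simp add: power2_sum power_mult_distrib)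
      qed
      ultimately have "gauss 0 V z * (likelihood_ratio V \<eta> l (z, \<phi>))\<^sup>2 \<le> gauss 0 V z * (1 + c\<^sup>2 + 2 * c * sin (k * z))"
        using V by (simp add: mult_left_mono)
      then show ?thesis by (simp add: algebra_simps)
    qed
    then have "(\<integral>\<^sup>+z. ennreal (gauss 0 V z * (likelihood_ratio V \<eta> l (z, \<phi>))\<^sup>2) \<partial>lborel)
      \<le> (\<integral>\<^sup>+z. ennreal ((1 + c\<^sup>2) * gauss 0 V z + 2 * c * (sin (k * z) * gauss 0 V z)) \<partial>lborel)"
      by (intro nn_integral_mono ennreal_leI)
    also have "\<dots> = ennreal (LINT z|lborel. (1 + c\<^sup>2) * gauss 0 V z + 2 * c * (sin (k * z) * gauss 0 V z))"
    proof (rule nn_integral_eq_integral)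
      show "AE z in lborel. 0 \<le> (1 + c\<^sup>2) * gauss 0 V z + 2 * c * (sin (k * z) * gauss 0 V z)"
        using V \<open>\<And>z. gauss 0 V z * (likelihood_ratio V \<eta> l (z, \<phi>))\<^sup>2 \<le> _ z\<close>
        by (intro AE_I2) (meson gauss_nonneg mult_nonneg_nonneg order_trans zero_le_power2)
    qed (use int V in auto)
    also have "(LINT z|lborel. (1 + c\<^sup>2) * gauss 0 V z + 2 * c * (sin (k * z) * gauss 0 V z)) = 1 + c\<^sup>2"
      using int V by (simp add: gauss_sin)
    finally show ?thesis by (simp add: c2)
  qed
  have "(\<integral>\<^sup>+w. ennreal ((likelihood_ratio V \<eta> l w)\<^sup>2) \<partial>observed V 0 l)
     \<le> (\<integral>\<^sup>+\<phi>. ennreal (indicator {0..pi} \<phi> / pi) * ennreal (1 + d \<phi>) \<partial>lborel)"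
    by (subst nn_integral_observed_0[OF V]) (auto intro!: nn_integral_mono mult_left_mono inner)
  also have "\<dots> = (\<integral>\<^sup>+\<phi>. ennreal (indicator {0..pi} \<phi> / pi) + ennreal (indicator {0..pi} \<phi> / pi) * ennreal (d \<phi>) \<partial>lborel)"
    using d0 by (intro nn_integral_cong) (simp add: distrib_left)
  also have "\<dots> = 1 + (\<integral>\<^sup>+\<phi>. ennreal (indicator {0..pi} \<phi> / pi) * ennreal (d \<phi>) \<partial>lborel)"
    by (subst nn_integral_add) (auto simp: nn_integral_angle)
  also have "\<dots> \<le> 1 + ennreal \<delta>" using \<delta> unfolding d_def by (intro add_left_mono)
  also have "\<dots> = ennreal (1 + \<delta>)" using \<delta>0 by simp
  finally show ?thesis .
qed

section \<open>Concentration of the angular average\<close>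

lemma sin_ge_quarter:
  fixes x :: real
  assumes "0 \<le> x" "x \<le> pi / 2"
  shows "x / 4 \<le> sin x"
\<comment> \<open>Up to pi / 3 the derivative of the sine is at least 1/2; beyond, the sine is at
  least 1/2 while x / 4 is below it. The slope affects only constants.\<close>
proof (cases "x \<le> pi / 3")
  case True
  have "sin 0 - 0 / 2 \<le> sin x - x / 2"
  proof (rule DERIV_nonneg_imp_nondecreasing[OF assms(1)])
    fix t assume t: "0 \<le> t" "t \<le> x"
    have "cos (pi / 3) \<le> cos t" using t True by (intro cos_monotone_0_pi_le) auto
    then have "0 \<le> cos t - 1 / 2" by (simp add: cos_60)
    moreover have "((\<lambda>x. sin x - x / 2) has_real_derivative cos t - 1 / 2) (at t)"
      by (auto intro!: derivative_eq_intros)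
    ultimately show "\<exists>y. ((\<lambda>x. sin x - x / 2) has_real_derivative y) (at t) \<and> 0 \<le> y" by blast
  qed
  then show ?thesis using assms by simp
next
  case False
  have "sin (pi / 6) \<le> sin x" using False assms pi_gt_zero by (intro sin_monotone_2pi_le) auto
  then have "1 / 2 \<le> sin x" by (simp add: sin_30)
  moreover have "x / 4 \<le> 1 / 2" using assms pi_less_4 by simp
  ultimately show ?thesis by simp
qed

text \<open>Laplace's method: the mass sits near 0 and pi, and each end is dominated by a Gaussian
  of width of order \<open>1 / sqrt b\<close>. Applied with \<open>b\<close> of order
  \<open>R^2\<close>, this yields the factor \<open>1 / R\<close> in the chi-square bound.\<close>

lemma nn_integral_exp_sin_sq_le:
  assumes b: "0 < b"
  shows "(\<integral>\<^sup>+\<phi>. ennreal (indicator {0..pi} \<phi> * exp (- b * (sin \<phi>)\<^sup>2)) \<partial>lborel) \<le> ennreal (8 * sqrt (pi / b))"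
proof -
  \<comment> \<open>This variance turns the lower bound x / 4 for the sine into the exponent of
    \<open>gauss\<close>: \<open>x^2 / (2 * V)\<close> equals \<open>b * (x / 4)^2\<close>.\<close>
  define V where "V = 8 / b"
  have V: "0 < V" using b by (simp add: V_def)
  define C where "C = sqrt (2 * pi * V)"
  have C: "0 \<le> C" using V by (simp add: C_def)
  have g: "C * gauss m V x = exp (- b * ((x - m) / 4)\<^sup>2)" for m x
    using b V unfolding gauss_def C_def by (simp add: V_def power2_eq_square)
  have le: "indicator {0..pi} \<phi> * exp (- b * (sin \<phi>)\<^sup>2) \<le> C * gauss 0 V \<phi> + C * gauss pi V \<phi>" for \<phi>
  proof (cases "\<phi> \<in> {0..pi}")
    case True
    show ?thesis
    proof (cases "\<phi> \<le> pi / 2")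
      case True
      with \<open>\<phi> \<in> {0..pi}\<close> have "((\<phi> - 0) / 4)\<^sup>2 \<le> (sin \<phi>)\<^sup>2"
        using sin_ge_quarter[of \<phi>] by (intro power_mono) auto
      then have "exp (- b * (sin \<phi>)\<^sup>2) \<le> exp (- b * ((\<phi> - 0) / 4)\<^sup>2)" using b by simp
      then show ?thesis using \<open>\<phi> \<in> {0..pi}\<close> unfolding g by (simp add: add_increasing2)
    next
      case False
      with \<open>\<phi> \<in> {0..pi}\<close> have "((pi - \<phi>) / 4)\<^sup>2 \<le> (sin (pi - \<phi>))\<^sup>2"
        using sin_ge_quarter[of "pi - \<phi>"] by (intro power_mono) auto
      then have "((\<phi> - pi) / 4)\<^sup>2 \<le> (sin \<phi>)\<^sup>2" by (simp add: power_divide power2_commute)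
      then have "exp (- b * (sin \<phi>)\<^sup>2) \<le> exp (- b * ((\<phi> - pi) / 4)\<^sup>2)" using b by simp
      then show ?thesis using \<open>\<phi> \<in> {0..pi}\<close> unfolding g by (simp add: add_increasing)
    qed
  next
    case False
    then show ?thesis unfolding g by (simp add: add_nonneg_nonneg)
  qed
  have "(\<integral>\<^sup>+\<phi>. ennreal (indicator {0..pi} \<phi> * exp (- b * (sin \<phi>)\<^sup>2)) \<partial>lborel)
     \<le> (\<integral>\<^sup>+\<phi>. ennreal (C * gauss 0 V \<phi> + C * gauss pi V \<phi>) \<partial>lborel)"
    by (intro nn_integral_mono ennreal_leI le)
  also have "\<dots> = ennreal (LINT \<phi>|lborel. C * gauss 0 V \<phi> + C * gauss pi V \<phi>)"
    using V C by (intro nn_integral_eq_integral) auto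
  also have "(LINT \<phi>|lborel. C * gauss 0 V \<phi> + C * gauss pi V \<phi>) = 2 * C"
    using V by simp
  also have "2 * C = 8 * sqrt (pi / b)"
  proof -
    have "C = sqrt (16 * (pi / b))" by (simp add: C_def V_def mult_ac)
    also have "\<dots> = 4 * sqrt (pi / b)" by (subst real_sqrt_mult) simp
    finally show ?thesis by simp
  qed
  finally show ?thesis .
qed

section \<open>From the two-point bound to the minimax risks\<close>

abbreviation sup_risk where
  "sup_risk \<gamma> n What \<equiv> \<lambda>(\<rho> :: operator, W, p). \<integral>\<^sup>+s. sup_norm (\<lambda>z. What s z - W z) \<partial>sample_law \<gamma> p n"

abbreviation L2_risk where
  "L2_risk \<gamma> n What \<equiv> \<lambda>(\<rho> :: operator, W, p). \<integral>\<^sup>+s. L2_norm_sq (\<lambda>z. What s z - W z) \<partial>sample_law \<gamma> p n"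

text \<open>\<open>two_point_bound\<close> needs measurable losses, so the sup-norm loss is replaced
  by its lower bound at a single point z, where the two hypotheses can be compared exactly. The L2
  loss is measurable by Tonelli.\<close>

lemma risk_lower_bounds:
  assumes V: "0 < V" and \<gamma>: "0 \<le> \<gamma>"
    and amp: "\<And>\<phi> V'. V \<le> V' \<Longrightarrow> \<bar>\<eta>\<bar> * exp ((l * cos \<phi>)\<^sup>2 / (2 * V')) \<le> 1"
    and adm: "(\<rho>0, plane_density V V 0 l, homodyne V 0 l) \<in> admissible_states \<beta> L"
      "(\<rho>1, plane_density V V \<eta> l, homodyne V \<eta> l) \<in> admissible_states \<beta> L"
    and \<delta>: "0 \<le> \<delta>" "(1 + \<delta>) ^ n \<le> 3 / 2"
      "(\<integral>\<^sup>+\<phi>. ennreal (indicator {0..pi} \<phi> / pi) * ennreal (\<eta>\<^sup>2 * exp ((l * cos \<phi>)\<^sup>2 / (V + 2 * \<gamma>))) \<partial>lborel) \<le> ennreal \<delta>"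
    and What: "What \<in> estimators n"
  shows "ennreal (\<bar>plane_density V V \<eta> l z - plane_density V V 0 l z\<bar> / 8)
      \<le> (SUP t\<in>admissible_states \<beta> L. sup_risk \<gamma> n What t)"
    and "0 \<le> D \<Longrightarrow> ennreal D \<le> L2_norm_sq (\<lambda>z. plane_density V V \<eta> l z - plane_density V V 0 l z) \<Longrightarrow>
      ennreal (D / 16)
      \<le> (SUP t\<in>admissible_states \<beta> L. L2_risk \<gamma> n What t)"
proof -
  let ?W0 = "plane_density V V 0 l" and ?W1 = "plane_density V V \<eta> l"
  define S where "S = V + 2 * \<gamma>"
  have S: "0 < S" "V \<le> S" using V \<gamma> by (auto simp: S_def)
  have ampS: "\<And>\<phi>. \<bar>\<eta>\<bar> * exp ((l * cos \<phi>)\<^sup>2 / (2 * S)) \<le> 1" by (rule amp[OF S(2)])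
  define O0 where "O0 = observed S 0 l"
  define h where "h = likelihood_ratio S \<eta> l"
  have O0: "prob_space O0" unfolding O0_def by (rule prob_space_observed_0[OF S(1)])
  have sets_O0 [measurable_cong, simp]: "sets O0 = sets borel" by (simp add: O0_def)
  have law0: "sample_law \<gamma> (homodyne V 0 l) n = PiM {..<n} (\<lambda>_. O0)"
    using observation_law_homodyne[OF V \<gamma>, of 0 l] by (simp add: sample_law_def O0_def S_def observed_def)
  have law1: "sample_law \<gamma> (homodyne V \<eta> l) n = PiM {..<n} (\<lambda>_. density O0 (\<lambda>w. ennreal (h w)))"
    using observation_law_homodyne[OF V \<gamma> amp] observed_eq_density[OF S(1) ampS]
    by (simp add: sample_law_def O0_def h_def S_def observed_def)
  have bound: "ennreal (\<Delta> / 4) \<le> (\<integral>\<^sup>+s. d0 s \<partial>sample_law \<gamma> (homodyne V 0 l) n) + (\<integral>\<^sup>+s. d1 s \<partial>sample_law \<gamma> (homodyne V \<eta> l) n)"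
    if "d0 \<in> borel_measurable (PiM {..<n} (\<lambda>_. O0))" "d1 \<in> borel_measurable (PiM {..<n} (\<lambda>_. O0))"
      "0 \<le> \<Delta>" "\<And>s. s \<in> space (PiM {..<n} (\<lambda>_. O0)) \<Longrightarrow> ennreal \<Delta> \<le> d0 s + d1 s" for d0 d1 and \<Delta> :: real
    unfolding law0 law1
  proof (rule two_point_bound[OF O0 _ _ _ _ \<delta>(1,2) that])
    show "h \<in> borel_measurable O0" unfolding h_def by measurable
    show "0 \<le> h w" for w unfolding h_def by (rule likelihood_ratio_nonneg[OF ampS])
    show "(\<integral>\<^sup>+w. ennreal (h w) \<partial>O0) = 1" unfolding h_def O0_def by (rule nn_integral_likelihood_ratio[OF S(1) ampS])
    show "(\<integral>\<^sup>+w. ennreal ((h w)\<^sup>2) \<partial>O0) \<le> ennreal (1 + \<delta>)"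
      unfolding h_def O0_def using \<delta> by (intro nn_integral_likelihood_ratio_sq[OF S(1) ampS]) (auto simp: S_def)
  qed
  have sets_P: "sets (PiM {..<n} (\<lambda>_. O0)) = sets (PiM {..<n} (\<lambda>_. borel :: (real \<times> real) measure))"
    by (rule sets_PiM_cong) auto
  have What_meas: "(\<lambda>(s, z). What s z) \<in> borel_measurable (PiM {..<n} (\<lambda>_. O0) \<Otimes>\<^sub>M borel)"
    using What unfolding estimators_def
    by (subst measurable_cong_sets[OF sets_pair_measure_cong[OF sets_P refl] refl]) simp
  note this [measurable]
  let ?A = "admissible_states \<beta> L"
  show "ennreal (\<bar>?W1 z - ?W0 z\<bar> / 8)
      \<le> (SUP t\<in>?A. sup_risk \<gamma> n What t)"
  proof (rule max_risk_ge[OF adm])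
    have sup: "ennreal \<bar>What s z - W z\<bar> \<le> sup_norm (\<lambda>z. What s z - W z)" for s W
      unfolding sup_norm_def by (rule SUP_upper) simp
    have "(\<lambda>s. What s z) \<in> borel_measurable (PiM {..<n} (\<lambda>_. O0))" by measurable
    then have "ennreal (\<bar>?W1 z - ?W0 z\<bar> / 4)
      \<le> (\<integral>\<^sup>+s. ennreal \<bar>What s z - ?W0 z\<bar> \<partial>sample_law \<gamma> (homodyne V 0 l) n)
        + (\<integral>\<^sup>+s. ennreal \<bar>What s z - ?W1 z\<bar> \<partial>sample_law \<gamma> (homodyne V \<eta> l) n)"
      by (intro bound) (auto intro!: ennreal_leI simp flip: ennreal_plus)
    also have "\<dots> \<le> (\<integral>\<^sup>+s. sup_norm (\<lambda>z. What s z - ?W0 z) \<partial>sample_law \<gamma> (homodyne V 0 l) n)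
        + (\<integral>\<^sup>+s. sup_norm (\<lambda>z. What s z - ?W1 z) \<partial>sample_law \<gamma> (homodyne V \<eta> l) n)"
      by (intro add_mono nn_integral_mono sup)
    finally show "ennreal (\<bar>?W1 z - ?W0 z\<bar> / 4)
      \<le> sup_risk \<gamma> n What (\<rho>0, ?W0, homodyne V 0 l)
        + sup_risk \<gamma> n What (\<rho>1, ?W1, homodyne V \<eta> l)"
      by simp
  qed simp
  assume D: "0 \<le> D" "ennreal D \<le> L2_norm_sq (\<lambda>z. ?W1 z - ?W0 z)"
  \<comment> \<open>A squared norm satisfies the triangle inequality only up to a factor 2, so the
    two losses add up to at least \<open>D / 2\<close>.\<close>
  have "ennreal (D / 2 / 8) \<le> (SUP t\<in>?A. L2_risk \<gamma> n What t)"
  proof (rule max_risk_ge[OF adm])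
    have meas: "(\<lambda>s. L2_norm_sq (\<lambda>z. What s z - plane_density V V \<eta>' l z)) \<in> borel_measurable (PiM {..<n} (\<lambda>_. O0))" for \<eta>'
      unfolding L2_norm_sq_def by measurable
    have slice: "(\<lambda>z. What s z) \<in> borel_measurable borel" if "s \<in> space (PiM {..<n} (\<lambda>_. O0))" for s
      using measurable_Pair2[OF What_meas that] by simp
    show "ennreal (D / 2 / 4)
      \<le> L2_risk \<gamma> n What (\<rho>0, ?W0, homodyne V 0 l)
        + L2_risk \<gamma> n What (\<rho>1, ?W1, homodyne V \<eta> l)"
      unfolding prod.case
    proof (rule bound[OF meas meas])
      show "0 \<le> D / 2" using D by simp
      fix s assume s: "s \<in> space (PiM {..<n} (\<lambda>_. O0))"
      note slice[OF s, measurable]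
      have "ennreal D \<le> L2_norm_sq (\<lambda>z. ?W1 z - ?W0 z)" by (fact D)
      also have "\<dots> \<le> (\<integral>\<^sup>+z. 2 * ennreal ((norm (What s z - ?W0 z))\<^sup>2) + 2 * ennreal ((norm (What s z - ?W1 z))\<^sup>2) \<partial>lborel)"
        unfolding L2_norm_sq_def
      proof (rule nn_integral_mono)
        fix z
        have "(norm (?W1 z - ?W0 z))\<^sup>2 \<le> 2 * (norm (What s z - ?W0 z))\<^sup>2 + 2 * (norm (What s z - ?W1 z))\<^sup>2"
          using norm_add_sq_le[of "What s z - ?W0 z" "?W1 z - What s z"] by (simp add: norm_minus_commute power2_commute)
        then have "ennreal ((norm (?W1 z - ?W0 z))\<^sup>2) \<le> ennreal (2 * (norm (What s z - ?W0 z))\<^sup>2 + 2 * (norm (What s z - ?W1 z))\<^sup>2)"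
          by (rule ennreal_leI)
        then show "ennreal ((norm (?W1 z - ?W0 z))\<^sup>2) \<le> 2 * ennreal ((norm (What s z - ?W0 z))\<^sup>2) + 2 * ennreal ((norm (What s z - ?W1 z))\<^sup>2)"
          by (simp add: ennreal_mult)
      qed
      also have "\<dots> = 2 * L2_norm_sq (\<lambda>z. What s z - ?W0 z) + 2 * L2_norm_sq (\<lambda>z. What s z - ?W1 z)"
        unfolding L2_norm_sq_def by (subst nn_integral_add) (auto simp: nn_integral_cmult)
      finally have "ennreal (1 / 2) * ennreal D \<le> ennreal (1 / 2) * (2 * (L2_norm_sq (\<lambda>z. What s z - ?W0 z) + L2_norm_sq (\<lambda>z. What s z - ?W1 z)))"
        by (intro mult_left_mono) (simp_all add: distrib_left)
      moreover have "ennreal (1 / 2) * (2 * x) = x" for x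
      proof -
        have "ennreal (1 / 2) * 2 = 1"
          by (subst ennreal_numeral[symmetric], subst ennreal_mult[symmetric]) auto
        then show ?thesis by (simp only: mult.assoc[symmetric] mult_1)
      qed
      moreover have "ennreal (D / 2) = ennreal (1 / 2) * ennreal D"
        using D(1) by (subst ennreal_mult[symmetric]) auto
      ultimately show "ennreal (D / 2) \<le> L2_norm_sq (\<lambda>z. What s z - ?W0 z) + L2_norm_sq (\<lambda>z. What s z - ?W1 z)"
        by (simp only:)
    qed
  qed (use D in simp)
  then show "ennreal (D / 16) \<le> (SUP t\<in>?A. L2_risk \<gamma> n What t)"
    by simp
qed

section \<open>Choice of the parameters\<close>

text \<open>The quotient occurs in exponents, so it is needed up to a bounded error, which costs
  only a constant after exponentiation. The geometric expansion starts with
  \<open>R^2 + a * R\<close>, and the rest is at most \<open>2 * a^2\<close>.\<close>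

lemma cube_div_diff_le:
  fixes R a :: real
  assumes "0 \<le> a" "2 * a \<le> R" "0 < R"
  shows "R ^ 3 / (R - a) \<le> R\<^sup>2 + a * R + 2 * a\<^sup>2"
proof -
  have "(R\<^sup>2 + a * R + 2 * a\<^sup>2) * (R - a) = R ^ 3 + a\<^sup>2 * (R - 2 * a)"
    by (simp add: power2_eq_square power3_eq_cube algebra_simps)
  moreover have "0 \<le> a\<^sup>2 * (R - 2 * a)" using assms by simp
  ultimately show ?thesis using assms by (simp add: pos_divide_le_eq)
qed

text \<open>The first bound is exact up to a constant and produces the noise factor
  \<open>exp (- 2 * \<gamma> * R)\<close>. The second only sets the speed of decay in the angle,
  where a factor 2 is harmless.\<close>

lemma cube_div_add_bounds:
  fixes R b :: real
  assumes "0 \<le> b" "b \<le> R" "0 < R"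
  shows "R ^ 3 / (R + b) \<le> R\<^sup>2 - b * R + b\<^sup>2" "R\<^sup>2 / 2 \<le> R ^ 3 / (R + b)"
proof -
  have "(R\<^sup>2 - b * R + b\<^sup>2) * (R + b) = R ^ 3 + b ^ 3"
    by (simp add: power2_eq_square power3_eq_cube algebra_simps)
  then show "R ^ 3 / (R + b) \<le> R\<^sup>2 - b * R + b\<^sup>2"
    using assms by (simp add: pos_divide_le_eq)
  have "R\<^sup>2 / 2 * (R + b) \<le> R\<^sup>2 / 2 * (R + R)" using assms by (intro mult_left_mono) auto
  then show "R\<^sup>2 / 2 \<le> R ^ 3 / (R + b)"
    using assms by (simp add: pos_le_divide_eq power2_eq_square power3_eq_cube)
qed

text \<open>The threshold 1/3 is chosen because exp(-1/3) is at least 2/3, which bounds exp(1/3) by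
  3/2.\<close>

lemma one_plus_power_le:
  fixes \<delta> :: real
  assumes "0 \<le> \<delta>" "real n * \<delta> \<le> 1 / 3"
  shows "(1 + \<delta>) ^ n \<le> 3 / 2"
proof -
  have "(1 + \<delta>) ^ n \<le> exp \<delta> ^ n" using assms by (intro power_mono exp_ge_add_one_self) auto
  also have "\<dots> = exp (real n * \<delta>)" by (simp add: exp_of_nat_mult)
  also have "\<dots> \<le> exp (1 / 3)" using assms by simp
  also have "\<dots> \<le> 3 / 2"
    using exp_ge_add_one_self[of "- (1 / 3) :: real"] by (simp add: exp_minus field_simps)
  finally show ?thesis .
qed

text \<open>Of the conditions on \<kappa>, the first puts the perturbed function into the smoothness
  class and the second keeps the chi-square distance of the sample bounded. The last condition on
  \<open>R\<close> makes the mixing density nonnegative, and the equation for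
  \<open>ln (real n)\<close> balances perturbation and sample size.\<close>

lemma risk_lower_bounds_at_radius:
  fixes \<beta> \<gamma> L \<kappa> r R :: real
  assumes \<gamma>: "0 \<le> \<gamma>" and \<beta>: "0 < \<beta>" and L: "0 < L"
    and \<kappa>: "0 < \<kappa>" "\<kappa>\<^sup>2 * exp (8 * \<beta>\<^sup>2) \<le> L" "\<kappa>\<^sup>2 * exp (4 * \<gamma>\<^sup>2) \<le> 1 / 24"
    and r: "0 < r" "r\<^sup>2 = R"
    and R: "2 \<le> R" "4 * \<beta> \<le> R" "2 * \<gamma> \<le> R" "1 / (2 * \<beta>) < R" "2 / L \<le> R"
      "2 * \<kappa> * exp (\<beta>\<^sup>2 / 4) \<le> (3 / 4 * \<beta>)\<^sup>2 * R"
    and n: "0 < n" "2 * (\<beta> + \<gamma>) * R = ln (real n)"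
    and What: "What \<in> estimators n"
  shows "ennreal (\<kappa> * exp (- \<beta> * R) / (32 * pi * r))
      \<le> (SUP t\<in>admissible_states \<beta> L. sup_risk \<gamma> n What t)"
    and "ennreal (\<kappa>\<^sup>2 * exp (- 2 * \<beta> * R) / (256 * pi))
      \<le> (SUP t\<in>admissible_states \<beta> L. L2_risk \<gamma> n What t)"
proof -
  \<comment> \<open>With this \<open>l\<close> the frequency \<open>l / R\<close> equals
    \<open>r\<close> and the squared \<open>l\<close> is the cube of \<open>R\<close>; the factor in
    \<eta> cancels the normalisation of \<open>modulated\<close>, so that \<epsilon> is the actual
    relative amplitude.\<close>
  define a l \<epsilon> \<eta> where "a = \<beta> / 2" and "l = r * R" and "\<epsilon> = \<kappa> * r * exp (- \<beta> * R)" and "\<eta> = \<epsilon> * exp (- (R\<^sup>2 / 2))"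
  have R0: "0 < R" using R by linarith
  have a: "0 < a" "2 * a \<le> R" "1 / (4 * a) < R" "a < R" "0 < R - a" using \<beta> R by (auto simp: a_def)
  have \<epsilon>0: "0 < \<epsilon>" using \<kappa> r by (simp add: \<epsilon>_def)
  then have \<eta>0: "0 < \<eta>" by (simp add: \<eta>_def)
  have l2: "l\<^sup>2 = R ^ 3" using r by (simp add: l_def power_mult_distrib power2_eq_square power3_eq_cube)
  have \<epsilon>2: "\<epsilon>\<^sup>2 = \<kappa>\<^sup>2 * R * exp (- 2 * \<beta> * R)"
    using r by (simp add: \<epsilon>_def power_mult_distrib exp_double[symmetric])
  have \<eta>2: "\<eta>\<^sup>2 = \<epsilon>\<^sup>2 * exp (- R\<^sup>2)"
    by (simp add: \<eta>_def power_mult_distrib exp_double[symmetric])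
  have amp_a: "\<bar>\<eta>\<bar> * exp (l\<^sup>2 / (2 * (R - a))) \<le> 1"
  proof -
    \<comment> \<open>The decay that is left after deconvolution: \<beta> from \<epsilon>, minus
      \<open>a / 2\<close>, which is a quarter of \<beta>.\<close>
    define c where "c = 3 / 4 * \<beta>"
    have c: "0 < c" using \<beta> by (simp add: c_def)
    have "l\<^sup>2 / (2 * (R - a)) \<le> (R\<^sup>2 + a * R + 2 * a\<^sup>2) / 2"
    proof -
      have "l\<^sup>2 / (2 * (R - a)) = R ^ 3 / (R - a) / 2"
        unfolding l2 by (simp only: divide_divide_eq_left mult.commute)
      also have "\<dots> \<le> (R\<^sup>2 + a * R + 2 * a\<^sup>2) / 2"
        by (intro divide_right_mono cube_div_diff_le) (use a R0 in auto)
      finally show ?thesis .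
    qed
    then have "\<bar>\<eta>\<bar> * exp (l\<^sup>2 / (2 * (R - a))) \<le> \<eta> * exp ((R\<^sup>2 + a * R + 2 * a\<^sup>2) / 2)"
      using \<eta>0 by (intro mult_mono) auto
    also have "\<dots> = \<kappa> * r * (exp (- \<beta> * R) * (exp (- (R\<^sup>2 / 2)) * exp ((R\<^sup>2 + a * R + 2 * a\<^sup>2) / 2)))"
      by (simp add: \<eta>_def \<epsilon>_def)
    also have "exp (- \<beta> * R) * (exp (- (R\<^sup>2 / 2)) * exp ((R\<^sup>2 + a * R + 2 * a\<^sup>2) / 2)) = exp (\<beta>\<^sup>2 / 4) / exp (c * R)"
      unfolding exp_add[symmetric] exp_diff[symmetric] by (simp add: a_def c_def power2_eq_square field_simps)
    also have "\<kappa> * r * (exp (\<beta>\<^sup>2 / 4) / exp (c * R)) \<le> \<kappa> * R * exp (\<beta>\<^sup>2 / 4) / exp (c * R)"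
    proof -
      have "1 \<le> r" by (rule power2_le_imp_le) (use r R in auto)
      then have "r * 1 \<le> r * r" using r by (intro mult_left_mono) auto
      then have "r \<le> R" using r(2) by (simp add: power2_eq_square)
      then show ?thesis using \<kappa> by (simp add: divide_right_mono mult_left_mono mult_right_mono)
    qed
    also have "\<dots> \<le> 1"
    proof -
      \<comment> \<open>The quadratic Taylor term of \<open>exp (c * R)\<close> already absorbs the
        linear factor \<open>R\<close>; the last hypothesis on \<open>R\<close> is exactly this
        comparison.\<close>
      have "\<kappa> * R * exp (\<beta>\<^sup>2 / 4) = (2 * \<kappa> * exp (\<beta>\<^sup>2 / 4)) * R / 2" by simp
      also have "\<dots> \<le> (c\<^sup>2 * R) * R / 2" using R(6) R0 by (intro divide_right_mono mult_right_mono) (auto simp: c_def)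
      also have "\<dots> \<le> 1 + c * R + (c * R)\<^sup>2 / 2" using c R0 by (simp add: power2_eq_square mult_ac)
      also have "\<dots> \<le> exp (c * R)" using c R0 by (intro exp_lower_Taylor_quadratic) auto
      finally show ?thesis by simp
    qed
    finally show ?thesis .
  qed
  have amp: "\<bar>\<eta>\<bar> * exp ((l * cos \<phi>)\<^sup>2 / (2 * V')) \<le> 1" if "R \<le> V'" for \<phi> V'
    using homodyne_amplitude_le[of V' "R - a" \<eta> l \<phi>] amp_a a R0 that by simp
  \<comment> \<open>Stated for any smaller amplitude, so that it serves both hypotheses. The growth
    \<open>exp (2 * \<beta> * R)\<close> cancels against the squared \<epsilon>, and the remaining
    factor \<open>R\<close> against the prefactor \<open>pi / (R - 2 * \<beta>)\<close>.\<close>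
  have smooth: "pi / (R - 2 * \<beta>) * (1 + \<eta>'\<^sup>2 / 2 * exp (l\<^sup>2 / (R - 2 * \<beta>))) \<le> (2 * pi)\<^sup>2 * L" if "\<eta>'\<^sup>2 \<le> \<eta>\<^sup>2" for \<eta>'
  proof -
    have "l\<^sup>2 / (R - 2 * \<beta>) \<le> R\<^sup>2 + 2 * \<beta> * R + 2 * (2 * \<beta>)\<^sup>2"
      using cube_div_diff_le[of "2 * \<beta>" R] \<beta> R R0 by (simp add: l2)
    then have "\<eta>'\<^sup>2 * exp (l\<^sup>2 / (R - 2 * \<beta>)) \<le> \<eta>\<^sup>2 * exp (R\<^sup>2 + 2 * \<beta> * R + 2 * (2 * \<beta>)\<^sup>2)"
      using that by (intro mult_mono) auto
    also have "\<dots> = \<kappa>\<^sup>2 * R * (exp (- 2 * \<beta> * R) * (exp (- R\<^sup>2) * exp (R\<^sup>2 + 2 * \<beta> * R + 2 * (2 * \<beta>)\<^sup>2)))"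
      by (simp add: \<eta>2 \<epsilon>2)
    also have "exp (- 2 * \<beta> * R) * (exp (- R\<^sup>2) * exp (R\<^sup>2 + 2 * \<beta> * R + 2 * (2 * \<beta>)\<^sup>2)) = exp (8 * \<beta>\<^sup>2)"
      unfolding exp_add[symmetric] by (simp add: power_mult_distrib)
    also have "\<kappa>\<^sup>2 * R * exp (8 * \<beta>\<^sup>2) \<le> L * R" using \<kappa>(2) R0 by (simp add: mult.commute[of _ R] mult_left_mono)
    finally have "1 + \<eta>'\<^sup>2 / 2 * exp (l\<^sup>2 / (R - 2 * \<beta>)) \<le> L * R / 2 + L * R / 2"
      using R(5) L by (intro add_mono) (auto simp: field_simps)
    then have "pi / (R - 2 * \<beta>) * (1 + \<eta>'\<^sup>2 / 2 * exp (l\<^sup>2 / (R - 2 * \<beta>))) \<le> pi / (R / 2) * (L * R)"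
      using R \<beta> R0 L by (intro mult_mono frac_le) (auto intro!: add_nonneg_nonneg)
    also have "\<dots> = 2 * pi * L" using R0 by simp
    also have "\<dots> \<le> (2 * pi) * (2 * pi) * L"
      using L pi_ge_two by (intro mult_right_mono) (auto intro: order_trans[OF _ mult_left_mono[of 1 "2 * pi" "2 * pi"]])
    finally show ?thesis by (simp add: power2_eq_square)
  qed
  have adm0: "(state R a 0 l, plane_density R R 0 l, homodyne R 0 l) \<in> admissible_states \<beta> L"
    by (rule state_admissible) (use a \<beta> R smooth[of 0] in auto)
  have adm1: "(state R a \<eta> l, plane_density R R \<eta> l, homodyne R \<eta> l) \<in> admissible_states \<beta> L"
    by (rule state_admissible) (use a \<beta> R smooth[of \<eta>] amp_a in auto)
  \<comment> \<open>By the second condition on \<kappa> this is at most 8/24 divided by n, as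
    \<open>one_plus_power_le\<close> requires.\<close>
  define \<delta> where "\<delta> = 8 * (\<kappa>\<^sup>2 * exp (4 * \<gamma>\<^sup>2)) / real n"
  have \<delta>0: "0 \<le> \<delta>" by (simp add: \<delta>_def)
  have \<delta>n: "(1 + \<delta>) ^ n \<le> 3 / 2"
    using \<kappa>(3) n(1) by (intro one_plus_power_le \<delta>0) (simp add: \<delta>_def)
  have \<delta>_chi: "(\<integral>\<^sup>+\<phi>. ennreal (indicator {0..pi} \<phi> / pi) * ennreal (\<eta>\<^sup>2 * exp ((l * cos \<phi>)\<^sup>2 / (R + 2 * \<gamma>))) \<partial>lborel) \<le> ennreal \<delta>"
  proof -
    \<comment> \<open>The factor \<open>R\<close> stems from the \<open>r\<close> in \<epsilon> and
      is removed by the angular integral; \<open>1 / real n\<close> is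
      \<open>exp (- 2 * (\<beta> + \<gamma>) * R)\<close>.\<close>
    define K where "K = \<kappa>\<^sup>2 * exp (4 * \<gamma>\<^sup>2) * R / real n"
    have K0: "0 \<le> K" using R0 by (simp add: K_def)
    have pointwise: "\<eta>\<^sup>2 * exp ((l * cos \<phi>)\<^sup>2 / (R + 2 * \<gamma>)) \<le> K * exp (- (R\<^sup>2 / 2) * (sin \<phi>)\<^sup>2)" for \<phi>
    proof -
      have "(l * cos \<phi>)\<^sup>2 / (R + 2 * \<gamma>) = R ^ 3 / (R + 2 * \<gamma>) - R ^ 3 / (R + 2 * \<gamma>) * (sin \<phi>)\<^sup>2"
        by (simp add: power_mult_distrib l2 cos_squared_eq diff_divide_distrib right_diff_distrib)
      also have "\<dots> \<le> (R\<^sup>2 - 2 * \<gamma> * R + (2 * \<gamma>)\<^sup>2) - R\<^sup>2 / 2 * (sin \<phi>)\<^sup>2"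
        using cube_div_add_bounds[of "2 * \<gamma>" R] \<gamma> R R0 by (intro diff_mono mult_right_mono) auto
      finally have "\<eta>\<^sup>2 * exp ((l * cos \<phi>)\<^sup>2 / (R + 2 * \<gamma>)) \<le> \<eta>\<^sup>2 * exp ((R\<^sup>2 - 2 * \<gamma> * R + (2 * \<gamma>)\<^sup>2) - R\<^sup>2 / 2 * (sin \<phi>)\<^sup>2)"
        by (intro mult_left_mono) auto
      also have "\<dots> = \<kappa>\<^sup>2 * R * (exp (- 2 * \<beta> * R) * (exp (- R\<^sup>2) * exp ((R\<^sup>2 - 2 * \<gamma> * R + (2 * \<gamma>)\<^sup>2) - R\<^sup>2 / 2 * (sin \<phi>)\<^sup>2)))"
        by (simp add: \<eta>2 \<epsilon>2)
      also have "exp (- 2 * \<beta> * R) * (exp (- R\<^sup>2) * exp ((R\<^sup>2 - 2 * \<gamma> * R + (2 * \<gamma>)\<^sup>2) - R\<^sup>2 / 2 * (sin \<phi>)\<^sup>2))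
        = exp (4 * \<gamma>\<^sup>2) * exp (- (2 * (\<beta> + \<gamma>) * R)) * exp (- (R\<^sup>2 / 2) * (sin \<phi>)\<^sup>2)"
        unfolding exp_add[symmetric] by (simp add: algebra_simps power_mult_distrib)
      also have "exp (- (2 * (\<beta> + \<gamma>) * R)) = 1 / real n"
        unfolding n(2) using n(1) by (simp add: exp_minus inverse_eq_divide)
      finally show ?thesis by (simp add: K_def mult_ac)
    qed
    have "(\<integral>\<^sup>+\<phi>. ennreal (indicator {0..pi} \<phi> / pi) * ennreal (\<eta>\<^sup>2 * exp ((l * cos \<phi>)\<^sup>2 / (R + 2 * \<gamma>))) \<partial>lborel)
      \<le> (\<integral>\<^sup>+\<phi>. ennreal (K / pi) * ennreal (indicator {0..pi} \<phi> * exp (- (R\<^sup>2 / 2) * (sin \<phi>)\<^sup>2)) \<partial>lborel)"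
    proof (rule nn_integral_mono)
      fix \<phi> :: real
      have "indicator {0..pi} \<phi> / pi * (\<eta>\<^sup>2 * exp ((l * cos \<phi>)\<^sup>2 / (R + 2 * \<gamma>)))
         \<le> indicator {0..pi} \<phi> / pi * (K * exp (- (R\<^sup>2 / 2) * (sin \<phi>)\<^sup>2))"
        by (intro mult_left_mono pointwise) auto
      then show "ennreal (indicator {0..pi} \<phi> / pi) * ennreal (\<eta>\<^sup>2 * exp ((l * cos \<phi>)\<^sup>2 / (R + 2 * \<gamma>)))
         \<le> ennreal (K / pi) * ennreal (indicator {0..pi} \<phi> * exp (- (R\<^sup>2 / 2) * (sin \<phi>)\<^sup>2))"
        using K0 by (simp add: mult_ac ennreal_leI flip: ennreal_mult)
    qed
    also have "\<dots> = ennreal (K / pi) * (\<integral>\<^sup>+\<phi>. ennreal (indicator {0..pi} \<phi> * exp (- (R\<^sup>2 / 2) * (sin \<phi>)\<^sup>2)) \<partial>lborel)"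
      by (rule nn_integral_cmult) measurable
    also have "\<dots> \<le> ennreal (K / pi) * ennreal (8 * sqrt (pi / (R\<^sup>2 / 2)))"
      using R0 by (intro mult_left_mono nn_integral_exp_sin_sq_le) auto
    also have "\<dots> = ennreal (K / pi * (8 * sqrt (pi / (R\<^sup>2 / 2))))"
      using K0 by (subst ennreal_mult[symmetric]) auto
    also have "\<dots> \<le> ennreal \<delta>"
    proof (rule ennreal_leI)
      \<comment> \<open>A slight weakening of the root of 2 pi to pi, so that pi cancels and
        \<delta> comes out exactly.\<close>
      have "sqrt (pi / (R\<^sup>2 / 2)) \<le> pi / R"
      proof (rule real_le_lsqrt)
        have "pi * 2 \<le> pi * pi" using pi_ge_two by (intro mult_left_mono) auto
        then show "pi / (R\<^sup>2 / 2) \<le> (pi / R)\<^sup>2"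
          using R0 by (simp add: power_divide divide_right_mono power2_eq_square)
      qed (use R0 in auto)
      then have "K / pi * (8 * sqrt (pi / (R\<^sup>2 / 2))) \<le> K / pi * (8 * (pi / R))"
        using K0 by (intro mult_left_mono) auto
      also have "\<dots> = \<delta>" using R0 by (simp add: K_def \<delta>_def)
      finally show "K / pi * (8 * sqrt (pi / (R\<^sup>2 / 2))) \<le> \<delta>" .
    qed
    finally show ?thesis .
  qed
  have diff: "plane_density R R \<eta> l (q, p) - plane_density R R 0 l (q, p) = \<epsilon> * gauss 0 R q * sin (r * q) * gauss 0 R p" for q p
  proof -
    have "\<eta> * exp (l\<^sup>2 / (2 * R)) = \<epsilon>"
    proof -
      have "l\<^sup>2 / (2 * R) = R\<^sup>2 / 2" using R0 unfolding l2 by (simp add: power2_eq_square power3_eq_cube)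
      then show ?thesis by (simp add: \<eta>_def mult.assoc exp_add[symmetric])
    qed
    moreover have "l * q / R = r * q" using R0 by (simp add: l_def)
    ultimately show ?thesis by (simp add: plane_density_def modulated_def algebra_simps)
  qed
  note bounds = risk_lower_bounds[OF R0 \<gamma> _ adm0 adm1 \<delta>0 \<delta>n \<delta>_chi What]
  \<comment> \<open>The point \<open>(pi / (2 * r), 0)\<close> is where \<open>sin (r * q)\<close>
    first reaches 1. It lies so far inside the Gaussian of variance \<open>R\<close> that the
    density loses at most a factor exp(-1/2) there.\<close>
  have "\<kappa> * exp (- \<beta> * R) / (4 * pi * r)
      \<le> \<bar>plane_density R R \<eta> l (pi / (2 * r), 0) - plane_density R R 0 l (pi / (2 * r), 0)\<bar>"
  proof -
    have "\<kappa> * exp (- \<beta> * R) / (4 * pi * r) = \<epsilon> * (1 / 2) / (2 * pi * R)"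
      using r by (simp add: \<epsilon>_def power2_eq_square flip: r(2))
    also have "\<dots> \<le> \<epsilon> * exp (- (1 / 2)) / (2 * pi * R)"
      using \<epsilon>0 R0 exp_ge_add_one_self[of "- (1 / 2) :: real"] by (intro divide_right_mono mult_left_mono) auto
    also have "\<dots> \<le> \<epsilon> * exp (- (pi / (2 * r))\<^sup>2 / (2 * R)) / (2 * pi * R)"
    proof -
      have "pi\<^sup>2 \<le> 4\<^sup>2" using pi_less_4 by (intro power_mono) auto
      moreover have "2\<^sup>2 \<le> R\<^sup>2" using R by (intro power_mono) auto
      ultimately have "pi\<^sup>2 / (8 * R\<^sup>2) \<le> 16 / (8 * 4)" by (intro frac_le) auto
      moreover have "(pi / (2 * r))\<^sup>2 / (2 * R) = pi\<^sup>2 / (8 * R\<^sup>2)"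
        using r(2) by (simp add: power_divide power_mult_distrib power2_eq_square)
      ultimately have "(pi / (2 * r))\<^sup>2 / (2 * R) \<le> 1 / 2" by simp
      then show ?thesis using \<epsilon>0 R0 by (intro divide_right_mono mult_left_mono) auto
    qed
    also have "\<dots> = \<bar>plane_density R R \<eta> l (pi / (2 * r), 0) - plane_density R R 0 l (pi / (2 * r), 0)\<bar>"
      unfolding diff using r R0 \<epsilon>0 by (simp add: gauss_def abs_mult)
    finally show ?thesis .
  qed
  then have "ennreal (\<kappa> * exp (- \<beta> * R) / (32 * pi * r))
     \<le> ennreal (\<bar>plane_density R R \<eta> l (pi / (2 * r), 0) - plane_density R R 0 l (pi / (2 * r), 0)\<bar> / 8)"
    by (intro ennreal_leI) (simp add: field_simps)
  also have "\<dots> \<le> (SUP t\<in>admissible_states \<beta> L. sup_risk \<gamma> n What t)"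
    by (rule bounds(1)) (rule amp)
  finally show "ennreal (\<kappa> * exp (- \<beta> * R) / (32 * pi * r))
      \<le> (SUP t\<in>admissible_states \<beta> L. sup_risk \<gamma> n What t)" by simp
  \<comment> \<open>The square of a Gaussian density is this constant times the Gaussian density of
    half the variance, which reduces the L2 norm to Gaussian averages.\<close>
  define C where "C = 1 / (2 * sqrt (pi * R))"
  have C0: "0 < C" "C\<^sup>2 = 1 / (4 * pi * R)" using R0 by (auto simp: C_def power_divide power_mult_distrib)
  have gauss_sq: "(gauss 0 R x)\<^sup>2 = C * gauss 0 (R / 2) x" for x
  proof -
    have "(gauss 0 R x)\<^sup>2 = exp (- x\<^sup>2 / R) / (2 * pi * R)"
      using R0 by (simp add: gauss_def power_divide exp_double[symmetric])
    moreover have "C * gauss 0 (R / 2) x = exp (- x\<^sup>2 / R) / (2 * (sqrt (pi * R) * sqrt (pi * R)))"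
      by (simp add: C_def gauss_def)
    ultimately show ?thesis using R0 by simp
  qed
  have half_R: "0 < R / 2" using R0 by simp
  have int_cos: "integrable lborel (\<lambda>x. cos (2 * r * x) * gauss 0 (R / 2) x)"
    using R0 by (auto intro!: Bochner_Integration.integrable_bound[OF gauss_integrable[OF half_R, of 0]] AE_I2 mult_left_le_one_le simp: abs_mult)
  have sin_sq: "(sin (r * x))\<^sup>2 * gauss 0 (R / 2) x = 1 / 2 * gauss 0 (R / 2) x - 1 / 2 * (cos (2 * r * x) * gauss 0 (R / 2) x)" for x
  proof -
    have "(sin (r * x))\<^sup>2 = 1 / 2 - 1 / 2 * cos (2 * r * x)"
      using cos_double_sin[of "r * x"] unfolding mult.assoc by linarith
    then show ?thesis by (simp add: left_diff_distrib)
  qed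
  have sin_int: "(LINT x|lborel. (sin (r * x))\<^sup>2 * gauss 0 (R / 2) x) = (1 - exp (- R\<^sup>2)) / 2"
  proof -
    have "- (R / 2) * (2 * r)\<^sup>2 / 2 = - R\<^sup>2" using r(2) by (simp add: power_mult_distrib power2_eq_square)
    then show ?thesis unfolding sin_sq using int_cos half_R gauss_cos[OF half_R, of "2 * r" 0] by (simp add: diff_divide_distrib)
  qed
  have sin_integrable: "integrable lborel (\<lambda>x. (sin (r * x))\<^sup>2 * gauss 0 (R / 2) x)"
    unfolding sin_sq using int_cos half_R by auto
  have L2: "L2_norm_sq (\<lambda>z. plane_density R R \<eta> l z - plane_density R R 0 l z)
      = ennreal (\<epsilon>\<^sup>2 * C\<^sup>2 * ((1 - exp (- R\<^sup>2)) / 2))"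
  proof -
    have "L2_norm_sq (\<lambda>z. plane_density R R \<eta> l z - plane_density R R 0 l z)
      = (\<integral>\<^sup>+(q, p). ennreal (\<epsilon>\<^sup>2 * C\<^sup>2 * ((sin (r * q))\<^sup>2 * gauss 0 (R / 2) q)) * ennreal (gauss 0 (R / 2) p) \<partial>lborel)"
      unfolding L2_norm_sq_def
    proof (rule nn_integral_cong, clarify)
      fix q p
      have "(norm (plane_density R R \<eta> l (q, p) - plane_density R R 0 l (q, p)))\<^sup>2
         = \<epsilon>\<^sup>2 * (sin (r * q))\<^sup>2 * ((gauss 0 R q)\<^sup>2 * (gauss 0 R p)\<^sup>2)"
        unfolding diff by (simp add: power_mult_distrib)
      also have "\<dots> = \<epsilon>\<^sup>2 * C\<^sup>2 * ((sin (r * q))\<^sup>2 * gauss 0 (R / 2) q) * gauss 0 (R / 2) p"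
        unfolding gauss_sq by (simp add: power2_eq_square)
      finally show "ennreal ((norm (plane_density R R \<eta> l (q, p) - plane_density R R 0 l (q, p)))\<^sup>2)
         = ennreal (\<epsilon>\<^sup>2 * C\<^sup>2 * ((sin (r * q))\<^sup>2 * gauss 0 (R / 2) q)) * ennreal (gauss 0 (R / 2) p)"
        using half_R by (simp add: ennreal_mult)
    qed
    also have "\<dots> = (\<integral>\<^sup>+q. ennreal (\<epsilon>\<^sup>2 * C\<^sup>2 * ((sin (r * q))\<^sup>2 * gauss 0 (R / 2) q)) \<partial>lborel) * (\<integral>\<^sup>+p. ennreal (gauss 0 (R / 2) p) \<partial>lborel)"
      by (rule nn_integral_lborel_prod_mult) measurable
    also have "\<dots> = ennreal (LINT q|lborel. \<epsilon>\<^sup>2 * C\<^sup>2 * ((sin (r * q))\<^sup>2 * gauss 0 (R / 2) q))"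
      using half_R sin_integrable by (subst nn_integral_eq_integral) auto
    finally show ?thesis by (simp add: sin_int)
  qed
  have "\<kappa>\<^sup>2 * exp (- 2 * \<beta> * R) / (16 * pi) \<le> \<epsilon>\<^sup>2 * C\<^sup>2 * ((1 - exp (- R\<^sup>2)) / 2)"
  proof -
    \<comment> \<open>The squared sine averages to \<open>(1 - exp (- R^2)) / 2\<close>; this keeps
      the average at least 1/4.\<close>
    have "1 + 1 \<le> 1 + R\<^sup>2" using R by (simp add: one_le_power)
    also have "\<dots> \<le> exp (R\<^sup>2)" by (rule exp_ge_add_one_self)
    finally have "exp (- R\<^sup>2) \<le> 1 / 2" by (simp add: exp_minus field_simps)
    then have "\<epsilon>\<^sup>2 * C\<^sup>2 * (1 / 4) \<le> \<epsilon>\<^sup>2 * C\<^sup>2 * ((1 - exp (- R\<^sup>2)) / 2)"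
      by (intro mult_left_mono) auto
    moreover have "\<epsilon>\<^sup>2 * C\<^sup>2 * (1 / 4) = \<kappa>\<^sup>2 * exp (- 2 * \<beta> * R) / (16 * pi)"
      using R0 by (simp add: \<epsilon>2 C0)
    ultimately show ?thesis by (simp only:)
  qed
  then have "ennreal (\<kappa>\<^sup>2 * exp (- 2 * \<beta> * R) / (16 * pi)) \<le> L2_norm_sq (\<lambda>z. plane_density R R \<eta> l z - plane_density R R 0 l z)"
    unfolding L2 by (rule ennreal_leI)
  from bounds(2)[OF amp _ this]
  show "ennreal (\<kappa>\<^sup>2 * exp (- 2 * \<beta> * R) / (256 * pi))
      \<le> (SUP t\<in>admissible_states \<beta> L. L2_risk \<gamma> n What t)"
    by simp
qed

theorem theorem2:
  fixes \<beta> \<gamma> L :: real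
  assumes "0 \<le> \<gamma>" and "\<gamma> < 1/4" and "0 < \<beta>" and "0 < L"
  shows "\<exists>c::real>0. \<exists>N::nat. \<forall>n\<ge>N.
    (INF What\<in>estimators n. SUP (\<rho>, W, p)\<in>admissible_states \<beta> L.
       \<integral>\<^sup>+s. sup_norm (\<lambda>z. What s z - W z) \<partial>sample_law \<gamma> p n)
      \<ge> ennreal (c * real n powr (- (\<beta> / (2 * (\<beta> + \<gamma>)))) * ln (real n) powr (- (3/2))) \<and>
    (INF What\<in>estimators n. SUP (\<rho>, W, p)\<in>admissible_states \<beta> L.
       \<integral>\<^sup>+s. L2_norm_sq (\<lambda>z. What s z - W z) \<partial>sample_law \<gamma> p n)
      \<ge> ennreal (c * real n powr (- (\<beta> / (\<beta> + \<gamma>))))"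
proof -
  define \<kappa> where "\<kappa> = sqrt (min (L / exp (8 * \<beta>\<^sup>2)) (1 / (24 * exp (4 * \<gamma>\<^sup>2))))"
  have "0 < min (L / exp (8 * \<beta>\<^sup>2)) (1 / (24 * exp (4 * \<gamma>\<^sup>2)))" using assms by simp
  then have \<kappa>0: "0 < \<kappa>" and \<kappa>2: "\<kappa>\<^sup>2 = min (L / exp (8 * \<beta>\<^sup>2)) (1 / (24 * exp (4 * \<gamma>\<^sup>2)))"
    unfolding \<kappa>_def by (auto simp del: min_less_iff_conj)
  have "\<kappa>\<^sup>2 \<le> L / exp (8 * \<beta>\<^sup>2)" "\<kappa>\<^sup>2 \<le> 1 / (24 * exp (4 * \<gamma>\<^sup>2))" unfolding \<kappa>2 by auto
  then have \<kappa>L: "\<kappa>\<^sup>2 * exp (8 * \<beta>\<^sup>2) \<le> L" and \<kappa>\<gamma>: "\<kappa>\<^sup>2 * exp (4 * \<gamma>\<^sup>2) \<le> 1 / 24"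
    by (auto simp: field_simps)
  define s where "s = 2 * (\<beta> + \<gamma>)"
  have s: "0 < s" using assms by (simp add: s_def)
  define c where "c = min (\<kappa> * sqrt s / (32 * pi)) (\<kappa>\<^sup>2 / (256 * pi))"
  have c: "0 < c" using \<kappa>0 s by (simp add: c_def)
  \<comment> \<open>A sum of positive thresholds, so exceeding it meets every requirement on the
    radius at once. The summand \<open>1 / s\<close> makes \<open>ln (real n)\<close> at least 1,
    which the comparison of logarithmic powers needs.\<close>
  define R0 where "R0 = 2 + 4 * \<beta> + 2 * \<gamma> + 1 / (2 * \<beta>) + 2 / L + 2 * \<kappa> * exp (\<beta>\<^sup>2 / 4) / (3 / 4 * \<beta>)\<^sup>2 + 1 / s"
  define N where "N = nat \<lceil>exp (s * R0)\<rceil>"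
  show ?thesis
  proof (intro exI[of _ c] conjI exI[of _ N] allI impI c)
    fix n assume "N \<le> n"
    then have "exp (s * R0) \<le> real n" unfolding N_def by linarith
    then have n0: "0 < real n" using exp_gt_zero[of "s * R0"] by linarith
    have "s * R0 \<le> ln (real n)" using \<open>exp (s * R0) \<le> real n\<close> n0 by (simp add: ln_ge_iff)
    define R r where "R = ln (real n) / s" and "r = sqrt R"
    have lnR: "ln (real n) = s * R" using s by (simp add: R_def)
    have "R0 \<le> R" using \<open>s * R0 \<le> ln (real n)\<close> s by (simp add: lnR)
    moreover have "0 \<le> 4 * \<beta>" "0 \<le> 2 * \<gamma>" "0 < 1 / (2 * \<beta>)" "0 < 2 / L" "0 < 1 / s"
      "0 < 2 * \<kappa> * exp (\<beta>\<^sup>2 / 4) / (3 / 4 * \<beta>)\<^sup>2"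
      using assms s \<kappa>0 by auto
    ultimately have R: "2 \<le> R" "4 * \<beta> \<le> R" "2 * \<gamma> \<le> R" "1 / (2 * \<beta>) < R" "2 / L \<le> R" "1 / s \<le> R"
      "2 * \<kappa> * exp (\<beta>\<^sup>2 / 4) / (3 / 4 * \<beta>)\<^sup>2 \<le> R"
      unfolding R0_def by linarith+
    have R6: "2 * \<kappa> * exp (\<beta>\<^sup>2 / 4) \<le> (3 / 4 * \<beta>)\<^sup>2 * R"
      using R(7) assms(3) by (subst (asm) pos_divide_le_eq) (auto simp: mult.commute)
    have r: "0 < r" "r\<^sup>2 = R" using R(1) by (auto simp: r_def)
    have ln1: "1 \<le> ln (real n)" using R(6) s by (simp add: lnR field_simps)
    note lower = risk_lower_bounds_at_radius[OF assms(1,3,4) \<kappa>0 \<kappa>L \<kappa>\<gamma> r R(1-5) R6, of n]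
    have nR: "0 < n" "2 * (\<beta> + \<gamma>) * R = ln (real n)" using n0 by (auto simp: lnR s_def)
    have exp_R: "exp (- \<beta> * R) = real n powr (- (\<beta> / (2 * (\<beta> + \<gamma>))))"
      "exp (- 2 * \<beta> * R) = real n powr (- (\<beta> / (\<beta> + \<gamma>)))"
      using n0 assms by (simp_all add: powr_def R_def s_def field_simps)
    have rate: "c * real n powr (- (\<beta> / (2 * (\<beta> + \<gamma>)))) * ln (real n) powr (- (3/2)) \<le> \<kappa> * exp (- \<beta> * R) / (32 * pi * r)"
    proof -
      \<comment> \<open>The construction yields the exponent -1/2 of the logarithm, from
        \<open>1 / r\<close>; as \<open>ln (real n)\<close> is at least 1, this implies the stated
        exponent.\<close>
      have "ln (real n) powr (- (3/2)) \<le> ln (real n) powr (- (1/2))" using ln1 by (intro powr_mono) auto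
      also have "\<dots> = 1 / sqrt (ln (real n))" using ln1 by (simp add: powr_minus powr_half_sqrt inverse_eq_divide)
      also have "\<dots> = 1 / (sqrt s * r)" by (simp add: lnR real_sqrt_mult r_def)
      finally have "c * real n powr (- (\<beta> / (2 * (\<beta> + \<gamma>)))) * ln (real n) powr (- (3/2))
        \<le> (\<kappa> * sqrt s / (32 * pi)) * real n powr (- (\<beta> / (2 * (\<beta> + \<gamma>)))) * (1 / (sqrt s * r))"
        using c \<kappa>0 s by (intro mult_mono) (auto simp: c_def)
      also have "\<dots> = \<kappa> * exp (- \<beta> * R) / (32 * pi * r)" unfolding exp_R using s by simp
      finally show ?thesis .
    qed
    show "ennreal (c * real n powr (- (\<beta> / (2 * (\<beta> + \<gamma>)))) * ln (real n) powr (- (3/2)))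
      \<le> (INF What\<in>estimators n. SUP (\<rho>, W, p)\<in>admissible_states \<beta> L.
         \<integral>\<^sup>+s. sup_norm (\<lambda>z. What s z - W z) \<partial>sample_law \<gamma> p n)"
      by (rule INF_greatest) (rule order_trans[OF ennreal_leI[OF rate] lower(1)[OF nR]])
    have "c * real n powr (- (\<beta> / (\<beta> + \<gamma>))) \<le> \<kappa>\<^sup>2 * exp (- 2 * \<beta> * R) / (256 * pi)"
    proof -
      have "c * real n powr (- (\<beta> / (\<beta> + \<gamma>))) \<le> \<kappa>\<^sup>2 / (256 * pi) * real n powr (- (\<beta> / (\<beta> + \<gamma>)))"
        by (intro mult_right_mono) (auto simp: c_def)
      then show ?thesis unfolding exp_R by simp
    qed
    note rate2 = this
    show "ennreal (c * real n powr (- (\<beta> / (\<beta> + \<gamma>))))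
      \<le> (INF What\<in>estimators n. SUP (\<rho>, W, p)\<in>admissible_states \<beta> L.
         \<integral>\<^sup>+s. L2_norm_sq (\<lambda>z. What s z - W z) \<partial>sample_law \<gamma> p n)"
      by (rule INF_greatest) (rule order_trans[OF ennreal_leI[OF rate2] lower(2)[OF nR]])
  qed
qed

end
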